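(* Let $n\ge 2$ and let $X$ be a conjugacy class of involutions in the group $G_n$ of type $\tilde C_n$. If the commuting graph $\mathcal{C}(G_n,X)$ is connected, then its diameter is at most $n+2$.
   Context: For $n\ge 2$, let $W_n$ be the Coxeter (Weyl) group of type $C_n$, i.e. the group of signed permutations acting (on the right) on $\mathbb{R}^n$ by permuting the subscripts of the standard basis vectors $e_1,\dots,e_n$ and changing their signs. $G_n$ is the affine Weyl group of type $\tilde C_n$, the semidirect product of $W_n$ with $\mathbb{Z}^n$ (the coroot lattice): its elements are pairs $(\sigma,\mathbf v)$ with $\sigma\in W_n$, $\mathbf v\in\mathbb{Z}^n$, and the product is $(\alpha,\mathbf v)(\tau,\mathbf u)=(\alpha\tau,\mathbf v^{\tau}+\mathbf u)$. An involution is an element of order exactly 2. For $X$ a conjugacy class of involutions of $G_n$, the commuting graph $\mathcal{C}(G_n,X)$ has vertex set $X$, with two distinct vertices $x,y$ joined by an edge whenever $xy=yx$. The diameter of a connected graph is the maximum graph distance $d(x,y)$ between two vertices. *)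

theory Defs
  imports
    "HOL-Combinatorics.Permutations"
    "HOL-Algebra.Multiplicative_Group"
    "HOL-Algebra.Group_Action"
    "Graph_Theory.Graph_Theory"
begin

section \<open>Commuting graphs\<close>

definition conjugacy_classes :: "('a, 'b) monoid_scheme \<Rightarrow> 'a set set" where
  "conjugacy_classes G =
     orbits G (carrier G) (\<lambda>g. \<lambda>h\<in>carrier G. g \<otimes>\<^bsub>G\<^esub> h \<otimes>\<^bsub>G\<^esub> inv\<^bsub>G\<^esub> g)"

definition involution :: "('a, 'b) monoid_scheme \<Rightarrow> 'a \<Rightarrow> bool" where
  "involution G x \<longleftrightarrow> x \<in> carrier G \<and> group.ord G x = 2"

text \<open>
  Undirected graphs are represented, as usual in this library, by digraphs with a symmetric
  set of arcs.
\<close>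

definition commuting_graph :: "('a, 'b) monoid_scheme \<Rightarrow> 'a set \<Rightarrow> 'a pair_pre_digraph" where
  "commuting_graph G X =
     \<lparr> pverts = X,
       parcs = {(x, y). x \<in> X \<and> y \<in> X \<and> x \<noteq> y \<and> x \<otimes>\<^bsub>G\<^esub> y = y \<otimes>\<^bsub>G\<^esub> x} \<rparr>"

text \<open>
  With all weights equal to 1, the cost of a walk is its length.  The supremum below is taken in
  the extended reals; in a connected graph all distances are natural numbers, so that a finite
  supremum is the maximum distance.
\<close>

definition graph_dist :: "('a, 'b) pre_digraph \<Rightarrow> 'a \<Rightarrow> 'a \<Rightarrow> ereal" where
  "graph_dist D x y = wf_digraph.\<mu> D (\<lambda>_. 1) x y"

definition graph_diameter :: "('a, 'b) pre_digraph \<Rightarrow> ereal" where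
  "graph_diameter D = (SUP x\<in>verts D. SUP y\<in>verts D. graph_dist D x y)"

lemma pair_wf_digraph_commuting_graph: "pair_wf_digraph (commuting_graph G X)"
  by unfold_locales (auto simp: commuting_graph_def)

lemma symmetric_commuting_graph: "symmetric (commuting_graph G X)"
  by (auto simp: symmetric_def commuting_graph_def intro!: symI)


section \<open>The group of signed permutations\<close>

text \<open>
  A signed permutation is a permutation \<open>\<sigma>\<close> of \<open>{\<plusminus>1, \<dots>, \<plusminus>n}\<close> with \<open>\<sigma>(-i) = -\<sigma>(i)\<close>; it sends
  \<open>e\<^sub>i\<close> to \<open>e\<^bsub>\<sigma>(i)\<^esub>\<close>, where \<open>e\<^bsub>-i\<^esub> = -e\<^sub>i\<close>.  Signed permutations act on the right, so that
  in a product the left factor is applied first.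
\<close>

definition signed_indices :: "nat \<Rightarrow> int set" where
  "signed_indices n = {i. i \<noteq> 0 \<and> \<bar>i\<bar> \<le> int n}"

definition signed_perm_group :: "nat \<Rightarrow> (int \<Rightarrow> int) monoid" where
  "signed_perm_group n =
     \<lparr> carrier = {\<sigma>. \<sigma> permutes signed_indices n \<and> (\<forall>i. \<sigma> (- i) = - \<sigma> i)},
       monoid.mult = (\<lambda>\<alpha> \<tau>. \<tau> \<circ> \<alpha>),
       monoid.one = id \<rparr>"

text \<open>
  The integral vectors with \<open>n\<close> coordinates are the functions vanishing off \<open>{1..n}\<close>.
\<close>

definition int_vectors :: "nat \<Rightarrow> (nat \<Rightarrow> int) set" where
  "int_vectors n = {v. \<forall>i. i \<notin> {1..n} \<longrightarrow> v i = 0}"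

definition signed_basis :: "int \<Rightarrow> nat \<Rightarrow> int" where
  "signed_basis k = (\<lambda>j. if int j = \<bar>k\<bar> then sgn k else 0)"

text \<open>The linear extension of \<open>e\<^sub>i \<mapsto> e\<^bsub>\<sigma>(i)\<^esub>\<close>.\<close>

definition signed_perm_act :: "nat \<Rightarrow> (nat \<Rightarrow> int) \<Rightarrow> (int \<Rightarrow> int) \<Rightarrow> nat \<Rightarrow> int" where
  "signed_perm_act n v \<sigma> = (\<lambda>j. \<Sum>i = 1..n. v i * signed_basis (\<sigma> (int i)) j)"


section \<open>The affine Weyl group of type C\<close>

definition affine_C :: "nat \<Rightarrow> ((int \<Rightarrow> int) \<times> (nat \<Rightarrow> int)) monoid" where
  "affine_C n =
     \<lparr> carrier = carrier (signed_perm_group n) \<times> int_vectors n,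
       monoid.mult = (\<lambda>(\<alpha>, v) (\<tau>, u).
         (\<alpha> \<otimes>\<^bsub>signed_perm_group n\<^esub> \<tau>, \<lambda>j. signed_perm_act n v \<tau> j + u j)),
       monoid.one = (\<one>\<^bsub>signed_perm_group n\<^esub>, \<lambda>_. 0) \<rparr>"

lemma group_signed_perm_group: "group (signed_perm_group n)"
proof (rule groupI)
  fix \<sigma> assume "\<sigma> \<in> carrier (signed_perm_group n)"
  then have p: "\<sigma> permutes signed_indices n" and odd: "\<And>i. \<sigma> (- i) = - \<sigma> i"
    by (auto simp: signed_perm_group_def)
  have "inv_into UNIV \<sigma> (- i) = - inv_into UNIV \<sigma> i" for i
    using odd[of "inv_into UNIV \<sigma> i"] permutes_inverses[OF p] by metis
  with p have "inv_into UNIV \<sigma> \<in> carrier (signed_perm_group n)"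
    by (auto simp: signed_perm_group_def permutes_inv)
  moreover have "inv_into UNIV \<sigma> \<otimes>\<^bsub>signed_perm_group n\<^esub> \<sigma> = \<one>\<^bsub>signed_perm_group n\<^esub>"
    using permutes_inv_o(1)[OF p] by (simp add: signed_perm_group_def)
  ultimately show "\<exists>\<tau>\<in>carrier (signed_perm_group n).
      \<tau> \<otimes>\<^bsub>signed_perm_group n\<^esub> \<sigma> = \<one>\<^bsub>signed_perm_group n\<^esub>" by blast
qed (auto simp: signed_perm_group_def permutes_compose permutes_id o_assoc)

lemma signed_perm_in_signed_indices:
  assumes "\<sigma> \<in> carrier (signed_perm_group n)" "i \<in> signed_indices n"
  shows "\<sigma> i \<in> signed_indices n"
  using assms permutes_in_image by (fastforce simp: signed_perm_group_def)

lemma signed_perm_act_closed: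
  assumes "\<sigma> \<in> carrier (signed_perm_group n)"
  shows "signed_perm_act n v \<sigma> \<in> int_vectors n"
proof -
  have "signed_basis (\<sigma> (int i)) j = 0" if "i \<in> {1..n}" "j \<notin> {1..n}" for i j
    using signed_perm_in_signed_indices[OF assms, of "int i"] that
    by (auto simp: signed_indices_def signed_basis_def)
  then show ?thesis
    by (auto simp: int_vectors_def signed_perm_act_def intro!: sum.neutral)
qed

lemma signed_perm_act_add:
  "signed_perm_act n (\<lambda>j. v j + u j) \<sigma> = (\<lambda>j. signed_perm_act n v \<sigma> j + signed_perm_act n u \<sigma> j)"
  by (simp add: signed_perm_act_def distrib_right sum.distrib)

lemma signed_perm_act_basis:
  assumes "\<sigma> \<in> carrier (signed_perm_group n)" "m \<in> signed_indices n"
  shows "signed_perm_act n (signed_basis m) \<sigma> = signed_basis (\<sigma> m)"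
proof
  fix j
  have odd: "\<sigma> (- i) = - \<sigma> i" for i
    using assms(1) by (simp add: signed_perm_group_def)
  have "signed_perm_act n (signed_basis m) \<sigma> j
      = (\<Sum>i = 1..n. if i = nat \<bar>m\<bar> then sgn m * signed_basis (\<sigma> \<bar>m\<bar>) j else 0)"
    unfolding signed_perm_act_def by (intro sum.cong) (auto simp: signed_basis_def)
  also have "\<dots> = sgn m * signed_basis (\<sigma> \<bar>m\<bar>) j"
    using assms(2) by (auto simp: signed_indices_def)
  also have "\<dots> = signed_basis (\<sigma> m) j"
    using assms(2) odd[of m]
    by (cases "m > 0") (auto simp: signed_indices_def signed_basis_def sgn_if)
  finally show "signed_perm_act n (signed_basis m) \<sigma> j = signed_basis (\<sigma> m) j" .
qed

lemma signed_perm_act_mult: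
  assumes "\<alpha> \<in> carrier (signed_perm_group n)" "\<tau> \<in> carrier (signed_perm_group n)"
  shows "signed_perm_act n (signed_perm_act n v \<alpha>) \<tau>
       = signed_perm_act n v (\<alpha> \<otimes>\<^bsub>signed_perm_group n\<^esub> \<tau>)"
proof
  fix j
  have "signed_perm_act n (signed_perm_act n v \<alpha>) \<tau> j
      = (\<Sum>k = 1..n. \<Sum>i = 1..n.
          v k * signed_basis (\<alpha> (int k)) i * signed_basis (\<tau> (int i)) j)"
    unfolding signed_perm_act_def sum_distrib_right by (rule sum.swap)
  also have "\<dots> = (\<Sum>k = 1..n. v k * signed_perm_act n (signed_basis (\<alpha> (int k))) \<tau> j)"
    by (simp add: signed_perm_act_def sum_distrib_left mult.assoc)
  also have "\<dots> = (\<Sum>k = 1..n. v k * signed_basis (\<tau> (\<alpha> (int k))) j)"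
  proof (intro sum.cong refl)
    fix k assume "k \<in> {1..n}"
    then have "\<alpha> (int k) \<in> signed_indices n"
      by (intro signed_perm_in_signed_indices[OF assms(1)]) (auto simp: signed_indices_def)
    then show "v k * signed_perm_act n (signed_basis (\<alpha> (int k))) \<tau> j
        = v k * signed_basis (\<tau> (\<alpha> (int k))) j"
      by (simp add: signed_perm_act_basis[OF assms(2)])
  qed
  also have "\<dots> = signed_perm_act n v (\<alpha> \<otimes>\<^bsub>signed_perm_group n\<^esub> \<tau>) j"
    by (simp add: signed_perm_act_def signed_perm_group_def)
  finally show "signed_perm_act n (signed_perm_act n v \<alpha>) \<tau> j
      = signed_perm_act n v (\<alpha> \<otimes>\<^bsub>signed_perm_group n\<^esub> \<tau>) j" .
qed

lemma signed_perm_act_one: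
  assumes "v \<in> int_vectors n"
  shows "signed_perm_act n v \<one>\<^bsub>signed_perm_group n\<^esub> = v"
proof
  fix j
  have "signed_perm_act n v \<one>\<^bsub>signed_perm_group n\<^esub> j = (\<Sum>i = 1..n. if i = j then v j else 0)"
    unfolding signed_perm_act_def
    by (intro sum.cong) (auto simp: signed_perm_group_def signed_basis_def)
  then show "signed_perm_act n v \<one>\<^bsub>signed_perm_group n\<^esub> j = v j"
    using assms by (auto simp: int_vectors_def)
qed

lemma group_affine_C: "group (affine_C n)"
proof -
  interpret W: group "signed_perm_group n" by (rule group_signed_perm_group)
  show ?thesis
  proof (rule groupI)
    fix x y assume "x \<in> carrier (affine_C n)" "y \<in> carrier (affine_C n)"
    then show "x \<otimes>\<^bsub>affine_C n\<^esub> y \<in> carrier (affine_C n)"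
      using signed_perm_act_closed[of _ n]
      by (auto simp: affine_C_def int_vectors_def)
  next
    show "\<one>\<^bsub>affine_C n\<^esub> \<in> carrier (affine_C n)"
      by (auto simp: affine_C_def int_vectors_def)
  next
    fix x y z
    assume "x \<in> carrier (affine_C n)" "y \<in> carrier (affine_C n)" "z \<in> carrier (affine_C n)"
    then show "x \<otimes>\<^bsub>affine_C n\<^esub> y \<otimes>\<^bsub>affine_C n\<^esub> z
        = x \<otimes>\<^bsub>affine_C n\<^esub> (y \<otimes>\<^bsub>affine_C n\<^esub> z)"
      by (auto simp: affine_C_def W.m_assoc signed_perm_act_add signed_perm_act_mult add.assoc)
  next
    fix x assume "x \<in> carrier (affine_C n)"
    then show "\<one>\<^bsub>affine_C n\<^esub> \<otimes>\<^bsub>affine_C n\<^esub> x = x"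
      by (auto simp: affine_C_def signed_perm_act_def)
  next
    fix x assume "x \<in> carrier (affine_C n)"
    then obtain \<sigma> v where x: "x = (\<sigma>, v)"
      and s: "\<sigma> \<in> carrier (signed_perm_group n)" and v: "v \<in> int_vectors n"
      by (auto simp: affine_C_def)
    define w where "w = (\<lambda>j. - v j)"
    define \<rho> where "\<rho> = inv\<^bsub>signed_perm_group n\<^esub> \<sigma>"
    have r: "\<rho> \<in> carrier (signed_perm_group n)" and w: "w \<in> int_vectors n"
      using s v by (auto simp: \<rho>_def w_def int_vectors_def)
    have "(\<rho>, signed_perm_act n w \<rho>) \<otimes>\<^bsub>affine_C n\<^esub> x = \<one>\<^bsub>affine_C n\<^esub>"
      using s w
      by (simp add: affine_C_def x signed_perm_act_mult[OF r s])
         (simp add: \<rho>_def signed_perm_act_one, simp add: w_def)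
    moreover have "(\<rho>, signed_perm_act n w \<rho>) \<in> carrier (affine_C n)"
      using r by (simp add: affine_C_def signed_perm_act_closed)
    ultimately show "\<exists>y\<in>carrier (affine_C n). y \<otimes>\<^bsub>affine_C n\<^esub> x = \<one>\<^bsub>affine_C n\<^esub>"
      by blast
  qed
qed

end

theory Submission
  imports Defs
begin

text \<open>
  An involution of the group permutes the \<open>n\<close> coordinate lines. On each line it is the identity
  (a hole), an even or an odd reflection (a token of one of two colours), or it exchanges the line
  with another one (a link). Conjugacy of involutions means that the numbers of lines of each of
  these four kinds agree. Commuting with a given involution allows few local changes: a link
  changes its orientation and offset; a link \<open>{i, j}\<close> and two lines \<open>k, l\<close> of one kind exchange
  their roles; a token hops to a hole; two links \<open>{i, p}, {j, r}\<close> are regrouped into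
  \<open>{i, j}, {p, r}\<close>.

  If these moves fail to join the whole class, an invariant shows that the commuting graph is
  disconnected. Otherwise \<open>y\<close> is reached from \<open>x\<close> by making lines, or links, agree with \<open>y\<close> one
  after another and removing them; the bound \<open>n + 2\<close> follows by induction on the number of lines.
  As long as there are at least two links, a link of \<open>y\<close> can be created in two moves, which is
  exactly what its two lines allow. So the delicate cases are those with a single link, where the
  moves must be chosen such that later lines are repaired along the way.
\<close>

section \<open>Involutions as arrangements of lines\<close>

text \<open>The whole difficulty is the surplus over one move per line. Hopping tokens pay one extra
  move per colour present, and there are two colours because conjugation by a translation preserves
  just the parity of the label of a reflection. A link of the target costs two moves and settles two
  lines, so removing links leaves the surplus unchanged. Two obstacles prevent a plain induction. A
  line that is the only one of its kind cannot enter an exchange, so a link of the target that ends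
  there cannot be made directly. Moreover, removing a link may lead from a connected class to a
  disconnected one, for instance to one link and two tokens. Hence small numbers of links need
  explicit paths with exact budgets. They rest on two devices: a line vacated by a link may choose
  its label, and so takes its final one whenever possible; and since distance is symmetric, a
  position that is bad for the way from \<open>x\<close> to \<open>y\<close> may be treated on the
  way from \<open>y\<close> to \<open>x\<close>.\<close>

text \<open>
  \<open>x i = (j, s, v)\<close> means that \<open>x\<close> maps the line \<open>i\<close> to the line \<open>j\<close> by \<open>c \<mapsto> s * c + v\<close>. In a
  composition the left factor is applied first, as in the group.
\<close>

type_synonym lmap = "nat \<Rightarrow> nat \<times> int \<times> int"

definition lcomp :: "lmap \<Rightarrow> lmap \<Rightarrow> lmap" where
  "lcomp x y i = (case x i of (j, s, v) \<Rightarrow> case y j of (k, t, w) \<Rightarrow> (k, s * t, t * v + w))"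

definition conf :: "nat set \<Rightarrow> lmap \<Rightarrow> bool" where
  "conf A x \<longleftrightarrow> (\<forall>i\<in>A. fst (x i) \<in> A \<and> (fst (snd (x i)) = 1 \<or> fst (snd (x i)) = -1)
      \<and> lcomp x x i = (i, 1, 0))"

text \<open>The kinds of lines: 0 hole, 1 even reflection, 2 odd reflection, 3 end of a link.\<close>

definition lkind :: "lmap \<Rightarrow> nat \<Rightarrow> nat" where
  "lkind x i = (case x i of (j, s, v) \<Rightarrow>
      if j \<noteq> i then 3 else if s = 1 then 0 else if even v then 1 else 2)"

definition kset :: "nat set \<Rightarrow> lmap \<Rightarrow> nat \<Rightarrow> nat set" where
  "kset A x q = {i \<in> A. lkind x i = q}"

text \<open>The combinatorial substitute for conjugacy; \<open>sim_twine\<close> and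
  \<open>twine_sim\<close> justify it.\<close>

definition sim :: "nat set \<Rightarrow> lmap \<Rightarrow> lmap \<Rightarrow> bool" where
  "sim A x y \<longleftrightarrow> (\<forall>q. card (kset A x q) = card (kset A y q))"

text \<open>Equality of \<open>x\<close> and \<open>y\<close> is allowed, so that
  \<open>reach A k\<close> expresses distance at most \<open>k\<close> and is monotone in
  \<open>k\<close>.\<close>

definition step :: "nat set \<Rightarrow> lmap \<Rightarrow> lmap \<Rightarrow> bool" where
  "step A x y \<longleftrightarrow> conf A x \<and> conf A y \<and> (\<forall>i\<in>A. lcomp x y i = lcomp y x i) \<and> sim A x y"

fun reach :: "nat set \<Rightarrow> nat \<Rightarrow> lmap \<Rightarrow> lmap \<Rightarrow> bool" where
  "reach A 0 x y \<longleftrightarrow> conf A x \<and> (\<forall>i\<in>A. x i = y i)"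
| "reach A (Suc k) x y \<longleftrightarrow> (\<exists>z. step A x z \<and> reach A k z y)"

text \<open>The way back must be the inverse of \<open>c \<mapsto> s * c + v\<close>. For
  \<open>j = i\<close> this forces \<open>v = 0\<close> if \<open>s = 1\<close> and leaves
  \<open>v\<close> free if \<open>s = -1\<close>.\<close>

lemma conf_link:
  assumes "conf A x" "i \<in> A" "x i = (j, s, v)"
  shows "j \<in> A" "s = 1 \<or> s = -1" "x j = (i, s, - s * v)"
proof -
  show "j \<in> A" and s: "s = 1 \<or> s = -1"
    using assms(1,2) unfolding conf_def by (auto simp: assms(3) dest!: bspec)
  obtain k t w where j: "x j = (k, t, w)" by (metis prod.exhaust)
  have "lcomp x x i = (i, 1, 0)" using assms by (auto simp: conf_def)
  then have "k = i" "s * t = 1" "t * v + w = 0" by (auto simp: lcomp_def assms j)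
  with s j show "x j = (i, s, - s * v)" by auto
qed

lemma lkind_le: "lkind x i \<le> 3" by (auto simp: lkind_def split: prod.split)

lemma lkind3: "lkind x i = 3 \<longleftrightarrow> fst (x i) \<noteq> i"
  by (auto simp: lkind_def split: prod.split)

lemma lkind0D: "conf A x \<Longrightarrow> i \<in> A \<Longrightarrow> lkind x i = 0 \<Longrightarrow> x i = (i, 1, 0)"
  using conf_link(3)[of A x i i] by (cases "x i") (auto simp: lkind_def split: if_splits)

lemma lkind12D:
  "conf A x \<Longrightarrow> i \<in> A \<Longrightarrow> lkind x i = q \<Longrightarrow> q = 1 \<or> q = 2 \<Longrightarrow> 
    \<exists>c. x i = (i, -1, c) \<and> (even c \<longleftrightarrow> q = 1)"
  using conf_link(2)[of A x i] by (cases "x i") (auto simp: lkind_def split: if_splits)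

lemma lkind3D:
  "conf A x \<Longrightarrow> i \<in> A \<Longrightarrow> lkind x i = 3 \<Longrightarrow> 
    \<exists>j s v. x i = (j, s, v) \<and> j \<in> A \<and> j \<noteq> i \<and> (s = 1 \<or> s = -1) \<and> x j = (i, s, - s * v) \<and> lkind x j = 3"
proof -
  assume a: "conf A x" "i \<in> A" "lkind x i = 3"
  obtain j s v where x: "x i = (j, s, v)" by (metis prod.exhaust)
  show ?thesis using conf_link[OF a(1,2) x] a(3) x by (auto simp: lkind3)
qed

lemma lkind_cases:
  assumes "conf A x" "i \<in> A"
  obtains "lkind x i = 0" "x i = (i, 1, 0)"
  | c where "lkind x i = (if even c then 1 else 2)" "x i = (i, -1, c)"
  | j s v where "lkind x i = 3" "x i = (j, s, v)" "j \<in> A" "j \<noteq> i" "s = 1 \<or> s = -1" "x j = (i, s, - s * v)" "lkind x j = 3"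
proof -
  consider "lkind x i = 0" | "lkind x i = 1 \<or> lkind x i = 2" | "lkind x i = 3"
    using lkind_le[of x i] by linarith
  then show ?thesis
  proof cases
    case 1
    then show ?thesis using lkind0D[OF assms] that(1) by blast
  next
    case 2
    then obtain c where "x i = (i, -1, c)" using lkind12D[OF assms refl] by blast
    then show ?thesis using that(2) by (simp add: lkind_def)
  next
    case 3
    then show ?thesis using lkind3D[OF assms] that(3) by blast
  qed
qed

lemma finite_kset [simp]: "finite A \<Longrightarrow> finite (kset A x q)" by (simp add: kset_def)

lemma kset_iff: "i \<in> kset A x q \<longleftrightarrow> i \<in> A \<and> lkind x i = q" by (simp add: kset_def)

lemma kset_sub: "kset A x q \<subseteq> A" by (auto simp: kset_def)

lemma kset_empty [simp]: "kset {} x q = {}" by (simp add: kset_def)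

lemma card_kset_insert:
  "finite B \<Longrightarrow> a \<notin> B \<Longrightarrow> card (kset (insert a B) x q) = (if lkind x a = q then 1 else 0) + card (kset B x q)"
proof -
  assume B: "finite B" "a \<notin> B"
  have "kset (insert a B) x q = (if lkind x a = q then insert a (kset B x q) else kset B x q)"
    by (auto simp: kset_def)
  then show ?thesis using B by (auto simp: kset_iff)
qed

lemma card_kset_Un:
  "finite B \<Longrightarrow> finite C \<Longrightarrow> B \<inter> C = {} \<Longrightarrow> card (kset (B \<union> C) x q) = card (kset B x q) + card (kset C x q)"
proof -
  assume *: "finite B" "finite C" "B \<inter> C = {}"
  have "kset (B \<union> C) x q = kset B x q \<union> kset C x q" by (auto simp: kset_def)
  moreover have "kset B x q \<inter> kset C x q = {}" using * by (auto simp: kset_def)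
  ultimately show ?thesis using * by (simp add: card_Un_disjoint)
qed

lemma card_kset_Diff:
  assumes "finite A" "B \<subseteq> A"
  shows "card (kset A x q) = card (kset B x q) + card (kset (A - B) x q)"
  using card_kset_Un[of B "A - B" x q] assms finite_subset[OF assms(2)]
  by (metis Diff_disjoint Diff_partition finite_Diff)

lemma lkind_cong: "x i = y i \<Longrightarrow> lkind x i = lkind y i" by (simp add: lkind_def)

lemma kset_cong: "(\<And>i. i \<in> A \<Longrightarrow> x i = y i) \<Longrightarrow> kset A x q = kset A y q"
  by (auto simp: kset_def lkind_def)

lemma sim_refl [simp]: "sim A x x" by (simp add: sim_def)
lemma sim_sym: "sim A x y \<Longrightarrow> sim A y x" by (simp add: sim_def)
lemma sim_trans: "sim A x y \<Longrightarrow> sim A y z \<Longrightarrow> sim A x z" by (simp add: sim_def)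

lemma sim_Un:
  "finite B \<Longrightarrow> finite C \<Longrightarrow> B \<inter> C = {} \<Longrightarrow> sim B x y \<Longrightarrow> sim C x y \<Longrightarrow> sim (B \<union> C) x y"
  by (simp add: sim_def card_kset_Un)

lemma sim_eq: "(\<And>i. i \<in> A \<Longrightarrow> x i = y i) \<Longrightarrow> sim A x y"
  using kset_cong[of A x y] by (simp add: sim_def)

lemma sim_Diff:
  assumes "finite A" "B \<subseteq> A" "sim A x y" "sim B x y"
  shows "sim (A - B) x y"
  using assms by (simp add: sim_def card_kset_Diff[OF assms(1,2)])

lemma lcomp_cong:
  assumes "x i = x' i" "y (fst (x i)) = y' (fst (x i))"
  shows "lcomp x y i = lcomp x' y' i"
  using assms by (cases "x' i") (simp add: lcomp_def)

lemma conf_cong: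
  assumes "\<And>i. i \<in> A \<Longrightarrow> x i = y i" "conf A x"
  shows "conf A y"
  unfolding conf_def
proof (intro ballI)
  fix i assume i: "i \<in> A"
  then have "fst (x i) \<in> A" using assms(2) by (simp add: conf_def)
  then have "lcomp y y i = lcomp x x i" using assms(1) i by (intro lcomp_cong) simp_all
  then show "fst (y i) \<in> A \<and> (fst (snd (y i)) = 1 \<or> fst (snd (y i)) = -1) \<and> lcomp y y i = (i, 1, 0)"
    using assms i by (simp add: conf_def)
qed

lemma conf_Un:
  "conf B x \<Longrightarrow> conf C x \<Longrightarrow> conf (B \<union> C) x" by (auto simp: conf_def)

text \<open>A line outside \<open>B\<close> that is mapped into \<open>B\<close> would be mapped
  back out of \<open>B\<close> by the second application.\<close>

lemma conf_Diff:
  assumes "conf A x" "conf B x"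
  shows "conf (A - B) x"
proof -
  have "fst (x i) \<notin> B" if "i \<in> A" "i \<notin> B" for i
  proof
    assume "fst (x i) \<in> B"
    moreover obtain s v where "x i = (fst (x i), s, v)" by (metis prod.collapse)
    ultimately have "x (fst (x i)) = (i, s, - s * v)" using conf_link(3)[OF assms(1) that(1)] by blast
    then show False using \<open>fst (x i) \<in> B\<close> assms(2) that(2) by (metis conf_def fst_conv)
  qed
  then show ?thesis using assms by (auto simp: conf_def)
qed

lemma conf_fix: "conf A x \<Longrightarrow> i \<in> A \<Longrightarrow> fst (x i) = i \<Longrightarrow> conf {i} x"
  by (auto simp: conf_def)

lemma conf_pair:
  assumes "conf A x" "i \<in> A" "x i = (j, s, v)"
  shows "conf {i, j} x"
  using assms conf_link[OF assms] by (auto simp: conf_def)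

section \<open>Moves and paths\<close>

lemma step_conf: "step A x y \<Longrightarrow> conf A x" "step A x y \<Longrightarrow> conf A y" "step A x y \<Longrightarrow> sim A x y"
  by (simp_all add: step_def)

lemma step_refl: "conf A x \<Longrightarrow> step A x x" by (simp add: step_def)

lemma step_sym: "step A x y \<Longrightarrow> step A y x" by (auto simp: step_def sim_sym)

lemma step_cong:
  assumes "step A x y" "\<And>i. i \<in> A \<Longrightarrow> x i = x' i" "\<And>i. i \<in> A \<Longrightarrow> y i = y' i"
  shows "step A x' y'"
proof -
  have c: "conf A x" "conf A y" and s: "sim A x y" using assms by (auto simp: step_def)
  have "lcomp x' y' i = lcomp y' x' i" if "i \<in> A" for i
  proof -
    have "fst (x i) \<in> A" "fst (y i) \<in> A" using c that by (auto simp: conf_def)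
    then have "lcomp x y i = lcomp x' y' i" "lcomp y x i = lcomp y' x' i"
      using assms(2,3) that by (auto intro!: lcomp_cong)
    then show ?thesis using assms(1) that by (simp add: step_def)
  qed
  moreover have "sim A x' y'"
    using s sim_eq[of A x x'] sim_eq[of A y y'] assms(2,3) sim_sym sim_trans by blast
  ultimately show ?thesis
    using conf_cong[OF assms(2) c(1)] conf_cong[OF assms(3) c(2)] by (simp add: step_def)
qed

lemma step_Un:
  assumes "step B x y" "step C x y" "B \<inter> C = {}" "finite B" "finite C"
  shows "step (B \<union> C) x y"
  using assms by (auto simp: step_def conf_Un sim_Un)

text \<open>Outside \<open>B\<close> the two maps coincide and hence commute; the complement is
  preserved because \<open>B\<close> is.\<close>

lemma step_local:
  assumes "conf A x" "finite A" "B \<subseteq> A" "step B x y" "\<And>i. i \<in> A - B \<Longrightarrow> y i = x i"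
  shows "step A x y"
proof -
  have "conf (A - B) x" using assms by (simp add: conf_Diff step_conf)
  then have "step (A - B) x x" by (rule step_refl)
  then have "step (A - B) x y" by (rule step_cong) (use assms in auto)
  then have "step (B \<union> (A - B)) x y"
    using assms finite_subset[OF assms(3,2)] by (intro step_Un) auto
  then show ?thesis using assms(3) by (simp add: Un_absorb1)
qed

lemma reach_conf: "reach A k x y \<Longrightarrow> conf A x \<and> conf A y \<and> sim A x y"
proof (induction k arbitrary: x)
  case 0 then show ?case using conf_cong[of A x y] sim_eq[of A x y] by auto
next
  case (Suc k) then show ?case by (auto simp: step_def intro: sim_trans)
qed

lemma reach_refl: "conf A x \<Longrightarrow> reach A k x x"
  by (induction k) (auto intro: step_refl)

lemma reach_Suc: "reach A k x y \<Longrightarrow> reach A (Suc k) x y"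
  using reach_conf[of A k x y] step_refl[of A x] reach.simps(2) by blast

lemma reach_mono: "reach A k x y \<Longrightarrow> k \<le> l \<Longrightarrow> reach A l x y"
proof (induction l)
  case (Suc l)
  then show ?case using reach_Suc[of A l x y] by (cases "k = Suc l") (auto simp del: reach.simps)
qed simp

lemma reach_cong_left:
  assumes "reach A k x y" "\<And>i. i \<in> A \<Longrightarrow> x i = x' i"
  shows "reach A k x' y"
proof (cases k)
  case 0 then show ?thesis using assms conf_cong[of A x x'] by auto
next
  case (Suc l) then show ?thesis using assms step_cong[of A x _ x'] by auto
qed

lemma reach_cong_right:
  assumes "reach A k x y" "\<And>i. i \<in> A \<Longrightarrow> y i = y' i"
  shows "reach A k x y'"
  using assms(1) by (induction k arbitrary: x) (auto simp: assms(2))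

lemma reach_trans: "reach A k x y \<Longrightarrow> reach A l y z \<Longrightarrow> reach A (k + l) x z"
proof (induction k arbitrary: x)
  case 0
  then show ?case using reach_cong_left[of A l y z x] by auto
next
  case (Suc k)
  then obtain w where "step A x w" "reach A k w y" by auto
  then show ?case using Suc.IH[of w] Suc.prems(2) by auto
qed

lemma reach_step: "step A x y \<Longrightarrow> reach A 1 x y"
  using reach_refl[of A y 0] step_conf(2) by (metis One_nat_def reach.simps(2))

lemma reach_sym: "reach A k x y \<Longrightarrow> reach A k y x"
proof (induction k arbitrary: x)
  case 0 then show ?case using conf_cong[of A x y] by auto
next
  case (Suc k)
  then obtain z where "step A x z" "reach A k z y" by auto
  then have "reach A k y z" "reach A 1 z x" using Suc reach_step step_sym by blast+
  then show ?case using reach_trans[of A k y z 1 x] by simp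
qed

text \<open>Paths on disjoint sets of lines run simultaneously, so their lengths do not add
  up.\<close>

lemma reach_Un:
  assumes "reach B k x y" "reach C k x y" "B \<inter> C = {}" "finite B" "finite C"
  shows "reach (B \<union> C) k x y"
  using assms(1,2)
proof (induction k arbitrary: x)
  case 0 then show ?case by (auto simp: conf_Un)
next
  case (Suc k)
  then obtain z z' where z: "step B x z" "reach B k z y" "step C x z'" "reach C k z' y" by auto
  define w where "w i = (if i \<in> B then z i else z' i)" for i
  have B: "z i = w i" if "i \<in> B" for i using that by (simp add: w_def)
  have C: "z' i = w i" if "i \<in> C" for i using that assms by (auto simp: w_def)
  have "step (B \<union> C) x w"
    using step_cong[OF z(1) refl B] step_cong[OF z(3) refl C] assms by (intro step_Un) auto
  moreover have "reach (B \<union> C) k w y"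
    using Suc.IH reach_cong_left[OF z(2) B] reach_cong_left[OF z(4) C] by blast
  ultimately show ?case by auto
qed

text \<open>The engine of all inductions: lines that already agree with the target are
  frozen.\<close>

lemma reach_pin:
  assumes "reach (A - B) k x y" "conf B x" "\<And>i. i \<in> B \<Longrightarrow> x i = y i" "finite A" "B \<subseteq> A"
  shows "reach A k x y"
proof -
  have "reach B k x y" using reach_refl[OF assms(2), of k] reach_cong_right assms(3) by blast
  then have "reach (B \<union> (A - B)) k x y"
    using assms finite_subset[OF assms(5,4)] by (intro reach_Un) auto
  then show ?thesis using assms(5) by (simp add: Un_absorb1)
qed

definition lnk :: "lmap \<Rightarrow> nat \<Rightarrow> nat \<Rightarrow> bool" where
  "lnk x i j \<longleftrightarrow> fst (x i) = j \<and> fst (x j) = i \<and> i \<noteq> j"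

definition off :: "nat set \<Rightarrow> lmap \<Rightarrow> lmap \<Rightarrow> bool" where
  "off S x x' \<longleftrightarrow> (\<forall>z. z \<notin> S \<longrightarrow> x' z = x z \<and> lkind x' z = lkind x z)"

lemma lnk_sym: "lnk x i j \<Longrightarrow> lnk x j i" by (auto simp: lnk_def)

lemma lnk_lkind: "lnk x i j \<Longrightarrow> lkind x i = 3" "lnk x i j \<Longrightarrow> lkind x j = 3"
  by (auto simp: lnk_def lkind3)

lemma lnkI: "conf A x \<Longrightarrow> i \<in> A \<Longrightarrow> x i = (j, s, v) \<Longrightarrow> i \<noteq> j \<Longrightarrow> lnk x i j"
  using conf_link(3) by (fastforce simp: lnk_def)

lemma lnkD:
  assumes "conf A x" "i \<in> A" "lnk x i j"
  obtains s v where "x i = (j, s, v)" "x j = (i, s, - s * v)" "s = 1 \<or> s = -1" "j \<in> A" "i \<noteq> j"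
proof -
  obtain s v where "x i = (j, s, v)" using assms(3) by (metis lnk_def prod.collapse)
  then show ?thesis using that conf_link[OF assms(1,2)] assms(3) by (auto simp: lnk_def)
qed

lemma lnk_mem: "conf A x \<Longrightarrow> i \<in> A \<Longrightarrow> lnk x i j \<Longrightarrow> j \<in> A"
  by (auto simp: conf_def lnk_def)

lemma lkind3_lnk: "conf A x \<Longrightarrow> i \<in> A \<Longrightarrow> lkind x i = 3 \<Longrightarrow> \<exists>j. lnk x i j \<and> j \<in> A"
  using lkind3D[of A x i] by (auto simp: lnk_def)

lemma offD: "off S x x' \<Longrightarrow> z \<notin> S \<Longrightarrow> x' z = x z" "off S x x' \<Longrightarrow> z \<notin> S \<Longrightarrow> lkind x' z = lkind x z"
  by (auto simp: off_def)

lemma off_lnk: "off S x x' \<Longrightarrow> i \<notin> S \<Longrightarrow> j \<notin> S \<Longrightarrow> lnk x' i j \<longleftrightarrow> lnk x i j"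
  by (auto simp: off_def lnk_def)

lemma offI: "(\<And>z. z \<notin> S \<Longrightarrow> x' z = x z) \<Longrightarrow> off S x x'"
  by (auto simp: off_def intro: lkind_cong)

lemma kinds_of_fixed: "lkind x i < 3 \<Longrightarrow> fst (x i) = i"
  using lkind3[of x i] by auto

section \<open>Local moves\<close>

text \<open>The sign must change: two links on the same pair with equal signs compose, in the two
  orders, to opposite translations, so they commute only if they are equal. With opposite signs they
  commute whatever the offset \<open>w\<close> is.\<close>

lemma flip_raw:
  assumes "conf A x" "finite A" "i \<in> A" "x i = (j, s, v)" "i \<noteq> j"
  shows "step A x (x(i := (j, - s, w), j := (i, - s, s * w)))"
proof (rule step_local[where B = "{i, j}"])
  have j: "j \<in> A" "s = 1 \<or> s = -1" "x j = (i, s, - s * v)" using conf_link[OF assms(1,3,4)] by auto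
  then show "{i, j} \<subseteq> A" using assms by simp
  let ?y = "x(i := (j, - s, w), j := (i, - s, s * w))"
  have "conf {i, j} x" using conf_pair[OF assms(1,3,4)] .
  moreover have "conf {i, j} ?y" using assms j by (auto simp: conf_def lcomp_def)
  moreover have "\<forall>z\<in>{i, j}. lcomp x ?y z = lcomp ?y x z" using assms j by (auto simp: lcomp_def)
  moreover have "sim {i, j} x ?y"
    using assms j unfolding sim_def by (simp add: card_kset_insert lkind_def)
  ultimately show "step {i, j} x ?y" by (simp add: step_def)
qed (use assms in auto)

text \<open>A link commutes with maps of its two lines to themselves iff it conjugates one into the
  other. For the new link \<open>{k, l}\<close> this is the equation for \<open>w\<close>; for the
  old link \<open>{i, j}\<close> it forces the label at \<open>j\<close> once \<open>e\<close> is
  chosen at \<open>i\<close>.\<close>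

lemma swap_raw:
  assumes "conf A x" "finite A" "i \<in> A" "x i = (j, s, v)" "i \<noteq> j"
    and "k \<in> A" "l \<in> A" "k \<noteq> l" "x k = (k, \<sigma>, c)" "x l = (l, \<sigma>, d)"
    and "t = 1 \<or> t = -1" "(1 - \<sigma>) * w = d - t * c" "\<sigma> = 1 \<or> \<sigma> = -1"
    and "\<sigma> = 1 \<Longrightarrow> e = 0" "\<sigma> = -1 \<Longrightarrow> even (e - c)"
  shows "step A x (x(k := (l, t, w), l := (k, t, - t * w), i := (i, \<sigma>, e), j := (j, \<sigma>, s * e + (1 - \<sigma>) * v)))"
proof (rule step_local[where B = "{i, j, k, l}"])
  have j: "j \<in> A" "s = 1 \<or> s = -1" "x j = (i, s, - s * v)" using conf_link[OF assms(1,3,4)] by auto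
  have d: "i \<noteq> k" "i \<noteq> l" "j \<noteq> k" "j \<noteq> l" using assms j by auto
  have cd: "\<sigma> = 1 \<Longrightarrow> c = 0 \<and> d = 0" "\<sigma> = -1 \<Longrightarrow> even (c - d)"
    using conf_link(3)[OF assms(1,6,9)] conf_link(3)[OF assms(1,7,10)] assms(9,10,11,12) by (auto, presburger+)
  show "{i, j, k, l} \<subseteq> A" using assms j by simp
  let ?y = "x(k := (l, t, w), l := (k, t, - t * w), i := (i, \<sigma>, e), j := (j, \<sigma>, s * e + (1 - \<sigma>) * v))"
  have "conf {i, j, k, l} x"
    using assms(1-10,13) j conf_link(3)[OF assms(1,6,9)] conf_link(3)[OF assms(1,7,10)]
    by (auto simp: conf_def lcomp_def)
  moreover have "conf {i, j, k, l} ?y"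
    using assms(5,8,11,13,14) j(2) d by (auto simp: conf_def lcomp_def)
  moreover have "lcomp x ?y z = lcomp ?y x z" if "z \<in> {i, j, k, l}" for z
    using that assms(4,5,8-14) j(2,3) d cd by (auto simp: lcomp_def algebra_simps)
  moreover have "sim {i, j, k, l} x ?y"
    unfolding sim_def using assms(4,5,8-15) j(2,3) d cd by (auto simp: card_kset_insert lkind_def)
  ultimately show "step {i, j, k, l} x ?y" unfolding step_def by blast
qed (use assms in auto)

text \<open>On each of the two lines one of the maps is the identity, so they commute whatever the
  new label is; its parity matters only for staying in the class.\<close>

lemma hop_raw:
  assumes "conf A x" "finite A" "i \<in> A" "h \<in> A" "x i = (i, -1, c)" "x h = (h, 1, 0)" "even (e - c)"
  shows "step A x (x(i := (i, 1, 0), h := (h, -1, e)))"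
proof (rule step_local[where B = "{i, h}"])
  have d: "i \<noteq> h" using assms by auto
  show "{i, h} \<subseteq> A" using assms by simp
  let ?y = "x(i := (i, 1, 0), h := (h, -1, e))"
  have "conf {i, h} x" "conf {i, h} ?y" using assms d by (auto simp: conf_def lcomp_def)
  moreover have "\<forall>z\<in>{i, h}. lcomp x ?y z = lcomp ?y x z" using assms d by (auto simp: lcomp_def)
  moreover have "sim {i, h} x ?y"
    unfolding sim_def using assms d by (auto simp: card_kset_insert lkind_def)
  ultimately show "step {i, h} x ?y" by (simp add: step_def)
qed (use assms in auto)

text \<open>The link \<open>{i, j}\<close> is free. Commutation says that going from
  \<open>p\<close> to \<open>r\<close> directly equals going through \<open>i\<close> and
  \<open>j\<close>, and this determines \<open>u\<close> and \<open>z\<close>.\<close>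

lemma regroup_raw:
  assumes "conf A x" "finite A" "i \<in> A" "j \<in> A" "x i = (p, s, v)" "x j = (r, s', v')"
    and "distinct [i, p, j, r]" "t = 1 \<or> t = -1"
    and "u = s' * t * s" "z = - s' * t * s * v + s' * w + v'"
  shows "step A x (x(i := (j, t, w), j := (i, t, - t * w), p := (r, u, z), r := (p, u, - u * z)))"
proof (rule step_local[where B = "{i, p, j, r}"])
  have p: "p \<in> A" "s = 1 \<or> s = -1" "x p = (i, s, - s * v)" using conf_link[OF assms(1,3,5)] by auto
  have r: "r \<in> A" "s' = 1 \<or> s' = -1" "x r = (j, s', - s' * v')" using conf_link[OF assms(1,4,6)] by auto
  show "{i, p, j, r} \<subseteq> A" using assms p r by simp
  let ?y = "x(i := (j, t, w), j := (i, t, - t * w), p := (r, u, z), r := (p, u, - u * z))"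
  have "conf {i, p, j, r} x"
    using assms(5,6,7) p(2,3) r(2,3) by (auto simp: conf_def lcomp_def)
  moreover have "conf {i, p, j, r} ?y"
    using assms(7,8,9) p(2) r(2) by (auto simp: conf_def lcomp_def)
  moreover have "lcomp x ?y y = lcomp ?y x y" if "y \<in> {i, p, j, r}" for y
    using that assms(5-10) p(2,3) r(2,3) by (auto simp: lcomp_def algebra_simps)
  moreover have "sim {i, p, j, r} x ?y"
    unfolding sim_def using assms(5,6,7) p(2,3) r(2,3) by (auto simp: card_kset_insert lkind_def)
  ultimately show "step {i, p, j, r} x ?y" unfolding step_def by blast
qed (use assms in auto)

text \<open>The vacated line \<open>i\<close> may take any label of its kind and takes that of
  \<open>y\<close>; the last equation is the label that the old link forces on \<open>j\<close>.
  Since \<open>y\<close> need only live on some set \<open>C\<close>, a one-line dummy can serve to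
  prescribe a label.\<close>

lemma swap_to:
  assumes x: "conf A x" "finite A" "i \<in> A" "lnk x i j"
    and kl: "k \<in> A" "l \<in> A" "k \<noteq> l" "lkind x k = q" "lkind x l = q" "q < 3"
    and t: "t = 1 \<or> t = -1" "q = 0 \<or> snd (snd (x l)) = t * snd (snd (x k)) + 2 * w"
    and y: "conf C y" "i \<in> C" "lkind y i = q"
  shows "\<exists>x'. step A x x' \<and> x' k = (l, t, w) \<and> x' l = (k, t, - t * w) \<and> lnk x' k l \<and> x' i = y i
    \<and> lkind x' i = q \<and> lkind x' j = q \<and> off {i, j, k, l} x x'
    \<and> snd (snd (x' j)) = fst (snd (x i)) * snd (snd (x' i)) + (if q = 0 then 0 else 2 * snd (snd (x i)))"
proof -
  obtain s v where i: "x i = (j, s, v)" "i \<noteq> j" "s = 1 \<or> s = -1" "x j = (i, s, - s * v)"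
    using lnkD[OF x(1,3,4)] by metis
  have d: "i \<noteq> k" "i \<noteq> l" "j \<noteq> k" "j \<noteq> l" using x(4) kl lnk_lkind by fastforce+
  show ?thesis
  proof (cases "q = 0")
    case True
    then have *: "x k = (k, 1, 0)" "x l = (l, 1, 0)" "y i = (i, 1, 0)"
      using lkind0D x(1) kl y by auto
    let ?x = "x(k := (l, t, w), l := (k, t, - t * w), i := (i, 1, 0), j := (j, 1, s * 0 + (1 - 1) * v))"
    have "step A x ?x"
      by (rule swap_raw[OF x(1-3) i(1,2) kl(1-3) *(1,2) t(1)]) auto
    moreover have "off {i, j, k, l} x ?x" by (rule offI) auto
    ultimately show ?thesis using d i * kl True by (intro exI[of _ ?x]) (auto simp: lnk_def lkind_def)
  next
    case False
    then have q: "q = 1 \<or> q = 2" using kl by auto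
    obtain c d' e where *: "x k = (k, -1, c)" "x l = (l, -1, d')" "y i = (i, -1, e)"
        "even c \<longleftrightarrow> q = 1" "even d' \<longleftrightarrow> q = 1" "even e \<longleftrightarrow> q = 1"
      using lkind12D[OF x(1) kl(1,4) q] lkind12D[OF x(1) kl(2,5) q] lkind12D[OF y q] by auto
    let ?x = "x(k := (l, t, w), l := (k, t, - t * w), i := (i, -1, e), j := (j, -1, s * e + (1 - (-1)) * v))"
    have "d' = t * c + 2 * w" using t False * by simp
    then have "step A x ?x"
      by (intro swap_raw[OF x(1-3) i(1,2) kl(1-3) *(1,2) t(1)]) (use * in auto)
    moreover have "off {i, j, k, l} x ?x" by (rule offI) auto
    ultimately show ?thesis using d i * kl False q
      by (intro exI[of _ ?x]) (auto simp: lnk_def lkind_def)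
  qed
qed

lemma same_kind_parity:
  assumes "conf A x" "k \<in> A" "lkind x k = q" "conf B y" "l \<in> B" "lkind y l = q" "q < 3" "q \<noteq> 0"
  shows "even (snd (snd (x k)) - snd (snd (y l)))"
proof -
  have "q = 1 \<or> q = 2" using assms by auto
  then show ?thesis using lkind12D[OF assms(1-3)] lkind12D[OF assms(4-6)] by auto
qed

text \<open>Labels of one colour have the same parity, so both their sum and their difference can be
  halved and an exchange can create a link of either sign.\<close>

lemma swap_sgn:
  assumes x: "conf A x" "finite A" "i \<in> A" "lnk x i j"
    and kl: "k \<in> A" "l \<in> A" "k \<noteq> l" "lkind x k = q" "lkind x l = q" "q < 3"
    and t: "t = 1 \<or> t = -1"
    and y: "conf C y" "i \<in> C" "lkind y i = q"
  shows "\<exists>x' w. step A x x' \<and> x' k = (l, t, w) \<and> lnk x' k l \<and> x' i = y i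
    \<and> lkind x' i = q \<and> lkind x' j = q \<and> off {i, j, k, l} x x'
    \<and> snd (snd (x' j)) = fst (snd (x i)) * snd (snd (x' i)) + (if q = 0 then 0 else 2 * snd (snd (x i)))"
proof -
  let ?w = "(snd (snd (x l)) - t * snd (snd (x k))) div 2"
  have "q = 0 \<or> snd (snd (x l)) = t * snd (snd (x k)) + 2 * ?w"
    using same_kind_parity[OF x(1) kl(2,5) x(1) kl(1,4)] kl(6) t by (cases "q = 0") auto
  from swap_to[OF x kl t this y] show ?thesis by blast
qed

lemma swap_lab:
  assumes x: "conf A x" "finite A" "i \<in> A" "lnk x i j"
    and kl: "k \<in> A" "l \<in> A" "k \<noteq> l" "lkind x k = q" "lkind x l = q" "q < 3"
    and y: "conf C y" "i \<in> C" "lkind y i = q"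
  shows "\<exists>x'. step A x x' \<and> lnk x' k l \<and> x' i = y i
    \<and> lkind x' i = q \<and> lkind x' j = q \<and> off {i, j, k, l} x x'"
  using swap_sgn[OF x kl _ y, of 1] by blast

lemma swap_any:
  assumes x: "conf A x" "finite A" "i \<in> A" "lnk x i j"
    and kl: "k \<in> A" "l \<in> A" "k \<noteq> l" "lkind x k = q" "lkind x l = q" "q < 3"
  shows "\<exists>x'. step A x x' \<and> lnk x' k l \<and> lkind x' i = q \<and> lkind x' j = q \<and> off {i, j, k, l} x x'"
proof -
  \<comment> \<open>Any label of the kind \<open>q\<close> will do for \<open>i\<close>; the one at
    \<open>k\<close> is copied.\<close>
  define y where "y z = (z, snd (x k))" for z :: nat
  have k: "fst (x k) = k" using kinds_of_fixed kl by auto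
  then obtain s c where xk: "x k = (k, s, c)" by (metis prod.collapse)
  have "conf {i} y"
    using x(1) kl(1) by (auto simp: conf_def y_def lcomp_def xk dest: bspec[of A _ k])
  moreover have "lkind y i = q" using kl(4) by (simp add: y_def lkind_def xk)
  ultimately show ?thesis using swap_lab[OF x kl, of "{i}" y] by auto
qed

lemma hop_lab:
  assumes x: "conf A x" "finite A" "i \<in> A" "h \<in> A" "lkind x i = q" "q = 1 \<or> q = 2" "lkind x h = 0"
    and y: "conf C y" "h \<in> C" "lkind y h = q"
  shows "\<exists>x'. step A x x' \<and> x' h = y h \<and> lkind x' h = q \<and> lkind x' i = 0 \<and> off {i, h} x x'"
proof -
  obtain c e where *: "x i = (i, -1, c)" "y h = (h, -1, e)" "even c \<longleftrightarrow> q = 1" "even e \<longleftrightarrow> q = 1"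
    using lkind12D[OF x(1,3,5,6)] lkind12D[OF y x(6)] by auto
  have h: "x h = (h, 1, 0)" using lkind0D[OF x(1,4,7)] .
  let ?x = "x(i := (i, 1, 0), h := (h, -1, e))"
  have "step A x ?x" using hop_raw[OF x(1-4) *(1) h, of e] * by auto
  moreover have "off {i, h} x ?x" by (rule offI) auto
  moreover have "i \<noteq> h" using x by auto
  ultimately show ?thesis using * x(5,6) by (intro exI[of _ ?x]) (auto simp: lkind_def)
qed

lemma hop_any:
  assumes x: "conf A x" "finite A" "i \<in> A" "h \<in> A" "lkind x i = q" "q = 1 \<or> q = 2" "lkind x h = 0"
  shows "\<exists>x'. step A x x' \<and> lkind x' h = q \<and> lkind x' i = 0 \<and> off {i, h} x x'"
proof -
  obtain c where c: "x i = (i, -1, c)" "even c \<longleftrightarrow> q = 1" using lkind12D[OF x(1,3,5,6)] by auto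
  define y :: lmap where "y z = (z, -1, c)" for z
  have "conf {h} y" "lkind y h = q" using c x(6) by (auto simp: conf_def y_def lcomp_def lkind_def)
  then show ?thesis using hop_lab[OF x, of "{h}" y] by auto
qed

lemma flip_to:
  assumes "conf A x" "finite A" "i \<in> A" "x i = (j, s, v)" "i \<noteq> j"
  shows "\<exists>x'. step A x x' \<and> x' i = (j, - s, w) \<and> lnk x' i j \<and> off {i, j} x x'"
proof -
  let ?x = "x(i := (j, - s, w), j := (i, - s, s * w))"
  have "step A x ?x" using flip_raw[OF assms] .
  moreover have "off {i, j} x ?x" by (rule offI) auto
  ultimately show ?thesis using assms by (intro exI[of _ ?x]) (auto simp: lnk_def)
qed

lemma regroup_to:
  assumes "conf A x" "finite A" "i \<in> A" "j \<in> A" "lnk x i p" "lnk x j r" "j \<noteq> i" "j \<noteq> p"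
    and t: "t = 1 \<or> t = -1"
  shows "\<exists>x'. step A x x' \<and> x' i = (j, t, w) \<and> lnk x' i j \<and> lnk x' p r \<and> off {i, p, j, r} x x'"
proof -
  obtain s v s' v' where *: "x i = (p, s, v)" "x j = (r, s', v')"
    using lnkD[OF assms(1,3,5)] lnkD[OF assms(1,4,6)] by metis
  have d: "distinct [i, p, j, r]" using assms by (auto simp: lnk_def)
  let ?u = "s' * t * s" let ?z = "- s' * t * s * v + s' * w + v'"
  let ?x = "x(i := (j, t, w), j := (i, t, - t * w), p := (r, ?u, ?z), r := (p, ?u, - ?u * ?z))"
  have "step A x ?x" using regroup_raw[OF assms(1-4) * d t refl refl] .
  moreover have "off {i, p, j, r} x ?x" by (rule offI) auto
  ultimately show ?thesis using d by (intro exI[of _ ?x]) (auto simp: lnk_def)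
qed

text \<open>A flip reverses the sign and sets the offset, so one flip settles opposite signs and two
  flips settle equal ones.\<close>

lemma reach_pair:
  assumes x: "conf A x" "conf A y" "i \<in> A" "lnk x i j" "lnk y i j"
  shows "reach {i, j} 2 x y"
proof -
  obtain s v where xi: "x i = (j, s, v)" "s = 1 \<or> s = -1" "i \<noteq> j" using lnkD[OF x(1,3,4)] by metis
  obtain t w where yi: "y i = (j, t, w)" "y j = (i, t, - t * w)" "t = 1 \<or> t = -1" using lnkD[OF x(2,3,5)] by metis
  have c: "conf {i, j} x" using conf_pair[OF x(1,3) xi(1)] .
  have eq: "reach {i, j} 0 z y" if "conf {i, j} z" "z i = y i" for z
    using that conf_link(3)[of "{i, j}" z i j] yi by auto
  show ?thesis
  proof (cases "s = t")
    case True
    from flip_to[OF c _ _ xi(1,3), of 0] obtain x1 where 1: "step {i, j} x x1" "x1 i = (j, - s, 0)" by auto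
    from flip_to[OF step_conf(2)[OF 1(1)] _ _ 1(2) xi(3), of w] obtain x2
      where 2: "step {i, j} x1 x2" "x2 i = (j, s, w)" by auto
    have "reach {i, j} 0 x2 y" using eq[OF step_conf(2)[OF 2(1)]] 2 True yi by simp
    then show ?thesis using 1 2 by (auto simp: numeral_2_eq_2)
  next
    case False
    then have "t = - s" using xi yi by auto
    from flip_to[OF c _ _ xi(1,3), of w] obtain x1 where 1: "step {i, j} x x1" "x1 i = (j, - s, w)" by auto
    have "reach {i, j} 0 x1 y" using eq[OF step_conf(2)[OF 1(1)]] 1 \<open>t = - s\<close> yi by simp
    then show ?thesis using 1 step_refl[OF c] by (auto simp: numeral_2_eq_2)
  qed
qed

lemma two_of: "2 \<le> card S \<Longrightarrow> \<exists>a b. a \<in> S \<and> b \<in> S \<and> a \<noteq> b"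
proof -
  assume "2 \<le> card S"
  then obtain T where "T \<subseteq> S" "card T = 2" using obtain_subset_with_card_n by blast
  then show ?thesis by (auto simp: card_2_iff)
qed

lemma other_of: "2 \<le> card S \<Longrightarrow> \<exists>b\<in>S. b \<noteq> a"
  using two_of by metis

lemma others_of:
  assumes "finite T" "card T < card S"
  shows "\<exists>b\<in>S. b \<notin> T"
proof (rule ccontr)
  assume "\<not> (\<exists>b\<in>S. b \<notin> T)"
  then have "S \<subseteq> T" by blast
  then show False using card_mono[OF assms(1)] assms(2) by (simp add: leD)
qed

lemma reach_1_1: "step A x y \<Longrightarrow> step A y z \<Longrightarrow> reach A 2 x z"
  using reach_trans[OF reach_step reach_step] by (metis nat_1_add_1)

lemma reach_snoc: "reach A n x y \<Longrightarrow> step A y z \<Longrightarrow> reach A (Suc n) x z"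
  using reach_trans[OF _ reach_step] by (metis Suc_eq_plus1)

lemma reach_Cons: "step A x y \<Longrightarrow> reach A n y z \<Longrightarrow> reach A (Suc n) x z"
  by auto

lemma step_restrict:
  assumes "step A x y" "finite A" "B \<subseteq> A" "conf B x" "off B x y"
  shows "step B x y"
proof -
  have eq: "x i = y i" if "i \<in> A - B" for i using that assms(5) by (simp add: off_def)
  have *: "A - (A - B) = B" using assms(3) by blast
  have "conf (A - B) x" using assms by (auto intro: conf_Diff simp: step_def)
  then have "conf (A - B) y" using eq by (rule conf_cong[rotated])
  then have "conf B y" using conf_Diff[of A y "A - B"] assms(1) * by (simp add: step_def)
  moreover have "sim B x y"
    using sim_Diff[of A "A - B" x y] assms(1,2) sim_eq[of "A - B" x y] eq * by (simp add: step_def)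
  ultimately show ?thesis using assms by (auto simp: step_def)
qed

text \<open>Both moves start from \<open>x\<close> and concern disjoint invariant sets of lines, so
  they count as one move. This allows exchanges with two different links at once.\<close>

lemma step_par:
  assumes "step A x x1" "step A x x2" "finite A" "off S x x1" "off T x x2"
    and "S \<inter> T = {}" "S \<subseteq> A" "T \<subseteq> A" "conf S x" "conf T x"
  shows "\<exists>x'. step A x x' \<and> off T x1 x' \<and> off S x2 x' \<and> off (S \<union> T) x x'"
proof -
  define x' where "x' z = (if z \<in> S then x1 z else x2 z)" for z
  have S: "step S x x'"
    by (rule step_cong[OF step_restrict[OF assms(1,3,7,9,4)]]) (auto simp: x'_def)
  have T: "step T x x'"
    by (rule step_cong[OF step_restrict[OF assms(2,3,8,10,5)]]) (use assms(6) in \<open>auto simp: x'_def\<close>)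
  have "step (S \<union> T) x x'"
    using S T assms finite_subset by (intro step_Un) auto
  moreover have *: "off (S \<union> T) x x'" using assms(4,5) by (intro offI) (auto simp: x'_def off_def)
  ultimately have "step A x x'"
    using step_local[OF step_conf(1)[OF assms(1)] assms(3) Un_least[OF assms(7,8)]] offD(1)[OF *]
    by blast
  moreover have "off T x1 x'"
    by (rule offI) (simp add: x'_def offD(1)[OF assms(4)] offD(1)[OF assms(5)])
  moreover have "off S x2 x'"
    by (rule offI) (simp add: x'_def)
  ultimately show ?thesis using * by blast
qed

section \<open>Removing lines and links that agree with the target\<close>

lemma del_fixed:
  assumes "finite A" "conf A x" "conf A y" "sim A x y" "h \<in> A" "x h = y h" "fst (x h) = h"
  shows "conf (A - {h}) x" "conf (A - {h}) y" "sim (A - {h}) x y"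
    "card (kset A x q) = (if lkind x h = q then 1 else 0) + card (kset (A - {h}) x q)"
    "reach (A - {h}) n x y \<Longrightarrow> reach A n x y"
proof -
  have c: "conf {h} x" "conf {h} y" using conf_fix assms by auto
  then show "conf (A - {h}) x" "conf (A - {h}) y" using conf_Diff assms by auto
  have "sim {h} x y" using assms(6) by (intro sim_eq) simp
  then show "sim (A - {h}) x y" using assms by (intro sim_Diff) auto
  have "A = insert h (A - {h})" using assms by auto
  then show "card (kset A x q) = (if lkind x h = q then 1 else 0) + card (kset (A - {h}) x q)"
    using card_kset_insert[of "A - {h}" h x q] assms(1) by auto
  show "reach (A - {h}) n x y \<Longrightarrow> reach A n x y" using reach_pin[of A "{h}"] c assms by auto
qed

lemma del_link:
  assumes "finite A" "conf A x" "conf A y" "sim A x y" "i \<in> A" "lnk x i j" "x i = y i"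
  shows "conf (A - {i, j}) x" "conf (A - {i, j}) y" "sim (A - {i, j}) x y"
    "card (kset A x q) = (if q = 3 then 2 else 0) + card (kset (A - {i, j}) x q)"
    "reach (A - {i, j}) n x y \<Longrightarrow> reach A n x y" "card A = 2 + card (A - {i, j})"
proof -
  obtain s v where x: "x i = (j, s, v)" "x j = (i, s, - s * v)" "j \<in> A" "i \<noteq> j"
    using lnkD[OF assms(2,5,6)] by metis
  have y: "x j = y j" using conf_link(3)[OF assms(3,5)] x assms(7) by simp
  have "y i = (j, s, v)" using assms(7) x by simp
  then have c: "conf {i, j} x" "conf {i, j} y"
    using conf_pair[OF assms(2,5) x(1)] conf_pair[OF assms(3,5)] by auto
  then show "conf (A - {i, j}) x" "conf (A - {i, j}) y" using conf_Diff assms by auto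
  have "sim {i, j} x y" using assms(7) y by (intro sim_eq) auto
  then show "sim (A - {i, j}) x y" using assms x by (intro sim_Diff) auto
  have A: "A = insert i (insert j (A - {i, j}))" using assms x by auto
  show "card (kset A x q) = (if q = 3 then 2 else 0) + card (kset (A - {i, j}) x q)"
    by (subst A, use assms x lnk_lkind[OF assms(6)] in \<open>simp add: card_kset_insert\<close>)
  show "card A = 2 + card (A - {i, j})" by (subst A) (use assms x in auto)
  show "reach (A - {i, j}) n x y \<Longrightarrow> reach A n x y"
    by (rule reach_pin[of A "{i, j}" n x y]) (use c assms(1,5,7) x(3) y in auto)
qed

text \<open>A link on its final pair needs no budget of its own: its at most two flips run in
  parallel with the moves of the other lines.\<close>

lemma sim_same_supp:
  assumes "finite A" "conf A x" "conf A y" "sim A x y" "i \<in> A" "lnk x i j" "lnk y i j"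
  shows "conf (A - {i, j}) x" "conf (A - {i, j}) y" "sim (A - {i, j}) x y"
    "card (kset A x q) = (if q = 3 then 2 else 0) + card (kset (A - {i, j}) x q)"
    "reach (A - {i, j}) n x y \<Longrightarrow> 2 \<le> n \<Longrightarrow> reach A n x y"
proof -
  obtain s v where x: "x i = (j, s, v)" "x j = (i, s, - s * v)" "j \<in> A" "i \<noteq> j"
    using lnkD[OF assms(2,5,6)] by metis
  obtain t w where y: "y i = (j, t, w)" using assms(7) by (metis lnk_def prod.collapse)
  have c: "conf {i, j} x" "conf {i, j} y"
    using conf_pair[OF assms(2,5) x(1)] conf_pair[OF assms(3,5) y] by auto
  then show "conf (A - {i, j}) x" "conf (A - {i, j}) y" using conf_Diff assms by auto
  have r: "reach {i, j} 2 x y" using reach_pair assms by blast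
  then show "sim (A - {i, j}) x y" using assms x reach_conf by (intro sim_Diff) auto
  have A: "A = insert i (insert j (A - {i, j}))" using assms x by auto
  show "card (kset A x q) = (if q = 3 then 2 else 0) + card (kset (A - {i, j}) x q)"
    by (subst A, use assms x lnk_lkind[OF assms(6)] in \<open>simp add: card_kset_insert\<close>)
  assume "reach (A - {i, j}) n x y" "2 \<le> n"
  then have "reach ({i, j} \<union> (A - {i, j})) n x y"
    using reach_mono[OF r] assms(1) by (intro reach_Un) auto
  then show "reach A n x y" using A by (metis Un_insert_left Un_empty_left insert_is_Un)
qed

section \<open>No links\<close>

definition tok :: "nat set \<Rightarrow> lmap \<Rightarrow> nat" where
  "tok A x = card (kset A x 1) + card (kset A x 2)"

text \<open>Each colour that occurs costs one move beyond one per token, see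
  \<open>tokens_reach\<close>.\<close>

definition col :: "nat set \<Rightarrow> lmap \<Rightarrow> nat" where
  "col A x = (if card (kset A x 1) = 0 then 0 else 1) + (if card (kset A x 2) = 0 then 0 else 1)"

lemma sim_tok_col: "sim A x y \<Longrightarrow> tok A x = tok A y" "sim A x y \<Longrightarrow> col A x = col A y"
  by (simp_all add: sim_def tok_def col_def)

lemma kset_nonempty: "finite A \<Longrightarrow> i \<in> A \<Longrightarrow> card (kset A x (lkind x i)) \<noteq> 0"
  by (auto simp: kset_def)

lemma kset_ex: "card (kset A x q) \<noteq> 0 \<Longrightarrow> \<exists>h\<in>A. lkind x h = q"
  by (metis (mono_tags, lifting) card.empty ex_in_conv kset_iff)

lemma sim_mem: "finite A \<Longrightarrow> sim A x y \<Longrightarrow> i \<in> A \<Longrightarrow> \<exists>j\<in>A. lkind y j = lkind x i"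
proof -
  assume a: "finite A" "sim A x y" "i \<in> A"
  then have "card (kset A y (lkind x i)) \<noteq> 0" using kset_nonempty by (metis sim_def)
  then have "kset A y (lkind x i) \<noteq> {}" by auto
  then show ?thesis by (auto simp: kset_def)
qed

text \<open>As long as the hole sets differ, every hop can settle a token for good. If they
  coincide, one token has to make way first. After the start this can happen only when a colour has
  just been used up, so each colour pays at most once.\<close>

lemma tokens_reach:
  assumes "finite A" "conf A x" "conf A y" "sim A x y" "card (kset A x 3) = 0" "card (kset A x 0) \<noteq> 0"
  shows "reach A (tok A x + col A x - (if kset A x 0 = kset A y 0 then 0 else 1)) x y"
  using assms
proof (induction "card A" arbitrary: A x rule: less_induct)
  case less
  note A = \<open>finite A\<close> and x = \<open>conf A x\<close> and y = \<open>conf A y\<close>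
  have moved: "reach A (tok A x + col A x - 1) x y"
    if x: "conf A x" "sim A x y" "card (kset A x 3) = 0" "card (kset A x 0) \<noteq> 0" "kset A x 0 \<noteq> kset A y 0" for x
  proof -
    have "card (kset A x 0) = card (kset A y 0)" using x(2) by (simp add: sim_def)
    then have "\<not> kset A x 0 \<subseteq> kset A y 0"
      using x(5) card_subset_eq[of "kset A y 0" "kset A x 0"] A by auto
    then obtain h where h: "h \<in> A" "lkind x h = 0" "lkind y h \<noteq> 0" by (auto simp: kset_def)
    define q where "q = lkind y h"
    have "card (kset A y 3) = 0" using x(2,3) by (simp add: sim_def)
    then have "q \<noteq> 3" using kset_nonempty[OF A h(1), of y] by (auto simp: q_def)
    then have q: "q = 1 \<or> q = 2" using lkind_le[of y h] h(3) q_def by linarith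
    \<comment> \<open>A token whose line is not a hole of \<open>y\<close> is preferred: its hop
      leaves a hole that is again misplaced.\<close>
    obtain j where j: "j \<in> A" "lkind x j = q" "(\<exists>j'\<in>A. lkind x j' = q \<and> lkind y j' \<noteq> 0) \<longrightarrow> lkind y j \<noteq> 0"
      using sim_mem[OF A sim_sym[OF x(2)] h(1)] q_def by metis
    obtain x' where x': "step A x x'" "x' h = y h" "lkind x' h = q" "lkind x' j = 0" "off {j, h} x x'"
      using hop_lab[OF x(1) A j(1) h(1) j(2) q h(2) y h(1)] q_def by blast
    have jh: "j \<noteq> h" using j h q by auto
    have c': "conf A x'" "sim A x x'" using x'(1) by (auto simp: step_def)
    have c'3: "sim A x' y" using sim_trans[OF sim_sym[OF c'(2)] x(2)] .
    have fh: "fst (x' h) = h" using x'(3) q kinds_of_fixed[of x' h] by auto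
    let ?A = "A - {h}"
    note d = del_fixed[OF A c'(1) y c'3 h(1) x'(2) fh]
    have cards: "card (kset A x r) = (if r = q then 1 else 0) + card (kset ?A x' r)" for r
      using d(4)[of r] c'(2) x'(3) by (auto simp: sim_def)
    have c3: "card (kset ?A x' 3) = 0" using cards[of 3] x(3) by auto
    have jm: "j \<in> kset ?A x' 0" using j jh x'(4) by (auto simp: kset_def)
    have c0: "card (kset ?A x' 0) \<noteq> 0" using cards[of 0] x(4) q by auto
    have "card ?A < card A" using A h by (metis card_Diff1_less)
    from less.hyps[OF this _ d(1-3) c3 c0] A
    have r: "reach ?A (tok ?A x' + col ?A x' - (if kset ?A x' 0 = kset ?A y 0 then 0 else 1)) x' y" by simp
    have "tok ?A x' + 1 = tok A x" using cards[of 1] cards[of 2] q by (auto simp: tok_def)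
    moreover have "col ?A x' \<le> col A x" "0 < col A x" using cards[of 1] cards[of 2] q by (auto simp: col_def)
    \<comment> \<open>If the hole sets now coincide, the preference in the choice of
      \<open>j\<close> shows that the last token of colour \<open>q\<close> has been moved; the drop
      of \<open>col\<close> pays for the lost saving.\<close>
    moreover have "col ?A x' + 1 = col A x" if eq: "kset ?A x' 0 = kset ?A y 0"
    proof -
      have "kset A x q = {j}"
      proof (rule ccontr)
        assume "kset A x q \<noteq> {j}"
        then obtain j' where j': "j' \<in> A" "lkind x j' = q" "j' \<noteq> j" using j by (auto simp: kset_def)
        have "lkind y j = 0" using jm eq by (auto simp: kset_def)
        then have "lkind y j' = 0" using j j' by blast
        moreover have "j' \<noteq> h" using j' h q by auto
        ultimately have "lkind x' j' = 0" using j' eq by (auto simp: kset_def)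
        then show False using offD(2)[OF x'(5)] j' q \<open>j' \<noteq> h\<close> by auto
      qed
      then show ?thesis using cards[of 1] cards[of 2] q by (auto simp: col_def)
    qed
    ultimately have le: "Suc (tok ?A x' + col ?A x' - (if kset ?A x' 0 = kset ?A y 0 then 0 else 1)) \<le> tok A x + col A x - 1"
      by auto
    show ?thesis using reach_mono[OF reach_Cons[OF x'(1) d(5)[OF r]] le] .
  qed
  show ?case
  proof (cases "kset A x 0 = kset A y 0")
    case False
    then show ?thesis using moved[of x] less.prems by simp
  next
    case eq: True
    show ?thesis
    proof (cases "\<forall>i\<in>A. x i = y i")
      case True
      then have "reach A 0 x y" using x by simp
      then show ?thesis using reach_mono by blast
    next
      case False
      then obtain i where i: "i \<in> A" "x i \<noteq> y i" by auto
      define q where "q = lkind x i"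
      have "q \<noteq> 0"
      proof
        assume "q = 0"
        then have "lkind y i = 0" "lkind x i = 0" using eq i(1) by (auto simp: q_def kset_def)
        then show False using i lkind0D x y by metis
      qed
      moreover have "q \<noteq> 3" using kset_nonempty[OF A i(1), of x] less.prems by (auto simp: q_def)
      ultimately have q: "q = 1 \<or> q = 2" using lkind_le[of x i] q_def by linarith
      \<comment> \<open>The holes are right but a label is wrong: one sacrificed hop makes the hole
        sets differ.\<close>
      obtain h where h: "h \<in> A" "lkind x h = 0" using kset_ex[OF less.prems(6)] by blast
      obtain x' where x': "step A x x'" "lkind x' h = q" "lkind x' i = 0" "off {i, h} x x'"
        using hop_any[OF x A i(1) h(1) q_def[symmetric] q h(2)] by blast
      have s: "sim A x x'" "conf A x'" using x' by (auto simp: step_def)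
      then have "kset A x' 0 \<noteq> kset A y 0"
        using eq x'(3) i(1) q q_def kset_iff[of i A x 0] kset_iff[of i A x' 0] by auto
      moreover have "sim A x' y" using sim_trans[OF sim_sym[OF s(1)] less.prems(4)] .
      ultimately have "reach A (tok A x' + col A x' - 1) x' y"
        using moved[of x'] s less.prems by (auto simp: sim_def)
      then have r: "reach A (tok A x + col A x - 1) x' y" using sim_tok_col[OF s(1)] by simp
      have "tok A x \<noteq> 0" using kset_nonempty[OF A i(1), of x] q q_def by (auto simp: tok_def)
      then have "Suc (tok A x + col A x - 1) = tok A x + col A x" by simp
      then show ?thesis using reach_Cons[OF x'(1) r] eq by simp
    qed
  qed
qed

text \<open>The only link is on its final pair and is corrected while the tokens hop, so it merely
  requires \<open>2 \<le> n\<close>.\<close>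

lemma finish_tokens:
  assumes "finite A" "conf A x" "conf A y" "sim A x y" "i \<in> A" "lnk x i j" "lnk y i j"
    and "card (kset A x 3) = 2" "card (kset A x 0) \<noteq> 0" "2 \<le> n"
    and "tok A x + col A x \<le> n \<or> kset A x 0 \<noteq> kset A y 0 \<and> tok A x + col A x \<le> Suc n"
  shows "reach A n x y"
proof -
  let ?A = "A - {i, j}"
  note s = sim_same_supp[OF assms(1-7)]
  have t: "tok ?A x = tok A x" "col ?A x = col A x" using s(4) by (simp_all add: tok_def col_def)
  have 0: "kset ?A x 0 = kset A x 0" "kset ?A y 0 = kset A y 0"
    using lnk_lkind[OF assms(6)] lnk_lkind[OF assms(7)] by (auto simp: kset_def)
  have "reach ?A (tok ?A x + col ?A x - (if kset ?A x 0 = kset ?A y 0 then 0 else 1)) x y"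
    using s(4)[of 3] s(4)[of 0] assms by (intro tokens_reach s) auto
  then have "reach ?A n x y" by (rule reach_mono) (use assms(11) in \<open>auto simp: t 0\<close>)
  then show ?thesis using s(5) assms(10) by blast
qed

section \<open>Creating a prescribed link\<close>

lemma other_link:
  assumes "conf A x" "finite A" "i \<in> A" "lnk x i p" "4 \<le> card (kset A x 3)"
  shows "\<exists>u v. u \<in> A \<and> v \<in> A \<and> lnk x u v \<and> u \<notin> {i, p} \<and> v \<notin> {i, p}"
proof -
  have "card {i, p} < card (kset A x 3)" using assms(5) card_insert_le_m1[of 2 "{p}" i] by simp
  then obtain u where u: "u \<in> A" "lkind x u = 3" "u \<notin> {i, p}"
    using others_of[of "{i, p}" "kset A x 3"] by (auto simp: kset_def)
  obtain v where v: "lnk x u v" "v \<in> A" using lkind3_lnk[OF assms(1) u(1,2)] by auto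
  have "v \<notin> {i, p}" using u v assms(4) by (auto simp: lnk_def)
  then show ?thesis using u v by blast
qed

lemma lnk_lt3: "lkind x k < 3 \<Longrightarrow> lnk x i j \<Longrightarrow> k \<noteq> i \<and> k \<noteq> j"
  using lnk_lkind by fastforce

lemma other_kind: "2 \<le> card (kset A x q) \<Longrightarrow> \<exists>k. k \<in> A \<and> lkind x k = q \<and> k \<noteq> a"
  using other_of[of "kset A x q" a] by (auto simp: kset_iff)

lemma two_kind: "2 \<le> card (kset A x q) \<Longrightarrow> \<exists>k l. k \<in> A \<and> l \<in> A \<and> lkind x k = q \<and> lkind x l = q \<and> k \<noteq> l"
  using two_of[of "kset A x q"] by (auto simp: kset_iff)

lemma conf_link_rev:
  assumes "conf A x" "j \<in> A" "x j = (i, t, - t * w)"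
  shows "x i = (j, t, w)"
  using conf_link(2)[OF assms] conf_link(3)[OF assms(1,2), of i t "- t * w"] assms(3) by auto

text \<open>A second link is exchanged with \<open>j\<close> and another line of its kind;
  afterwards \<open>i\<close> and \<open>j\<close> are ends of different links, and a regrouping
  creates the prescribed link. The first link has to stay at \<open>i\<close> meanwhile, hence the
  four link ends.\<close>

lemma pin_link_mixed:
  assumes x: "conf A x" "finite A" "i \<in> A" "j \<in> A" "4 \<le> card (kset A x 3)"
    and t: "t = 1 \<or> t = -1"
    and i: "lnk x i p" and j: "lkind x j = q" "q < 3" "2 \<le> card (kset A x q)"
  shows "\<exists>x'. reach A 2 x x' \<and> x' i = (j, t, w)"
proof -
  obtain u v where uv: "u \<in> A" "v \<in> A" "lnk x u v" "u \<notin> {i, p}" "v \<notin> {i, p}"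
    using other_link[OF x(1,2,3) i x(5)] by blast
  obtain k where k: "k \<in> A" "lkind x k = q" "k \<noteq> j" using other_kind[OF j(3)] by blast
  have d: "j \<noteq> i" "j \<noteq> p" "k \<noteq> i" "k \<noteq> p" using lnk_lt3[OF _ i] j k by auto
  obtain x1 where x1: "step A x x1" "lnk x1 j k" "off {u, v, j, k} x x1"
    using swap_any[OF x(1,2) uv(1,3) x(4) k(1) k(3)[symmetric] j(1) k(2) j(2)] by blast
  have "lnk x1 i p" using off_lnk[OF x1(3), of i p] uv d i by auto
  then obtain x2 where "step A x1 x2" "x2 i = (j, t, w)"
    using regroup_to[OF step_conf(2)[OF x1(1)] x(2,3,4) _ x1(2) d(1,2) t] by blast
  then show ?thesis using reach_1_1[OF x1(1)] by blast
qed

text \<open>Any line that is not alone of its kind can be put on a link by one exchange. The second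
  move is a regrouping or a flip, both of which leave the offset free.\<close>

lemma pin_link:
  assumes x: "conf A x" "finite A" "i \<in> A" "j \<in> A" "i \<noteq> j" "4 \<le> card (kset A x 3)"
    and t: "t = 1 \<or> t = -1"
    and i: "lkind x i = 3 \<or> 2 \<le> card (kset A x (lkind x i))"
    and j: "lkind x j = 3 \<or> 2 \<le> card (kset A x (lkind x j))"
  shows "\<exists>x'. reach A 2 x x' \<and> x' i = (j, t, w)"
proof -
  have le: "lkind x i < 3" if "lkind x i \<noteq> 3" for i using lkind_le[of x i] that by simp
  consider (both) "lkind x i = 3" "lkind x j = 3" | (left) "lkind x i = 3" "lkind x j \<noteq> 3"
    | (right) "lkind x i \<noteq> 3" "lkind x j = 3" | (same) "lkind x i \<noteq> 3" "lkind x j = lkind x i"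
    | (diff) "lkind x i \<noteq> 3" "lkind x j \<noteq> 3" "lkind x j \<noteq> lkind x i" by blast
  then show ?thesis
  proof cases
    case both
    obtain p where p: "lnk x i p" using lkind3_lnk[OF x(1,3) both(1)] by blast
    show ?thesis
    proof (cases "p = j")
      case True
      obtain s v where xi: "x i = (j, s, v)" "s = 1 \<or> s = -1" using lnkD[OF x(1,3) p] True by metis
      show ?thesis
      proof (cases "s = t")
        case True
        obtain x1 where 1: "step A x x1" "x1 i = (j, - s, 0)"
          using flip_to[OF x(1-3) xi(1) x(5)] by blast
        obtain x2 where 2: "step A x1 x2" "x2 i = (j, s, w)"
          using flip_to[OF step_conf(2)[OF 1(1)] x(2,3) 1(2) x(5), of w] by auto
        then show ?thesis using reach_1_1[OF 1(1)] True by blast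
      next
        case False
        then have "t = - s" using t xi by auto
        then obtain x1 where "step A x x1" "x1 i = (j, t, w)"
          using flip_to[OF x(1-3) xi(1) x(5)] by blast
        then show ?thesis using reach_1_1[OF step_refl[OF x(1)]] by blast
      qed
    next
      case False
      obtain r where r: "lnk x j r" using lkind3_lnk[OF x(1,4) both(2)] by blast
      obtain x1 where "step A x x1" "x1 i = (j, t, w)"
        using regroup_to[OF x(1-4) p r x(5)[symmetric] False[symmetric] t] by blast
      then show ?thesis using reach_1_1[OF step_refl[OF x(1)]] by blast
    qed
  next
    case left
    obtain p where p: "lnk x i p" using lkind3_lnk[OF x(1,3) left(1)] by blast
    show ?thesis using pin_link_mixed[OF x(1-4,6) t p refl le] left j by blast
  next
    case right
    obtain p where p: "lnk x j p" using lkind3_lnk[OF x(1,4) right(2)] by blast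
    obtain x' where x': "reach A 2 x x'" "x' j = (i, t, - t * w)"
      using pin_link_mixed[OF x(1,2,4,3,6) t p refl le] right i by blast
    have "x' i = (j, t, w)"
      using conf_link_rev[where x = x' and j = j, OF _ x(4)] x'(2) reach_conf[OF x'(1)] by blast
    then show ?thesis using x'(1) by blast
  next
    case same
    obtain u v where uv: "u \<in> A" "lnk x u v"
      using kset_ex[of A x 3] lkind3_lnk[OF x(1)] x(6) by fastforce
    obtain y where y: "conf {u} y" "lkind y u = lkind x i"
    proof
      have "fst (x i) = i" using kinds_of_fixed[OF le[OF same(1)]] .
      then show "lkind (\<lambda>_. (u, snd (x i))) u = lkind x i" by (cases "x i") (simp add: lkind_def)
      show "conf {u} (\<lambda>_. (u, snd (x i)))"
        using x(1,3) \<open>fst (x i) = i\<close> by (cases "x i") (auto simp: conf_def lcomp_def dest: bspec[of A _ i])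
    qed
    \<comment> \<open>The exchange creates the link with the wrong sign on purpose: the flip
      reverses it and sets the offset.\<close>
    have "- t = 1 \<or> - t = -1" using t by auto
    then obtain x1 w' where x1: "step A x x1" "x1 i = (j, - t, w')"
      using swap_sgn[OF x(1,2) uv x(3,4,5) refl same(2) le[OF same(1)] _ y(1) _ y(2)] by blast
    obtain x2 where 2: "step A x1 x2" "x2 i = (j, t, w)"
      using flip_to[OF step_conf(2)[OF x1(1)] x(2,3) x1(2) x(5), of w] by auto
    then show ?thesis using reach_1_1[OF x1(1)] by blast
  next
    case diff
    obtain u v where uv: "u \<in> A" "v \<in> A" "lnk x u v"
      using kset_ex[of A x 3] lkind3_lnk[OF x(1)] x(6) by fastforce
    obtain u' v' where uv': "u' \<in> A" "v' \<in> A" "lnk x u' v'" "u' \<notin> {u, v}" "v' \<notin> {u, v}"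
      using other_link[OF x(1,2) uv(1,3) x(6)] by blast
    obtain k where k: "k \<in> A" "lkind x k = lkind x i" "k \<noteq> i"
      using other_kind i diff(1) by blast
    obtain l where l: "l \<in> A" "lkind x l = lkind x j" "l \<noteq> j"
      using other_kind j diff(2) by blast
    obtain x1 where x1: "step A x x1" "lnk x1 i k" "off {u, v, i, k} x x1"
      using swap_any[OF x(1,2) uv(1,3) x(3) k(1) k(3)[symmetric] refl k(2) le[OF diff(1)]] by blast
    obtain x2 where x2: "step A x x2" "lnk x2 j l" "off {u', v', j, l} x x2"
      using swap_any[OF x(1,2) uv'(1,3) x(4) l(1) l(3)[symmetric] refl l(2) le[OF diff(2)]] by blast
    have c: "conf {a, b, c, d} x" if abcd: "a \<in> A" "lnk x a b" "c \<in> A" "d \<in> A" "lkind x c \<noteq> 3" "lkind x d \<noteq> 3" for a b c d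
    proof -
      obtain s v where "x a = (b, s, v)" using lnkD[OF x(1) abcd(1,2)] by metis
      then have "conf {a, b} x" using conf_pair[OF x(1) abcd(1)] by blast
      moreover have "conf {c} x" "conf {d} x"
        using conf_fix[OF x(1)] abcd lkind3 by blast+
      ultimately show ?thesis using conf_Un[of "{a, b}" x "{c} \<union> {d}"] conf_Un[of "{c}" x "{d}"] by (simp add: insert_commute)
    qed
    \<comment> \<open>Two different links are exchanged in the same move. As \<open>i\<close> and
      \<open>j\<close> are of different kinds, so are \<open>k\<close> and \<open>l\<close>, and the
      supports are disjoint.\<close>
    have dis: "{u, v, i, k} \<inter> {u', v', j, l} = {}"
      using uv(3) uv'(3-5) k(2,3) l(2,3) diff lnk_lkind[OF uv(3)] lnk_lkind[OF uv'(3)] by auto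
    obtain x' where x': "step A x x'" "off {u', v', j, l} x1 x'" "off {u, v, i, k} x2 x'"
      using step_par[OF x1(1) x2(1) x(2) x1(3) x2(3) dis] uv uv' x k l c diff by auto
    have "lnk x' i k" "lnk x' j l"
      using off_lnk[OF x'(2), of i k] off_lnk[OF x'(3), of j l] x1(2) x2(2) dis by auto
    moreover have "j \<noteq> k" using k diff by auto
    ultimately obtain x2 where "step A x' x2" "x2 i = (j, t, w)"
      using regroup_to[OF step_conf(2)[OF x'(1)] x(2,3,4) _ _ x(5)[symmetric] _ t] by blast
    then show ?thesis using reach_1_1[OF x'(1)] by blast
  qed
qed

text \<open>Two holes can always receive the link. The fifth line matters when the link is
  \<open>{i, p}\<close> and \<open>j\<close> is empty: it must be parked on two lines other than
  \<open>i\<close>, \<open>p\<close>, \<open>j\<close> before it can come back. With four lines the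
  class is disconnected, see \<open>separated_four\<close>.\<close>

lemma transport_two_holes:
  assumes x: "conf A x" "finite A" "i \<in> A" "j \<in> A" "i \<noteq> j" "card (kset A x 3) = 2"
    and F: "2 \<le> card (kset A x 0)" "5 \<le> card A"
  shows "\<exists>x'. reach A 4 x x' \<and> lnk x' i j"
proof -
  have tk: "lkind x u = 1 \<or> lkind x u = 2" if "lkind x u \<noteq> 0" "lkind x u \<noteq> 3" for u
    using lkind_le[of x u] that by linarith
  have other: "\<exists>h. h \<in> A \<and> lkind x h = 0 \<and> h \<noteq> a" for a using other_kind[OF F(1)] by blast
  have mixed: "\<exists>x'. reach A 3 x x' \<and> lnk x' i j"
    if ij: "i \<in> A" "j \<in> A" "i \<noteq> j" and i: "lkind x i = 0 \<or> lkind x i \<noteq> 3" and j: "lkind x j \<noteq> 3"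
    for i j
  proof -
    obtain p p' where p: "p \<in> A" "p' \<in> A" "lnk x p p'"
      using kset_ex[of A x 3] lkind3_lnk[OF x(1)] x(6) by fastforce
    have np: "i \<noteq> p" "i \<noteq> p'" "j \<noteq> p" "j \<noteq> p'" using i j p lnk_lkind by fastforce+
    consider "lkind x i = 0" "lkind x j = 0" | "lkind x i \<noteq> 0" "lkind x j = 0"
      | "lkind x i = 0" "lkind x j \<noteq> 0" | "lkind x i \<noteq> 0" "lkind x j \<noteq> 0" by blast
    \<comment> \<open>One hop empties each of \<open>i\<close> and \<open>j\<close> if necessary;
      the link enters in a third move.\<close>
    then have "\<exists>y. reach A 2 x y \<and> lkind y i = 0 \<and> lkind y j = 0 \<and> lnk y p p'"
    proof cases
      case 1
      then show ?thesis using reach_refl x p by blast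
    next
      case 2
      obtain h where h: "h \<in> A" "lkind x h = 0" "h \<noteq> j" using other by blast
      obtain x1 where x1: "step A x x1" "lkind x1 i = 0" "off {i, h} x x1"
        using hop_any[OF x(1,2) ij(1) h(1) refl tk h(2)] i 2 by auto
      have "lkind x1 j = 0" "lnk x1 p p'"
        using offD(2)[OF x1(3), of j] off_lnk[OF x1(3), of p p'] ij h 2 np p lnk_lt3[of x h p p'] by auto
      then show ?thesis using x1(2) reach_mono[OF reach_step[OF x1(1)], of 2] by auto
    next
      case 3
      obtain h where h: "h \<in> A" "lkind x h = 0" "h \<noteq> i" using other by blast
      obtain x1 where x1: "step A x x1" "lkind x1 j = 0" "off {j, h} x x1"
        using hop_any[OF x(1,2) ij(2) h(1) refl tk h(2)] j 3 by auto
      have "lkind x1 i = 0" "lnk x1 p p'"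
        using offD(2)[OF x1(3), of i] off_lnk[OF x1(3), of p p'] ij h 3 np p lnk_lt3[of x h p p'] by auto
      then show ?thesis using x1(2) reach_mono[OF reach_step[OF x1(1)], of 2] by auto
    next
      case 4
      obtain g h where h: "g \<in> A" "h \<in> A" "lkind x g = 0" "lkind x h = 0" "g \<noteq> h" using two_kind[OF F(1)] by blast
      have gh: "g \<noteq> i" "g \<noteq> j" "h \<noteq> i" "h \<noteq> j" "g \<noteq> p" "g \<noteq> p'" "h \<noteq> p" "h \<noteq> p'" 
        using h 4 lnk_lt3[of x h p p'] lnk_lt3[of x g p p'] p by auto
      obtain x1 where x1: "step A x x1" "lkind x1 i = 0" "off {i, g} x x1"
        using hop_any[OF x(1,2) ij(1) h(1) refl tk h(3)] i 4 by auto
      have 1: "lkind x1 j = lkind x j" "lkind x1 h = 0" "lnk x1 p p'"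
        using offD(2)[OF x1(3), of j] offD(2)[OF x1(3), of h] off_lnk[OF x1(3), of p p'] ij h gh np p by auto
      have "lkind x1 j = 1 \<or> lkind x1 j = 2" using tk[of j] 1 4 j by simp
      then obtain x2 where x2: "step A x1 x2" "lkind x2 j = 0" "off {j, h} x1 x2"
        using hop_any[OF step_conf(2)[OF x1(1)] x(2) ij(2) h(2) refl _ 1(2)] by auto
      have "lkind x2 i = 0" "lnk x2 p p'"
        using offD(2)[OF x2(3), of i] off_lnk[OF x2(3), of p p'] ij gh np p 1 x1 by auto
      then show ?thesis using x2(2) reach_1_1[OF x1(1) x2(1)] by auto
    qed
    then obtain y where y: "reach A 2 x y" "lkind y i = 0" "lkind y j = 0" "lnk y p p'" by blast
    obtain x' where "step A y x'" "lnk x' i j"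
      using swap_any[OF _ x(2) p(1) y(4) ij y(2,3)] reach_conf[OF y(1)] by auto
    then show ?thesis using reach_snoc[OF y(1)] by (metis numeral_3_eq_3 numeral_2_eq_2)
  qed
  have onein: "\<exists>x'. reach A 4 x x' \<and> lnk x' i j"
    if ij: "i \<in> A" "j \<in> A" "i \<noteq> j" and i: "lnk x i p" and j: "lkind x j \<noteq> 3" for i j p
  proof -
    have p: "p \<in> A" "p \<noteq> i" using lnk_mem[OF x(1) ij(1) i] i by (auto simp: lnk_def)
    have d: "j \<noteq> p" using j lnk_lkind[OF i] by auto
    have P: "kset A x 3 = {i, p}"
      using x(6) lnk_lkind[OF i] p ij(1) by (intro card_subset_eq[symmetric]) (auto simp: kset_iff x(2))
    have le: "lkind x z < 3" if "z \<in> A" "z \<noteq> i" "z \<noteq> p" for z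
      using that P kset_iff[of z A x 3] lkind_le[of x z] by (auto simp: le_less)
    \<comment> \<open>The link is parked on \<open>{g, h}\<close>, and \<open>i\<close> and
      \<open>p\<close> are empty: the token at \<open>j\<close> hops to \<open>p\<close>, and the
      link returns to \<open>{i, j}\<close>.\<close>
    have tail: "\<exists>x'. step A y x' \<and> (\<exists>x''. step A x' x'' \<and> lnk x'' i j)"
      if y: "conf A y" "lkind y i = 0" "lkind y p = 0" "lkind y j = 1 \<or> lkind y j = 2" "lnk y g h" "g \<in> A" for y g h
    proof -
      obtain y1 where y1: "step A y y1" "lkind y1 j = 0" "off {j, p} y y1"
        using hop_any[OF y(1) x(2) ij(2) p(1) refl y(4,3)] by blast
      have "j \<noteq> g" "j \<noteq> h" "i \<noteq> g" "i \<noteq> h" "p \<noteq> g" "p \<noteq> h" using y lnk_lkind[OF y(5)] by auto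
      then have "lkind y1 i = 0" "lnk y1 g h"
        using offD(2)[OF y1(3), of i] off_lnk[OF y1(3), of g h] ij p y by auto
      then show ?thesis
        using swap_any[OF step_conf(2)[OF y1(1)] x(2) y(6) _ ij _ y1(2)] y1(1) by fastforce
    qed
    show ?thesis
    proof (cases "lkind x j = 0")
      case False
      obtain g h where h: "g \<in> A" "h \<in> A" "lkind x g = 0" "lkind x h = 0" "g \<noteq> h" using two_kind[OF F(1)] by blast
      obtain y where y: "step A x y" "lnk y g h" "lkind y i = 0" "lkind y p = 0" "off {i, p, g, h} x y"
        using swap_any[OF x(1,2) ij(1) i h(1,2,5,3,4)] by auto
      have "j \<noteq> g" "j \<noteq> h" using h False by auto
      then have "lkind y j = lkind x j" using offD(2)[OF y(5), of j] d ij by auto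
      then obtain x1 x2 where "step A y x1" "step A x1 x2" "lnk x2 i j"
        using tail[OF step_conf(2)[OF y(1)] y(3,4) _ y(2) h(1)] tk[of j] j False by auto
      then have "reach A 3 x x2" using reach_Cons[OF y(1)] reach_1_1 by (metis numeral_3_eq_3 numeral_2_eq_2)
      then show ?thesis using reach_mono[of A 3 x x2 4] \<open>lnk x2 i j\<close> by auto
    next
      case j0: True
      obtain h where h: "h \<in> A" "lkind x h = 0" "h \<noteq> j" using other by blast
      have hd: "h \<noteq> i" "h \<noteq> p" using lnk_lt3[OF _ i, of h] h by auto
      have "card {i, p, j, h} \<le> 4" by (simp add: card_insert_if)
      then obtain l where l: "l \<in> A" "l \<notin> {i, p, j, h}" using others_of[of "{i, p, j, h}" A] F(2) by auto
      show ?thesis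
      proof (cases "lkind x l = 0")
        case True
        obtain y where y: "step A x y" "lnk y h l" "lkind y i = 0" "off {i, p, h, l} x y"
          using swap_any[OF x(1,2) ij(1) i h(1) l(1) _ h(2) True] l(2) by auto
        have "lkind y j = 0" using offD(2)[OF y(4), of j] d ij h l j0 by auto
        then obtain x' where "step A y x'" "lnk x' i j"
          using swap_any[OF step_conf(2)[OF y(1)] x(2) h(1) y(2) ij y(3)] by auto
        then show ?thesis using reach_mono[OF reach_1_1[OF y(1)], of x' 4] by auto
      next
        case False
        \<comment> \<open>The token at \<open>l\<close> hops to \<open>j\<close>, so that
          \<open>h\<close> and \<open>l\<close> become a parking place for the link.\<close>
        have l12: "lkind x l = 1 \<or> lkind x l = 2" using tk[OF False] le[of l] l by auto
        obtain y where y: "step A x y" "lkind y j = lkind x l" "lkind y l = 0" "off {l, j} x y"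
          using hop_any[OF x(1,2) l(1) ij(2) refl l12 j0] by blast
        have y': "lnk y i p" "lkind y h = 0"
          using offD(2)[OF y(4), of h] off_lnk[OF y(4), of i p] d ij h l i by auto
        have hl: "h \<noteq> l" using l by auto
        obtain z where z: "step A y z" "lnk z h l" "lkind z i = 0" "lkind z p = 0" "off {i, p, h, l} y z"
          using swap_any[OF step_conf(2)[OF y(1)] x(2) ij(1) y'(1) h(1) l(1) hl y'(2) y(3)] by auto
        have "lkind z j = lkind x l" using offD(2)[OF z(5), of j] d ij h l y by auto
        then obtain x1 x2 where "step A z x1" "step A x1 x2" "lnk x2 i j"
          using tail[OF step_conf(2)[OF z(1)] z(3,4) _ z(2) h(1)] l12 by auto
        then have "reach A 4 x x2"
          using reach_Cons[OF y(1) reach_Cons[OF z(1) reach_1_1]] by (simp add: eval_nat_numeral)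
        then show ?thesis using \<open>lnk x2 i j\<close> by blast
      qed
    qed
  qed
  consider (both) "lkind x i = 3" "lkind x j = 3" | (left) "lkind x i = 3" "lkind x j \<noteq> 3"
    | (right) "lkind x i \<noteq> 3" "lkind x j = 3" | (none) "lkind x i \<noteq> 3" "lkind x j \<noteq> 3" by blast
  then show ?thesis
  proof cases
    case both
    obtain p where p: "lnk x i p" "p \<in> A" using lkind3_lnk[OF x(1,3) both(1)] by blast
    have "kset A x 3 = {i, j}"
      using x(2-6) both by (intro card_subset_eq[symmetric]) (auto simp: kset_iff)
    then have "p = j" using p lnk_lkind[OF p(1)] by (auto simp: kset_def lnk_def)
    then show ?thesis using p reach_refl[OF x(1)] by blast
  next
    case left
    obtain p where p: "lnk x i p" "p \<in> A" using lkind3_lnk[OF x(1,3) left(1)] by blast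
    then show ?thesis using onein x left by blast
  next
    case right
    obtain p where p: "lnk x j p" "p \<in> A" using lkind3_lnk[OF x(1,4) right(2)] by blast
    then obtain x' where "reach A 4 x x'" "lnk x' j i" using onein[OF x(4,3) x(5)[symmetric]] right by blast
    then show ?thesis using lnk_sym by blast
  next
    case none
    then show ?thesis using mixed[OF x(3-5)] reach_mono[of A 3 x _ 4] by fastforce
  qed
qed

text \<open>
  If the link \<open>{i, j}\<close> is reached only after four steps, the hole differs from the prescribed hole
  \<open>h0\<close>, and this saves one step in the subsequent motion of the tokens.
\<close>

definition moved :: "nat set \<Rightarrow> nat \<Rightarrow> nat \<Rightarrow> nat \<Rightarrow> lmap \<Rightarrow> bool" where
  "moved A h0 i j x \<longleftrightarrow> (\<exists>x'. lnk x' i j \<and>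
     (reach A 3 x x' \<or> reach A 4 x x' \<and> (\<exists>g\<in>A. g \<noteq> h0 \<and> lkind x' g = 0)))"

lemma moved_sym: "moved A h0 i j x \<Longrightarrow> moved A h0 j i x"
  unfolding moved_def using lnk_sym by blast

lemma movedI3: "reach A n x x' \<Longrightarrow> n \<le> 3 \<Longrightarrow> lnk x' i j \<Longrightarrow> moved A h0 i j x"
  unfolding moved_def using reach_mono by blast

lemma reach_1_1_1: "step A x y \<Longrightarrow> step A y z \<Longrightarrow> step A z w \<Longrightarrow> reach A 3 x w"
  using reach_Cons[OF _ reach_1_1] by (metis numeral_3_eq_3 numeral_2_eq_2)

lemma reach_1_1_1_1: "step A x y \<Longrightarrow> step A y z \<Longrightarrow> step A z w \<Longrightarrow> step A w u \<Longrightarrow> reach A 4 x u"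
  using reach_Cons[OF _ reach_1_1_1] by (simp add: eval_nat_numeral)

text \<open>Tokens of a colour that occurs twice replace the second hole as partners of the link. In
  the exceptional outcomes the hole would end at \<open>h0\<close>, the old partner of
  \<open>i\<close> or \<open>j\<close>, and nothing is saved later; \<open>one_link_one_hole\<close>
  treats them by going from \<open>y\<close> to \<open>x\<close>.\<close>

lemma transport_one_hole:
  assumes x: "conf A x" "finite A" "i \<in> A" "j \<in> A" "i \<noteq> j" "card (kset A x 3) = 2"
    and F: "card (kset A x 0) = 1" and q: "q = 1 \<or> q = 2" "2 \<le> card (kset A x q)"
  shows "moved A h0 i j x \<or> lnk x i h0 \<and> lkind x j \<noteq> 0 \<or> lnk x j h0 \<and> lkind x i \<noteq> 0"
proof -
  have tk: "lkind x u = 1 \<or> lkind x u = 2" if "lkind x u \<noteq> 0" "lkind x u \<noteq> 3" for u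
    using lkind_le[of x u] that by linarith
  have q3: "q < 3" "q \<noteq> 0" using q by auto
  obtain p p' where p: "p \<in> A" "p' \<in> A" "lnk x p p'"
    using kset_ex[of A x 3] lkind3_lnk[OF x(1)] x(6) by fastforce
  have k3: "lkind x p = 3" "lkind x p' = 3" using lnk_lkind[OF p(3)] by auto
  have P: "kset A x 3 = {p, p'}"
    using x(6) p k3 by (intro card_subset_eq[symmetric]) (auto simp: kset_iff x(2) lnk_def)
  have hole_token: "moved A h0 i j x"
    if ij: "i \<in> A" "j \<in> A" "i \<noteq> j" "lkind x i = 0" "lkind x j \<noteq> 0" "lkind x j \<noteq> 3" for i j
  proof (cases "2 \<le> card (kset A x (lkind x j))")
    case True
    obtain k where k: "k \<in> A" "lkind x k = lkind x j" "k \<noteq> j" using other_kind[OF True] by blast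
    obtain x1 where x1: "step A x x1" "lkind x1 i = lkind x j" "off {k, i} x x1"
      using hop_any[OF x(1,2) k(1) ij(1) k(2) tk ij(4)] ij by blast
    have "k \<noteq> p" "k \<noteq> p'" "i \<noteq> p" "i \<noteq> p'" using k ij k3 by auto
    then have "lkind x1 j = lkind x j" "lnk x1 p p'"
      using offD(2)[OF x1(3), of j] off_lnk[OF x1(3), of p p'] ij k p by auto
    then obtain x2 where "step A x1 x2" "lnk x2 i j"
      using swap_any[OF step_conf(2)[OF x1(1)] x(2) p(1) _ ij(1-3) x1(2)] ij lkind_le[of x j] by (auto simp: le_less)
    then show ?thesis using movedI3[OF reach_1_1[OF x1(1)]] by auto
  next
    case False
    \<comment> \<open>The hole will end at \<open>l\<close>, which is therefore chosen different
      from \<open>h0\<close>.\<close>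
    obtain k l where kl: "k \<in> A" "l \<in> A" "lkind x k = q" "lkind x l = q" "k \<noteq> l" "l \<noteq> h0"
    proof -
      obtain k l where "k \<in> A" "l \<in> A" "lkind x k = q" "lkind x l = q" "k \<noteq> l" using two_kind[OF q(2)] by blast
      then show thesis using that[of k l] that[of l k] by auto
    qed
    have jq: "lkind x j \<noteq> q" using False q by auto
    have ne: "k \<noteq> i" "k \<noteq> j" "l \<noteq> i" "l \<noteq> j" "k \<noteq> p" "k \<noteq> p'" "l \<noteq> p" "l \<noteq> p'" "i \<noteq> p" "i \<noteq> p'" "j \<noteq> p" "j \<noteq> p'"
      using kl ij jq k3 q3 by auto
    obtain x1 where x1: "step A x x1" "lkind x1 i = q" "lkind x1 k = 0" "off {k, i} x x1"
      using hop_any[OF x(1,2) kl(1) ij(1) kl(3) q(1) ij(4)] by blast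
    have 1: "lkind x1 j = lkind x j" "lnk x1 p p'" "lkind x1 l = q"
      using offD(2)[OF x1(4), of j] offD(2)[OF x1(4), of l] off_lnk[OF x1(4), of p p'] ij kl ne p by auto
    have "lkind x j = 1 \<or> lkind x j = 2" using tk ij by blast
    then obtain x2 where x2: "step A x1 x2" "lkind x2 j = 0" "off {j, k} x1 x2"
      using hop_any[OF step_conf(2)[OF x1(1)] x(2) ij(2) kl(1) 1(1) _ x1(3)] by blast
    have 2: "lkind x2 i = q" "lnk x2 p p'" "lkind x2 l = q"
      using offD(2)[OF x2(3), of i] offD(2)[OF x2(3), of l] off_lnk[OF x2(3), of p p'] ij kl ne 1 x1 by auto
    obtain x3 where x3: "step A x2 x3" "lkind x3 j = q" "lkind x3 l = 0" "off {l, j} x2 x3"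
      using hop_any[OF step_conf(2)[OF x2(1)] x(2) kl(2) ij(2) 2(3) q(1) x2(2)] by blast
    have 3: "lkind x3 i = q" "lnk x3 p p'"
      using offD(2)[OF x3(4), of i] off_lnk[OF x3(4), of p p'] ij kl ne 2 by auto
    obtain x4 where x4: "step A x3 x4" "lnk x4 i j" "off {p, p', i, j} x3 x4"
      using swap_any[OF step_conf(2)[OF x3(1)] x(2) p(1) 3(2) ij(1-3) 3(1) x3(2) q3(1)] by blast
    have "lkind x4 l = 0" using offD(2)[OF x4(3), of l] ne x3 by auto
    then show ?thesis
      unfolding moved_def using reach_1_1_1_1[OF x1(1) x2(1) x3(1) x4(1)] x4(2) kl by blast
  qed
  have tokens: "moved A h0 i j x"
    if ij: "i \<in> A" "j \<in> A" "i \<noteq> j" "lkind x i \<noteq> 0" "lkind x i \<noteq> 3" "lkind x j \<noteq> 0" "lkind x j \<noteq> 3"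
      "lkind x i \<noteq> lkind x j" "2 \<le> card (kset A x (lkind x i))" for i j
  proof -
    have ti: "lkind x i = 1 \<or> lkind x i = 2" and tj: "lkind x j = 1 \<or> lkind x j = 2"
      using tk[of i] tk[of j] ij by auto
    obtain h where h: "h \<in> A" "lkind x h = 0" using kset_ex[of A x 0] F by auto
    obtain k where k: "k \<in> A" "lkind x k = lkind x i" "k \<noteq> i" using other_kind[OF ij(9)] by blast
    have ne: "k \<noteq> h" "k \<noteq> j" "h \<noteq> i" "h \<noteq> j" "k \<noteq> p" "k \<noteq> p'" "h \<noteq> p" "h \<noteq> p'" "i \<noteq> p" "i \<noteq> p'" "j \<noteq> p" "j \<noteq> p'"
      using h k ij k3 by auto
    obtain x1 where x1: "step A x x1" "lkind x1 j = 0" "off {j, h} x x1"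
      using hop_any[OF x(1,2) ij(2) h(1) refl tj h(2)] by blast
    have 1: "lkind x1 i = lkind x i" "lnk x1 p p'" "lkind x1 k = lkind x i"
      using offD(2)[OF x1(3), of i] offD(2)[OF x1(3), of k] off_lnk[OF x1(3), of p p'] ij k ne p by auto
    obtain x2 where x2: "step A x1 x2" "lkind x2 j = lkind x i" "off {k, j} x1 x2"
      using hop_any[OF step_conf(2)[OF x1(1)] x(2) k(1) ij(2) 1(3) ti x1(2)] by blast
    have 2: "lkind x2 i = lkind x i" "lnk x2 p p'"
      using offD(2)[OF x2(3), of i] off_lnk[OF x2(3), of p p'] ij k ne 1 by auto
    obtain x3 where x3: "step A x2 x3" "lnk x3 i j"
      using swap_any[OF step_conf(2)[OF x2(1)] x(2) p(1) 2(2) ij(1-3) 2(1) x2(2)] ti by auto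
    then show ?thesis using movedI3[OF reach_1_1_1[OF x1(1) x2(1)]] by auto
  qed
  have linked: "moved A h0 i j x \<or> lnk x i h0 \<and> lkind x j \<noteq> 0"
    if ij: "i \<in> A" "j \<in> A" "i \<noteq> j" "lnk x i p" "lkind x j \<noteq> 3" for i j p
  proof -
    have p: "p \<in> A" "p \<noteq> i" using lnk_mem[OF x(1) ij(1,4)] ij(4) by (auto simp: lnk_def)
    have kp: "lkind x i = 3" "lkind x p = 3" using lnk_lkind[OF ij(4)] by auto
    have jp: "j \<noteq> p" using kp ij(5) by auto
    show ?thesis
    proof (cases "lkind x j = 0")
      case j0: True
      obtain k l where kl: "k \<in> A" "l \<in> A" "lkind x k = q" "lkind x l = q" "k \<noteq> l" using two_kind[OF q(2)] by blast
      have ne: "k \<noteq> i" "k \<noteq> j" "l \<noteq> i" "l \<noteq> j" "k \<noteq> p" "l \<noteq> p" using kl j0 kp q3 by auto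
      obtain x1 where x1: "step A x x1" "lnk x1 k l" "lkind x1 i = q" "lkind x1 p = q" "off {i, p, k, l} x x1"
        using swap_any[OF x(1,2) ij(1,4) kl(1,2,5,3,4) q3(1)] by blast
      have 1: "lkind x1 j = 0" using offD(2)[OF x1(5), of j] ij jp ne j0 by auto
      obtain x2 where x2: "step A x1 x2" "lkind x2 j = q" "off {p, j} x1 x2"
        using hop_any[OF step_conf(2)[OF x1(1)] x(2) p(1) ij(2) x1(4) q(1) 1] by blast
      have 2: "lkind x2 i = q" "lnk x2 k l"
        using offD(2)[OF x2(3), of i] off_lnk[OF x2(3), of k l] ij p ne x1 by auto
      obtain x3 where x3: "step A x2 x3" "lnk x3 i j"
        using swap_any[OF step_conf(2)[OF x2(1)] x(2) kl(1) 2(2) ij(1-3) 2(1) x2(2) q3(1)] by blast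
      then show ?thesis using movedI3[OF reach_1_1_1[OF x1(1) x2(1)]] by auto
    next
      case False
      then have tj: "lkind x j = 1 \<or> lkind x j = 2" using tk ij by blast
      obtain h where h: "h \<in> A" "lkind x h = 0" using kset_ex[of A x 0] F by auto
      have hne: "h \<noteq> i" "h \<noteq> j" "h \<noteq> p" using h False kp by auto
      \<comment> \<open>The link leaves \<open>{i, p}\<close> for tokens of colour \<open>q\<close>,
        the token so created at \<open>p\<close> hops to \<open>j\<close>, and the link returns to
        \<open>{i, j}\<close>. This is why the hole ends at \<open>p\<close>.\<close>
      have "\<exists>x'. lnk x' i j \<and> reach A 4 x x' \<and> lkind x' p = 0"
      proof (cases "q = lkind x j")
        case True
        obtain k where k: "k \<in> A" "lkind x k = q" "k \<noteq> j" using other_kind[OF q(2)] by blast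
        have ne: "k \<noteq> i" "k \<noteq> p" "k \<noteq> h" using k kp q3 h by auto
        obtain x1 where x1: "step A x x1" "lkind x1 h = q" "lkind x1 j = 0" "off {j, h} x x1"
          using hop_any[OF x(1,2) ij(2) h(1) True[symmetric] q(1) h(2)] by blast
        have 1: "lkind x1 k = q" "lnk x1 i p"
          using offD(2)[OF x1(4), of k] off_lnk[OF x1(4), of i p] ij k jp ne hne by auto
        obtain x2 where x2: "step A x1 x2" "lnk x2 h k" "lkind x2 i = q" "lkind x2 p = q" "off {i, p, h, k} x1 x2"
          using swap_any[OF step_conf(2)[OF x1(1)] x(2) ij(1) 1(2) h(1) k(1) ne(3)[symmetric] x1(2) 1(1) q3(1)] by blast
        have 2: "lkind x2 j = 0" using offD(2)[OF x2(5), of j] ij jp k hne x1 by auto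
        obtain x3 where x3: "step A x2 x3" "lkind x3 j = q" "lkind x3 p = 0" "off {p, j} x2 x3"
          using hop_any[OF step_conf(2)[OF x2(1)] x(2) p(1) ij(2) x2(4) q(1) 2] by blast
        have 3: "lkind x3 i = q" "lnk x3 h k"
          using offD(2)[OF x3(4), of i] off_lnk[OF x3(4), of h k] ij p ne k hne x2 by auto
        obtain x4 where x4: "step A x3 x4" "lnk x4 i j" "off {h, k, i, j} x3 x4"
          using swap_any[OF step_conf(2)[OF x3(1)] x(2) h(1) 3(2) ij(1-3) 3(1) x3(2) q3(1)] by blast
        have "lkind x4 p = 0" using offD(2)[OF x4(3), of p] hne ne p jp x3 by auto
        then show ?thesis using reach_1_1_1_1[OF x1(1) x2(1) x3(1) x4(1)] x4(2) by blast
      next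
        case jq: False
        obtain k l where kl: "k \<in> A" "l \<in> A" "lkind x k = q" "lkind x l = q" "k \<noteq> l" using two_kind[OF q(2)] by blast
        have ne: "k \<noteq> i" "k \<noteq> j" "l \<noteq> i" "l \<noteq> j" "k \<noteq> p" "l \<noteq> p" "k \<noteq> h" "l \<noteq> h" using kl jq kp q3 h by auto
        obtain x1 where x1: "step A x x1" "lnk x1 k l" "lkind x1 i = q" "lkind x1 p = q" "off {i, p, k, l} x x1"
          using swap_any[OF x(1,2) ij(1,4) kl(1,2,5,3,4) q3(1)] by blast
        have 1: "lkind x1 j = lkind x j" "lkind x1 h = 0"
          using offD(2)[OF x1(5), of j] offD(2)[OF x1(5), of h] ij jp ne hne h by auto
        obtain x2 where x2: "step A x1 x2" "lkind x2 j = 0" "off {j, h} x1 x2"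
          using hop_any[OF step_conf(2)[OF x1(1)] x(2) ij(2) h(1) 1(1) tj 1(2)] by blast
        have 2: "lkind x2 i = q" "lnk x2 k l" "lkind x2 p = q"
          using offD(2)[OF x2(3), of i] offD(2)[OF x2(3), of p] off_lnk[OF x2(3), of k l] ij p ne x1 jp hne by auto
        obtain x3 where x3: "step A x2 x3" "lkind x3 j = q" "lkind x3 p = 0" "off {p, j} x2 x3"
          using hop_any[OF step_conf(2)[OF x2(1)] x(2) p(1) ij(2) 2(3) q(1) x2(2)] by blast
        have 3: "lkind x3 i = q" "lnk x3 k l"
          using offD(2)[OF x3(4), of i] off_lnk[OF x3(4), of k l] ij p ne 2 by auto
        obtain x4 where x4: "step A x3 x4" "lnk x4 i j" "off {k, l, i, j} x3 x4"
          using swap_any[OF step_conf(2)[OF x3(1)] x(2) kl(1) 3(2) ij(1-3) 3(1) x3(2) q3(1)] by blast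
        have "lkind x4 p = 0" using offD(2)[OF x4(3), of p] ne p jp x3 by auto
        then show ?thesis using reach_1_1_1_1[OF x1(1) x2(1) x3(1) x4(1)] x4(2) by blast
      qed
      then show ?thesis unfolding moved_def using p ij(4) False by metis
    qed
  qed
  consider (both) "lkind x i = 3" "lkind x j = 3" | (left) "lkind x i = 3" "lkind x j \<noteq> 3"
    | (right) "lkind x i \<noteq> 3" "lkind x j = 3" | (none) "lkind x i \<noteq> 3" "lkind x j \<noteq> 3" by blast
  then show ?thesis
  proof cases
    case both
    then have "lnk x i j \<or> lnk x j i" using P x(3,4,5) p(3) kset_iff[of i A x 3] kset_iff[of j A x 3] by auto
    then have "lnk x i j" using lnk_sym by blast
    then show ?thesis using movedI3[OF reach_refl[OF x(1), of 0]] by auto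
  next
    case left
    then obtain p where "lnk x i p" using lkind3_lnk[OF x(1,3)] by blast
    then show ?thesis using linked[OF x(3,4,5)] left by blast
  next
    case right
    then obtain p where "lnk x j p" using lkind3_lnk[OF x(1,4)] by blast
    then show ?thesis using linked[OF x(4,3) x(5)[symmetric]] right moved_sym by blast
  next
    case none
    consider "lkind x i = lkind x j" | "lkind x i \<noteq> lkind x j" "lkind x i = 0" | "lkind x i \<noteq> lkind x j" "lkind x j = 0"
      | "lkind x i \<noteq> lkind x j" "lkind x i \<noteq> 0" "lkind x j \<noteq> 0" by blast
    then have "moved A h0 i j x"
    proof cases
      case 1
      then obtain x1 where "step A x x1" "lnk x1 i j"
        using swap_any[OF x(1,2) p(1,3) x(3,4,5) refl 1[symmetric]] none lkind_le[of x i] by (auto simp: le_less)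
      then show ?thesis using movedI3[OF reach_step] by auto
    next
      case 2
      then show ?thesis using hole_token[OF x(3,4,5)] none by auto
    next
      case 3
      then show ?thesis using hole_token[OF x(4,3) x(5)[symmetric]] none moved_sym by auto
    next
      case 4
      then have "lkind x i = q \<or> lkind x j = q" using tk[of i] tk[of j] none q by auto
      then show ?thesis
        using tokens[OF x(3,4,5)] tokens[OF x(4,3) x(5)[symmetric]] 4 none q(2) moved_sym by metis
    qed
    then show ?thesis by blast
  qed
qed

text \<open>Supplies a label to the exchange lemmas when the label does not matter.\<close>

lemma lkind_dummy: "q = 1 \<or> q = 2 \<Longrightarrow> \<exists>y. conf {w} y \<and> lkind y w = q"
proof -
  assume q: "q = 1 \<or> q = 2"
  have "conf {w} (\<lambda>_. (w, -1, c))" for c by (simp add: conf_def lcomp_def)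
  moreover have "lkind (\<lambda>_. (w, -1, if q = 1 then 0 else 1)) w = q" using q by (auto simp: lkind_def)
  ultimately show ?thesis by blast
qed

lemma reach_6:
  "step A a b \<Longrightarrow> step A b c \<Longrightarrow> step A c d \<Longrightarrow> step A d e \<Longrightarrow> step A e f \<Longrightarrow> step A f g \<Longrightarrow> reach A 6 a g"
  using reach_Cons[of A a b 5 g] reach_Cons[OF _ reach_1_1_1_1, of A b c d e f g] by (simp add: eval_nat_numeral)

text \<open>The hole \<open>j\<close> and the only \<open>q'\<close>-token, at \<open>i\<close>,
  cannot take part in an exchange, so hops bring tokens of the frequent colour \<open>q\<close> to
  \<open>j\<close> and \<open>i\<close> before a link enters there. On the way the
  \<open>q'\<close>-token is set down at \<open>w\<close> with its label in
  \<open>y\<close>.\<close>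

lemma two_links_path_a:
  assumes x: "conf A x" "finite A" and mem: "j \<in> A" "j2 \<in> A" "i \<in> A" "i2 \<in> A" "w \<in> A" "w' \<in> A" "k \<in> A" "l \<in> A"
    and l: "lnk x j2 w" "lnk x i2 w'" "i2 \<noteq> j2" "i2 \<noteq> w"
    and q: "q = 1 \<or> q = 2" "q' = 1 \<or> q' = 2" "q \<noteq> q'"
    and kj: "lkind x j = 0" and ki: "lkind x i = q'" and kk: "lkind x k = q" "lkind x l = q" "k \<noteq> l"
    and y: "conf C y" "w \<in> C" "lkind y w = q'"
  shows "\<exists>x'. reach A 6 x x' \<and> lnk x' j j2 \<and> lnk x' i i2 \<and> x' w = y w \<and> lkind x' w = q' \<and> lkind x' w' = 0"
proof -
  have q3: "q < 3" "q \<noteq> 0" "q' \<noteq> 0" "q' \<noteq> 3" using q by auto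
  have k3: "lkind x j2 = 3" "lkind x w = 3" "lkind x i2 = 3" "lkind x w' = 3" using lnk_lkind l by auto
  have ne1: "j2 \<noteq> w" "i2 \<noteq> w'" "w' \<noteq> j2" "w' \<noteq> w" using l by (auto simp: lnk_def)
  have ne2: "j \<noteq> i" "j \<noteq> j2" "j \<noteq> i2" "j \<noteq> w" "j \<noteq> w'" "j \<noteq> k" "j \<noteq> l" "i \<noteq> j2" "i \<noteq> i2" "i \<noteq> w" "i \<noteq> w'" "i \<noteq> k" "i \<noteq> l"
    "k \<noteq> j2" "k \<noteq> i2" "k \<noteq> w" "k \<noteq> w'" "l \<noteq> j2" "l \<noteq> i2" "l \<noteq> w" "l \<noteq> w'"
    using k3 kj ki kk q q3 by auto
  note ne = ne1 ne2 ne1[symmetric] ne2[symmetric] l(3,4) l(3,4)[symmetric] kk(3)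
  obtain x1 where x1: "step A x x1" "lnk x1 k l" "lkind x1 j2 = q" "lkind x1 w = q" "off {j2, w, k, l} x x1"
    using swap_any[OF x mem(2) l(1) mem(7,8) kk(3,1,2) q3(1)] by blast
  have 1: "lkind x1 j = 0" "lkind x1 i = q'" "lnk x1 i2 w'"
    using offD(2)[OF x1(5), of j] offD(2)[OF x1(5), of i] off_lnk[OF x1(5), of i2 w'] ne l kj ki by auto
  obtain x2 where x2: "step A x1 x2" "lkind x2 j = q" "lkind x2 w = 0" "off {w, j} x1 x2"
    using hop_any[OF step_conf(2)[OF x1(1)] x(2) mem(5,1) x1(4) q(1) 1(1)] by blast
  have 2: "lkind x2 i = q'" "lnk x2 i2 w'" "lkind x2 j2 = q" "lnk x2 k l"
    using offD(2)[OF x2(4), of j2] offD(2)[OF x2(4), of i] off_lnk[OF x2(4), of i2 w'] off_lnk[OF x2(4), of k l] ne 1 x1 by auto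
  obtain x3 where x3: "step A x2 x3" "lnk x3 j j2" "lkind x3 i2 = q" "lkind x3 w' = q" "off {i2, w', j, j2} x2 x3"
    using swap_any[OF step_conf(2)[OF x2(1)] x(2) mem(4) 2(2) mem(1,2) ne2(2) x2(2) 2(3) q3(1)] by blast
  have 3: "lkind x3 i = q'" "lkind x3 w = 0" "lnk x3 k l"
    using offD(2)[OF x3(5), of w] offD(2)[OF x3(5), of i] off_lnk[OF x3(5), of k l] ne 2 x2 by auto
  obtain x4 where x4: "step A x3 x4" "x4 w = y w" "lkind x4 w = q'" "lkind x4 i = 0" "off {i, w} x3 x4"
    using hop_lab[OF step_conf(2)[OF x3(1)] x(2) mem(3,5) 3(1) q(2) 3(2) y] by blast
  have 4: "lkind x4 w' = q" "lkind x4 i2 = q" "lnk x4 k l" "lnk x4 j j2"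
    using offD(2)[OF x4(5), of w'] offD(2)[OF x4(5), of i2] off_lnk[OF x4(5), of k l] off_lnk[OF x4(5), of j j2] ne 3 x3 by auto
  obtain x5 where x5: "step A x4 x5" "lkind x5 i = q" "lkind x5 w' = 0" "off {w', i} x4 x5"
    using hop_any[OF step_conf(2)[OF x4(1)] x(2) mem(6,3) 4(1) q(1) x4(4)] by blast
  have 5: "lkind x5 w = q'" "x5 w = y w" "lkind x5 i2 = q" "lnk x5 k l" "lnk x5 j j2"
    using offD[OF x5(4), of w] offD(2)[OF x5(4), of i2] off_lnk[OF x5(4), of k l] off_lnk[OF x5(4), of j j2] ne 4 x4 by auto
  obtain x6 where x6: "step A x5 x6" "lnk x6 i i2" "off {k, l, i, i2} x5 x6"
    using swap_any[OF step_conf(2)[OF x5(1)] x(2) mem(7) 5(4) mem(3,4) ne2(9) x5(2) 5(3) q3(1)] by blast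
  have "lkind x6 w = q'" "x6 w = y w" "lkind x6 w' = 0" "lnk x6 j j2"
    using offD[OF x6(3), of w] offD(2)[OF x6(3), of w'] off_lnk[OF x6(3), of j j2] ne 5 x5 by auto
  then show ?thesis using reach_6[OF x1(1) x2(1) x3(1) x4(1) x5(1) x6(1)] x6(2) by blast
qed

text \<open>The variant in which \<open>i2\<close> carries a \<open>q\<close>-token instead of
  ending a link: the first exchange goes through \<open>{i2, k}\<close>, and the second link
  \<open>{u, v}\<close> waits for the last move.\<close>

lemma two_links_path_b:
  assumes x: "conf A x" "finite A" and mem: "j \<in> A" "j2 \<in> A" "i \<in> A" "i2 \<in> A" "f \<in> A" "u \<in> A" "v \<in> A" "k \<in> A"
    and l: "lnk x j2 f" "lnk x u v" "u \<noteq> j2" "u \<noteq> f"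
    and q: "q = 1 \<or> q = 2" "q' = 1 \<or> q' = 2" "q \<noteq> q'"
    and kj: "lkind x j = 0" and ki: "lkind x i = q'" and kk: "lkind x i2 = q" "lkind x k = q" "i2 \<noteq> k"
  shows "\<exists>x'. reach A 6 x x' \<and> lnk x' j j2 \<and> lnk x' i i2 \<and> lkind x' k = 0"
proof -
  have q3: "q < 3" "q \<noteq> 0" "q' \<noteq> 0" "q' \<noteq> 3" using q by auto
  have k3: "lkind x j2 = 3" "lkind x f = 3" "lkind x u = 3" "lkind x v = 3" using lnk_lkind l by auto
  have ne1: "j2 \<noteq> f" "u \<noteq> v" "v \<noteq> j2" "v \<noteq> f" using l by (auto simp: lnk_def)
  have ne2: "j \<noteq> i" "j \<noteq> j2" "j \<noteq> i2" "j \<noteq> f" "j \<noteq> u" "j \<noteq> v" "j \<noteq> k" "i \<noteq> j2" "i \<noteq> i2" "i \<noteq> f" "i \<noteq> u" "i \<noteq> v" "i \<noteq> k"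
    "k \<noteq> j2" "k \<noteq> f" "k \<noteq> u" "k \<noteq> v" "i2 \<noteq> j2" "i2 \<noteq> f" "i2 \<noteq> u" "i2 \<noteq> v"
    using k3 kj ki kk q q3 by auto
  note ne = ne1 ne2 ne1[symmetric] ne2[symmetric] l(3,4) l(3,4)[symmetric] kk(3)
  obtain x1 where x1: "step A x x1" "lnk x1 i2 k" "lkind x1 j2 = q" "lkind x1 f = q" "off {j2, f, i2, k} x x1"
    using swap_any[OF x mem(2) l(1) mem(4,8) kk(3,1,2) q3(1)] by blast
  have 1: "lkind x1 j = 0" "lkind x1 i = q'" "lnk x1 u v"
    using offD(2)[OF x1(5), of j] offD(2)[OF x1(5), of i] off_lnk[OF x1(5), of u v] ne l kj ki by auto
  obtain x2 where x2: "step A x1 x2" "lkind x2 j = q" "lkind x2 f = 0" "off {f, j} x1 x2"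
    using hop_any[OF step_conf(2)[OF x1(1)] x(2) mem(5,1) x1(4) q(1) 1(1)] by blast
  have 2: "lkind x2 i = q'" "lnk x2 u v" "lkind x2 j2 = q" "lnk x2 i2 k"
    using offD(2)[OF x2(4), of j2] offD(2)[OF x2(4), of i] off_lnk[OF x2(4), of u v] off_lnk[OF x2(4), of i2 k] ne 1 x1 by auto
  obtain x3 where x3: "step A x2 x3" "lnk x3 j j2" "lkind x3 i2 = q" "lkind x3 k = q" "off {i2, k, j, j2} x2 x3"
    using swap_any[OF step_conf(2)[OF x2(1)] x(2) mem(4) 2(4) mem(1,2) ne2(2) x2(2) 2(3) q3(1)] by blast
  have 3: "lkind x3 i = q'" "lkind x3 f = 0" "lnk x3 u v"
    using offD(2)[OF x3(5), of f] offD(2)[OF x3(5), of i] off_lnk[OF x3(5), of u v] ne 2 x2 by auto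
  obtain x4 where x4: "step A x3 x4" "lkind x4 i = 0" "off {i, f} x3 x4"
    using hop_any[OF step_conf(2)[OF x3(1)] x(2) mem(3,5) 3(1) q(2) 3(2)] by blast
  have 4: "lkind x4 k = q" "lkind x4 i2 = q" "lnk x4 u v" "lnk x4 j j2"
    using offD(2)[OF x4(3), of k] offD(2)[OF x4(3), of i2] off_lnk[OF x4(3), of u v] off_lnk[OF x4(3), of j j2] ne 3 x3 by auto
  obtain x5 where x5: "step A x4 x5" "lkind x5 i = q" "lkind x5 k = 0" "off {k, i} x4 x5"
    using hop_any[OF step_conf(2)[OF x4(1)] x(2) mem(8,3) 4(1) q(1) x4(2)] by blast
  have 5: "lkind x5 i2 = q" "lnk x5 u v" "lnk x5 j j2"
    using offD(2)[OF x5(4), of i2] off_lnk[OF x5(4), of u v] off_lnk[OF x5(4), of j j2] ne 4 x4 by auto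
  obtain x6 where x6: "step A x5 x6" "lnk x6 i i2" "off {u, v, i, i2} x5 x6"
    using swap_any[OF step_conf(2)[OF x5(1)] x(2) mem(6) 5(2) mem(3,4) ne2(9) x5(2) 5(1) q3(1)] by blast
  have "lkind x6 k = 0" "lnk x6 j j2"
    using offD(2)[OF x6(3), of k] off_lnk[OF x6(3), of j j2] ne 5 x5 by auto
  then show ?thesis using reach_6[OF x1(1) x2(1) x3(1) x4(1) x5(1) x6(1)] x6(2) by blast
qed

text \<open>The line is emptied in one move, by a hop or by exchanging its link with two holes; a
  token of the right colour then arrives with the right label.\<close>

lemma pin_token:
  assumes x: "conf A x" "conf A y" "finite A" "sim A x y" "i \<in> A" "2 \<le> card (kset A x 0)"
    and q: "lkind y i = q" "q = 1 \<or> q = 2"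
  shows "\<exists>x'. reach A 2 x x' \<and> x' i = y i"
proof -
  have "\<exists>x1. step A x x1 \<and> lkind x1 i = 0"
  proof (cases rule: lkind_cases[OF x(1,5)])
    case 1
    then show ?thesis using step_refl[OF x(1)] by blast
  next
    case (2 c)
    obtain h where h: "h \<in> A" "lkind x h = 0" using kset_ex[of A x 0] x(6) by auto
    have "lkind x i = 1 \<or> lkind x i = 2" using 2 by simp
    then show ?thesis using hop_any[OF x(1,3,5) h(1) refl _ h(2)] by blast
  next
    case (3 p s v)
    obtain g h where h: "g \<in> A" "h \<in> A" "lkind x g = 0" "lkind x h = 0" "g \<noteq> h" using two_kind[OF x(6)] by blast
    have "lnk x i p" using 3 lnkI[OF x(1,5)] by auto
    then show ?thesis using swap_any[OF x(1,3,5) _ h(1,2,5,3,4)] by fastforce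
  qed
  then obtain x1 where x1: "step A x x1" "lkind x1 i = 0" by blast
  obtain j where j: "j \<in> A" "lkind x1 j = q"
    using sim_mem[OF x(3) sim_trans[OF sim_sym[OF x(4)] step_conf(3)[OF x1(1)]] x(5)] q(1) by blast
  obtain x2 where "step A x1 x2" "x2 i = y i"
    using hop_lab[OF step_conf(2)[OF x1(1)] x(3) j(1) x(5) j(2) q(2) x1(2) x(2,5) q(1)] by blast
  then show ?thesis using reach_1_1[OF x1(1)] by blast
qed

lemma card_kinds:
  assumes "finite A"
  shows "card A = card (kset A x 0) + card (kset A x 1) + card (kset A x 2) + card (kset A x 3)"
proof -
  have "A = (\<Union>q\<in>{0, 1, 2, 3}. kset A x q)"
  proof -
    have "lkind x i = 0 \<or> lkind x i = 1 \<or> lkind x i = 2 \<or> lkind x i = 3" for i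
      using lkind_le[of x i] by linarith
    then show ?thesis unfolding kset_def by blast
  qed
  also have "card \<dots> = (\<Sum>q\<in>{0, 1, 2, 3}. card (kset A x q))"
    using assms by (intro card_UN_disjoint) (auto simp: kset_def)
  finally show ?thesis by simp
qed

lemma reach_trans_le: "reach A k x y \<Longrightarrow> reach A l y z \<Longrightarrow> k + l \<le> n \<Longrightarrow> reach A n x z"
  using reach_trans reach_mono by blast

lemma col_bounds: "col A x \<le> 2" "col A x \<le> tok A x" "tok A x \<noteq> 0 \<Longrightarrow> 1 \<le> col A x"
  by (auto simp: col_def tok_def)

lemma card_kinds_tok:
  "finite A \<Longrightarrow> card A = card (kset A x 0) + tok A x + card (kset A x 3)"
  using card_kinds[of A x] by (simp add: tok_def)

text \<open>The four moves of the transport are paid by two link ends and two holes, lines that need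
  no hop of their own.\<close>

lemma one_link_two_holes:
  assumes "finite A" "conf A x" "conf A y" "sim A x y" "card (kset A x 3) = 2"
    and "2 \<le> card (kset A x 0)" "5 \<le> card A"
  shows "reach A (card A + (if tok A x = 0 then 2 else col A x)) x y"
proof -
  have "card (kset A y 3) = 2" using assms(4,5) by (simp add: sim_def)
  then obtain i j where ij: "i \<in> A" "lnk y i j" "j \<in> A"
    using kset_ex[of A y 3] lkind3_lnk[OF assms(3)] by fastforce
  have "i \<noteq> j" using ij by (simp add: lnk_def)
  then obtain x' where x': "reach A 4 x x'" "lnk x' i j"
    using transport_two_holes[OF assms(2,1) ij(1,3)] assms by blast
  have c: "conf A x'" "sim A x x'" using reach_conf[OF x'(1)] by auto
  have s: "sim A x' y" using sim_trans[OF sim_sym[OF c(2)] assms(4)] .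
  \<comment> \<open>Two moves are reserved for correcting the link even if there are no
    tokens.\<close>
  define n where "n = max 2 (tok A x + col A x)"
  have "reach A n x' y"
    using finish_tokens[OF assms(1) c(1) assms(3) s ij(1) x'(2) ij(2), of n] assms(5,6) c(2) sim_tok_col[OF c(2)]
    by (auto simp: sim_def n_def)
  then show ?thesis
    by (rule reach_trans_le[OF x'(1)])
      (use card_kinds_tok[OF assms(1), of x] col_bounds(2,3)[of A x] assms(5,6,7) in \<open>auto simp: n_def\<close>)
qed

text \<open>Here \<open>card A = tok A x + 3\<close>. A transport in three moves fits the budget
  exactly; one in four moves does so because the misplaced hole saves a hop in
  \<open>tokens_reach\<close>.\<close>

lemma moved_reach:
  assumes "finite A" "conf A x" "conf A y" "sim A x y" "card (kset A x 3) = 2"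
    and "card (kset A x 0) = 1" "2 \<le> tok A x"
    and y: "i \<in> A" "lnk y i j" "h \<in> A" "lkind y h = 0" and m: "moved A h i j x"
  shows "reach A (card A + col A x) x y"
proof -
  have t: "card A = tok A x + 3" "1 \<le> col A x"
    using card_kinds_tok[OF assms(1), of x] assms(5,6,7) col_bounds(3)[of A x] by auto
  have fin: "reach A n x' y"
    if r: "reach A k x x'" "lnk x' i j" and n: "2 \<le> n"
      "tok A x + col A x \<le> n \<or> kset A x' 0 \<noteq> kset A y 0 \<and> tok A x + col A x \<le> Suc n" for k x' n
  proof -
    have c: "conf A x'" "sim A x x'" using reach_conf[OF r(1)] by auto
    have s: "sim A x' y" using sim_trans[OF sim_sym[OF c(2)] assms(4)] .
    show ?thesis
      using finish_tokens[OF assms(1) c(1) assms(3) s y(1) r(2) y(2) _ _ n(1)] n(2) assms(5,6) c(2) sim_tok_col[OF c(2)]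
      by (auto simp: sim_def)
  qed
  from m obtain x' where x': "lnk x' i j"
    "reach A 3 x x' \<or> reach A 4 x x' \<and> (\<exists>g\<in>A. g \<noteq> h \<and> lkind x' g = 0)"
    by (auto simp: moved_def)
  from x'(2) show ?thesis
  proof
    assume r: "reach A 3 x x'"
    have "reach A (tok A x + col A x) x' y" using fin[OF r x'(1)] assms(7) by auto
    then show ?thesis by (rule reach_trans_le[OF r]) (use t in auto)
  next
    assume r: "reach A 4 x x' \<and> (\<exists>g\<in>A. g \<noteq> h \<and> lkind x' g = 0)"
    then obtain g where g: "g \<in> A" "g \<noteq> h" "lkind x' g = 0" by blast
    have "card (kset A y 0) = 1" using assms(4,6) by (simp add: sim_def)
    then obtain z where z: "kset A y 0 = {z}" by (auto simp: card_1_singleton_iff)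
    moreover have "h \<in> kset A y 0" using y(3,4) by (simp add: kset_iff)
    ultimately have "kset A y 0 = {h}" by simp
    moreover have "g \<in> kset A x' 0" using g by (simp add: kset_iff)
    ultimately have "kset A x' 0 \<noteq> kset A y 0" using g(2) by blast
    have r4: "reach A 4 x x'" using r by blast
    have "2 \<le> tok A x + col A x - 1" "tok A x + col A x \<le> Suc (tok A x + col A x - 1)"
      using assms(7) t by auto
    then have "reach A (tok A x + col A x - 1) x' y"
      using fin[OF r4 x'(1)] \<open>kset A x' 0 \<noteq> kset A y 0\<close> by blast
    then show ?thesis by (rule reach_trans_le[OF r4]) (use t in linarith)
  qed
qed

lemma one_link_one_hole:
  assumes "finite A" "conf A x" "conf A y" "sim A x y" "card (kset A x 3) = 2"
    and "card (kset A x 0) = 1" and q: "q = 1 \<or> q = 2" "2 \<le> card (kset A x q)"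
  shows "reach A (card A + col A x) x y"
proof -
  have t: "2 \<le> tok A x" using q by (auto simp: tok_def)
  have s: "card (kset A y r) = card (kset A x r)" for r using assms(4) by (simp add: sim_def)
  obtain i j where ij: "i \<in> A" "lnk y i j" "j \<in> A"
    using kset_ex[of A y 3] lkind3_lnk[OF assms(3)] s[of 3] assms(5) by fastforce
  obtain h where h: "h \<in> A" "lkind y h = 0" using kset_ex[of A y 0] s[of 0] assms(6) by auto
  obtain h' where h': "h' \<in> A" "lkind x h' = 0" using kset_ex[of A x 0] assms(6) by auto
  have ne: "i \<noteq> j" using ij by (simp add: lnk_def)
  \<comment> \<open>The exceptional case is estimated from \<open>y\<close> to \<open>x\<close>,
    with the pair \<open>{a, h}\<close> of the link of \<open>x\<close> as destination. As
    \<open>h\<close> is a hole of \<open>y\<close>, both exceptions of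
    \<open>transport_one_hole\<close> are now impossible.\<close>
  have rev: "reach A (card A + col A x) x y" if a: "lnk x a h" "a \<in> A" "lnk y a b" "lkind x b \<noteq> 0" for a b
  proof -
    have "\<not> (lnk y a h' \<and> lkind y h \<noteq> 0)" "\<not> (lnk y h h' \<and> lkind y a \<noteq> 0)"
      using h lnk_lkind by fastforce+
    moreover have "a \<noteq> h" using a by (simp add: lnk_def)
    ultimately have "moved A h' a h y"
      using transport_one_hole[OF assms(3,1) a(2) h(1) _ _ _ q(1), of h'] s assms(5,6) q by auto
    then have "reach A (card A + col A y) y x"
      using moved_reach[OF assms(1,3,2) sim_sym[OF assms(4)] _ _ _ a(2,1) h'] s assms(5,6) t sim_tok_col[OF assms(4)] by auto
    then show ?thesis using reach_sym sim_tok_col[OF assms(4)] by auto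
  qed
  consider "moved A h i j x" | "lnk x i h" "lkind x j \<noteq> 0" | "lnk x j h" "lkind x i \<noteq> 0"
    using transport_one_hole[OF assms(2,1) ij(1,3) ne assms(5,6) q, of h] by blast
  then show ?thesis
  proof cases
    case 1
    then show ?thesis using moved_reach[OF assms(1-6) t ij(1,2) h] by blast
  next
    case 2
    then show ?thesis using rev ij by blast
  next
    case 3
    then show ?thesis using rev[OF 3(1) ij(3) lnk_sym[OF ij(2)]] by blast
  qed
qed

section \<open>Several links\<close>

text \<open>A hole or token that is the only one of its kind cannot take part in an exchange with a link.\<close>

definition lonely :: "nat set \<Rightarrow> lmap \<Rightarrow> nat \<Rightarrow> bool" where
  "lonely A x i \<longleftrightarrow> lkind x i \<noteq> 3 \<and> card (kset A x (lkind x i)) < 2"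

text \<open>A kind contributes a lonely line only if it occurs exactly once.\<close>

lemma lonely_count:
  assumes "finite A"
  shows "card {i\<in>A. lonely A x i} \<le> card {q \<in> {0, 1, 2}. card (kset A x q) = 1}"
proof -
  let ?Q = "{q \<in> {0, 1, 2}. card (kset A x q) = 1}"
  have "i \<in> (\<Union>q\<in>?Q. kset A x q)" if "i \<in> A" "lonely A x i" for i
  proof -
    have "lkind x i \<in> {0, 1, 2}" using lkind_le[of x i] that by (auto simp: lonely_def)
    moreover have "card (kset A x (lkind x i)) = 1"
      using that kset_nonempty[OF assms that(1), of x] by (auto simp: lonely_def less_2_cases_iff)
    ultimately show ?thesis using that(1) by (auto simp: kset_iff)
  qed
  then have "card {i\<in>A. lonely A x i} \<le> card (\<Union>q\<in>?Q. kset A x q)"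
    using assms by (intro card_mono) auto
  also have "\<dots> \<le> (\<Sum>q\<in>?Q. card (kset A x q))" by (rule card_UN_le) simp
  also have "\<dots> = card ?Q" by simp
  finally show ?thesis .
qed

text \<open>The lonely lines and their partners in \<open>y\<close> cover at most twice as many link
  ends of \<open>y\<close> as there are lonely lines.\<close>

lemma free_link:
  assumes "finite A" "conf A y" "2 * card {i\<in>A. lonely A x i} < card (kset A y 3)"
  shows "\<exists>i j. i \<in> A \<and> j \<in> A \<and> lnk y i j \<and> \<not> lonely A x i \<and> \<not> lonely A x j"
proof -
  let ?L = "{i\<in>A. lonely A x i}"
  have "card (?L \<union> (\<lambda>z. fst (y z)) ` ?L) \<le> card ?L + card ((\<lambda>z. fst (y z)) ` ?L)" by (rule card_Un_le)
  also have "\<dots> \<le> card ?L + card ?L" using assms(1) by (simp add: card_image_le)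
  also have "\<dots> < card (kset A y 3)" using assms(3) by simp
  finally have lt: "card (?L \<union> (\<lambda>z. fst (y z)) ` ?L) < card (kset A y 3)" .
  have "finite (?L \<union> (\<lambda>z. fst (y z)) ` ?L)" using assms(1) by simp
  from others_of[OF this lt] obtain i where i: "i \<in> kset A y 3" "i \<notin> ?L \<union> (\<lambda>z. fst (y z)) ` ?L"
    by blast
  then obtain j where j: "lnk y i j" "j \<in> A" using lkind3_lnk[OF assms(2)] by (auto simp: kset_iff)
  then have "i = fst (y j)" by (simp add: lnk_def)
  then show ?thesis using i j by (auto simp: kset_iff)
qed

text \<open>Two moves settle two lines, so the surplus is preserved. Only the numbers of lines of
  each kind are passed to the induction, since \<open>pin_link\<close> does not control where the
  other lines end up.\<close>

lemma drop_link:
  assumes "finite A" "conf A x" "conf A y" "sim A x y" "4 \<le> card (kset A x 3)"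
    and ij: "i \<in> A" "j \<in> A" "lnk y i j" "\<not> lonely A x i" "\<not> lonely A x j"
    and IH: "\<And>x'. \<lbrakk>conf (A - {i, j}) x'; conf (A - {i, j}) y; sim (A - {i, j}) x' y;
        \<And>q. card (kset (A - {i, j}) x' q) = card (kset A x q) - (if q = 3 then 2 else 0)\<rbrakk>
        \<Longrightarrow> reach (A - {i, j}) n x' y"
  shows "reach A (n + 2) x y"
proof -
  obtain t w where yi: "y i = (j, t, w)" "t = 1 \<or> t = -1" "i \<noteq> j" using lnkD[OF assms(3) ij(1,3)] by metis
  obtain x' where x': "reach A 2 x x'" "x' i = (j, t, w)"
    using pin_link[OF assms(2,1) ij(1,2) yi(3) assms(5) yi(2)] ij(4,5) unfolding lonely_def by (metis not_less)
  have c: "conf A x'" "sim A x x'" using reach_conf[OF x'(1)] by auto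
  have s: "sim A x' y" using sim_trans[OF sim_sym[OF c(2)] assms(4)] .
  have l: "lnk x' i j" using lnkI[OF c(1) ij(1) x'(2) yi(3)] .
  have e: "x' i = y i" using x'(2) yi by simp
  note d = del_link[OF assms(1) c(1) assms(3) s ij(1) l e]
  have "card (kset (A - {i, j}) x' q) = card (kset A x q) - (if q = 3 then 2 else 0)" for q
    using d(4)[of q] c(2) by (auto simp: sim_def)
  then have "reach A n x' y" using d(5)[OF IH[OF d(1-3)]] by blast
  then show ?thesis using reach_trans[OF x'(1)] by (simp add: add.commute)
qed

text \<open>\<open>pin_link\<close> excludes a lonely hole. If the other end of the link carries a
  token of a frequent colour, a second token of this colour hops to the hole, and one exchange
  creates the link.\<close>

lemma hole_pair_pin:
  assumes x: "conf A x" "finite A" "i \<in> A" "j \<in> A" "lkind x i = 0" "lkind x j = q" "q = 1 \<or> q = 2"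
    and c: "2 \<le> card (kset A x q)" "card (kset A x 3) \<noteq> 0" and t: "t = 1 \<or> t = -1"
  shows "\<exists>x'. reach A 2 x x' \<and> x' i = (j, t, w)"
proof -
  obtain k where k: "k \<in> A" "lkind x k = q" "k \<noteq> j" using other_kind[OF c(1)] by blast
  obtain p p' where p: "p \<in> A" "lnk x p p'" using kset_ex[OF c(2)] lkind3_lnk[OF x(1)] by blast
  have k3: "lkind x p = 3" "lkind x p' = 3" using lnk_lkind[OF p(2)] by auto
  have ne: "i \<noteq> j" "p \<noteq> k" "p \<noteq> i" "p' \<noteq> k" "p' \<noteq> i" "i \<noteq> k" using x k k3 by auto
  obtain d where d: "x j = (j, -1, d)" "even d \<longleftrightarrow> q = 1" using lkind12D[OF x(1,4,6,7)] by blast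
  \<comment> \<open>the new label is the preimage of the label of the line \<open>j\<close> under the wanted link\<close>
  define y :: lmap where "y z = (z, -1, t * (d - 2 * w))" for z
  have y: "conf {i} y" "lkind y i = q"
    using d x(7) t by (auto simp: y_def conf_def lcomp_def lkind_def)
  obtain x1 where x1: "step A x x1" "x1 i = y i" "lkind x1 i = q" "off {k, i} x x1"
    using hop_lab[OF x(1,2) k(1) x(3) k(2) x(7,5) y(1) _ y(2)] by blast
  have 1: "lkind x1 j = q" "x1 j = x j" "lnk x1 p p'"
    using offD[OF x1(4), of j] off_lnk[OF x1(4), of p p'] ne k x p by auto
  have "snd (snd (x1 j)) = t * snd (snd (x1 i)) + 2 * w"
    using t by (auto simp: 1(2) d(1) x1(2) y_def)
  moreover obtain z where "conf {p} z" "lkind z p = q" using lkind_dummy[OF x(7)] by blast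
  ultimately obtain x2 where "step A x1 x2" "x2 i = (j, t, w)"
    using swap_to[OF step_conf(2)[OF x1(1)] x(2) p(1) 1(3) x(3,4) ne(1) x1(3) 1(1) _ t] x(7) by fastforce
  then show ?thesis using reach_1_1[OF x1(1)] by blast
qed

lemma lkind_values: "lkind x i = 0 \<or> lkind x i = 1 \<or> lkind x i = 2 \<or> lkind x i = 3"
  using lkind_le[of x i] by linarith

lemma two_supports:
  assumes "finite A" "conf A x" "conf A y" "sim A x y" "i \<in> A" "j \<in> A" "i2 \<in> A" "j2 \<in> A"
    and "lnk x j j2" "lnk y j j2" "lnk x i i2" "lnk y i i2" "j2 \<noteq> i" "j \<noteq> i"
  shows "conf (A - {j, j2} - {i, i2}) x" "conf (A - {j, j2} - {i, i2}) y" "sim (A - {j, j2} - {i, i2}) x y"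
    "card (kset A x q) = (if q = 3 then 4 else 0) + card (kset (A - {j, j2} - {i, i2}) x q)"
    "reach (A - {j, j2} - {i, i2}) n x y \<Longrightarrow> 2 \<le> n \<Longrightarrow> reach A n x y"
proof -
  note 1 = sim_same_supp[OF assms(1-4,6,9,10)]
  have i: "i \<in> A - {j, j2}" using assms by auto
  note 2 = sim_same_supp[OF _ 1(1-3) i assms(11,12)]
  show "conf (A - {j, j2} - {i, i2}) x" "conf (A - {j, j2} - {i, i2}) y" "sim (A - {j, j2} - {i, i2}) x y"
    using 2(1-3) assms(1) by auto
  show "card (kset A x q) = (if q = 3 then 4 else 0) + card (kset (A - {j, j2} - {i, i2}) x q)"
    using 1(4)[of q] 2(4)[of q] assms(1) by auto
  show "reach (A - {j, j2} - {i, i2}) n x y \<Longrightarrow> 2 \<le> n \<Longrightarrow> reach A n x y"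
    using 1(5)[of n] 2(5)[of n] assms(1) by auto
qed

text \<open>Two disjoint links that both meet the set \<open>{i, j}\<close> meet it in one line
  each.\<close>

lemma no_free_link_structure:
  assumes "finite A" "conf A y" "card (kset A y 3) = 4" "j \<noteq> i"
    and nf: "\<And>u v. u \<in> A \<Longrightarrow> v \<in> A \<Longrightarrow> lnk y u v \<Longrightarrow> u \<in> {i, j} \<or> v \<in> {i, j}"
  shows "\<exists>j2 i2. j2 \<in> A \<and> i2 \<in> A \<and> lnk y j j2 \<and> lnk y i i2 \<and> j2 \<noteq> i \<and> i2 \<noteq> j"
proof -
  obtain u v where uv: "u \<in> A" "v \<in> A" "lnk y u v"
    using kset_ex[of A y 3] lkind3_lnk[OF assms(2)] assms(3) by fastforce
  obtain u' v' where uv': "u' \<in> A" "v' \<in> A" "lnk y u' v'" "u' \<notin> {u, v}" "v' \<notin> {u, v}"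
    using other_link[OF assms(2,1) uv(1,3)] assms(3) by auto
  note s = lnk_sym[OF uv(3)] lnk_sym[OF uv'(3)]
  consider "u \<in> {i, j}" "u' \<in> {i, j}" | "u \<in> {i, j}" "v' \<in> {i, j}" | "v \<in> {i, j}" "u' \<in> {i, j}" | "v \<in> {i, j}" "v' \<in> {i, j}"
    using nf[OF uv(1-3)] nf[OF uv'(1-3)] by blast
  then show ?thesis using uv uv' s by cases auto
qed

text \<open>The lonely hole and the lonely token of \<open>x\<close> may block both links of
  \<open>y\<close>. By symmetry those of \<open>y\<close> may be assumed to block both links of
  \<open>x\<close>. Few relative positions remain, and each admits a path of six moves that places
  both links and also saves a later move.\<close>

lemma two_links_one_hole:
  assumes "finite A" "conf A x" "conf A y" "sim A x y" "card (kset A x 3) = 4" "card (kset A x 0) = 1"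
    and q: "q = 1 \<or> q = 2" "q' = 1 \<or> q' = 2" "q \<noteq> q'" "2 \<le> card (kset A x q)" "card (kset A x q') = 1"
  shows "reach A (card A + 2) x y"
proof -
  \<comment> \<open>Once a link of \<open>y\<close> is made in two moves,
    \<open>one_link_one_hole\<close> applies to two lines fewer, with surplus at most 2.\<close>
  have shorter: "reach A (card A + 2) x y"
    if a: "conf A x" "conf A y" "sim A x y" "card (kset A x 3) = 4" "card (kset A x 0) = 1" "2 \<le> card (kset A x q)"
      "i \<in> A" "lnk y i j" "reach A 2 x x'" "x' i = y i" for x y i j x'
  proof -
    have c: "conf A x'" "sim A x x'" using reach_conf[OF a(9)] by auto
    have s: "sim A x' y" using sim_trans[OF sim_sym[OF c(2)] a(3)] .
    have l: "lnk x' i j"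
    proof -
      obtain t w where "y i = (j, t, w)" "i \<noteq> j" using lnkD[OF a(2,7,8)] by metis
      then show ?thesis using lnkI[OF c(1) a(7)] a(10) by simp
    qed
    note d = del_link[OF assms(1) c(1) a(2) s a(7) l a(10)]
    have cc: "card (kset A x r) = card (kset A x' r)" for r using c(2) by (simp add: sim_def)
    have "reach (A - {i, j}) (card (A - {i, j}) + col (A - {i, j}) x') x' y"
      using one_link_one_hole[OF _ d(1-3) _ _ q(1)] d(4)[of 3] d(4)[of 0] d(4)[of q] a(4-6) q assms(1)
      by (auto simp: cc)
    then have "reach (A - {i, j}) (card A) x' y"
      by (rule reach_mono) (use d(6) col_bounds(1)[of "A - {i, j}" x'] in linarith)
    then show ?thesis using reach_trans[OF a(9) d(5)] by (simp add: add.commute)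
  qed
  have free: "reach A (card A + 2) x y"
    if a: "conf A x" "conf A y" "sim A x y" "card (kset A x 3) = 4" "card (kset A x 0) = 1" "2 \<le> card (kset A x q)"
      "i \<in> A" "j \<in> A" "lnk y i j" "lkind x i = 3 \<or> lkind x i = q" "lkind x j = 3 \<or> lkind x j = q" for x y i j
  proof -
    obtain t w where yi: "y i = (j, t, w)" "t = 1 \<or> t = -1" "i \<noteq> j" using lnkD[OF a(2,7,9)] by metis
    have k: "lkind x i = 3 \<or> 2 \<le> card (kset A x (lkind x i))" "lkind x j = 3 \<or> 2 \<le> card (kset A x (lkind x j))"
      "4 \<le> card (kset A x 3)"
      using a(4,6,10,11) by auto
    obtain x' where "reach A 2 x x'" "x' i = (j, t, w)"
      using pin_link[OF a(1) assms(1) a(7,8) yi(3) k(3) yi(2) k(1,2)] by blast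
    then show ?thesis using shorter[OF a(1-7,9)] yi(1) by simp
  qed
  have paired: "reach A (card A + 2) x y"
    if a: "conf A x" "conf A y" "sim A x y" "card (kset A x 3) = 4" "card (kset A x 0) = 1" "2 \<le> card (kset A x q)"
      "i \<in> A" "j \<in> A" "lnk y i j" "lkind x i = 0" "lkind x j = q" for x y i j
  proof -
    obtain t w where yi: "y i = (j, t, w)" "t = 1 \<or> t = -1" "i \<noteq> j" using lnkD[OF a(2,7,9)] by metis
    obtain x' where "reach A 2 x x'" "x' i = (j, t, w)"
      using hole_pair_pin[OF a(1) assms(1) a(7,8,10,11) q(1) a(6) _ yi(2)] a(4) by auto
    then show ?thesis using shorter[OF a(1-7,9)] yi(1) by simp
  qed
  have cy: "card (kset A y r) = card (kset A x r)" for r using assms(4) by (simp add: sim_def)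
  note sx = assms(2,3,4,5,6) q(4)
  have sy: "conf A y" "conf A x" "sim A y x" "card (kset A y 3) = 4" "card (kset A y 0) = 1" "2 \<le> card (kset A y q)"
    using assms sim_sym cy by auto
  obtain j where j: "j \<in> A" "lkind x j = 0" "\<And>z. z \<in> A \<Longrightarrow> lkind x z = 0 \<Longrightarrow> z = j"
    using assms(6) by (auto simp: card_1_singleton_iff kset_def set_eq_iff)
  obtain i where i: "i \<in> A" "lkind x i = q'" "\<And>z. z \<in> A \<Longrightarrow> lkind x z = q' \<Longrightarrow> z = i"
    using q(5) by (auto simp: card_1_singleton_iff kset_def set_eq_iff)
  obtain f where f: "f \<in> A" "lkind y f = 0" "\<And>z. z \<in> A \<Longrightarrow> lkind y z = 0 \<Longrightarrow> z = f"
    using sy(5) by (auto simp: card_1_singleton_iff kset_def set_eq_iff)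
  have "card (kset A y q') = 1" using cy q(5) by simp
  then obtain e where e: "e \<in> A" "lkind y e = q'" "\<And>z. z \<in> A \<Longrightarrow> lkind y z = q' \<Longrightarrow> z = e"
    by (auto simp: card_1_singleton_iff kset_def set_eq_iff)
  have rx: "lkind x z = 3 \<or> lkind x z = q" if "z \<in> A" "z \<noteq> i" "z \<noteq> j" for z
    using lkind_values[of x z] i(3)[of z] j(3)[of z] that q(1-3) by auto
  have ry: "lkind y z = 3 \<or> lkind y z = q" if "z \<in> A" "z \<noteq> e" "z \<noteq> f" for z
    using lkind_values[of y z] e(3)[of z] f(3)[of z] that q(1-3) by auto
  show ?thesis
  proof (rule ccontr)
    assume neg: "\<not> reach A (card A + 2) x y"
    then have neg': "\<not> reach A (card A + 2) y x" using reach_sym by blast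
    have ji: "j \<noteq> i" using j(2) i(2) q by auto
    have fe: "f \<noteq> e" using f(2) e(2) q by auto
    have "u \<in> {i, j} \<or> v \<in> {i, j}" if "u \<in> A" "v \<in> A" "lnk y u v" for u v
      using free[OF sx that] neg rx that by blast
    from no_free_link_structure[OF assms(1,3) sy(4) ji this]
    obtain j2 i2 where l: "j2 \<in> A" "i2 \<in> A" "lnk y j j2" "lnk y i i2" "j2 \<noteq> i" "i2 \<noteq> j" by blast
    have "u \<in> {e, f} \<or> v \<in> {e, f}" if "u \<in> A" "v \<in> A" "lnk x u v" for u v
      using free[OF sy that] neg' ry that by blast
    from no_free_link_structure[OF assms(1,2,5) fe this]
    obtain f2 e2 where m: "f2 \<in> A" "e2 \<in> A" "lnk x f f2" "lnk x e e2" "f2 \<noteq> e" "e2 \<noteq> f" by blast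
    have ne: "j2 \<noteq> j" "i2 \<noteq> i" "f2 \<noteq> f" "e2 \<noteq> e" "i2 \<noteq> j2" "e2 \<noteq> f2" using l m ji fe by (auto simp: lnk_def)
    have k3y: "lkind y j = 3" "lkind y j2 = 3" "lkind y i = 3" "lkind y i2 = 3"
      using lnk_lkind[OF l(3)] lnk_lkind[OF l(4)] by auto
    have k3x: "lkind x f = 3" "lkind x f2 = 3" "lkind x e = 3" "lkind x e2 = 3"
      using lnk_lkind[OF m(3)] lnk_lkind[OF m(4)] by auto
    have j2: "lkind x j2 = 3"
      using rx[OF l(1) l(5) ne(1)] paired[OF sx j(1) l(1,3) j(2)] neg by blast
    have f2: "lkind y f2 = 3"
      using ry[OF m(1) m(5) ne(3)] paired[OF sy f(1) m(1,3) f(2)] neg' by blast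
    have "card {f, f2, e, e2} = 4" using ne m(5,6) fe by auto
    then have Px: "kset A x 3 = {f, f2, e, e2}"
      using assms(5) k3x f(1) e(1) m by (intro card_subset_eq[symmetric]) (auto simp: kset_iff assms(1))
    have "card {j, j2, i, i2} = 4" using ne l(5,6) ji by auto
    then have Py: "kset A y 3 = {j, j2, i, i2}"
      using sy(4) k3y i(1) j(1) l by (intro card_subset_eq[symmetric]) (auto simp: kset_iff assms(1))
    have memx: "z = f2 \<or> z = e2" if "z \<in> A" "lkind x z = 3" "lkind y z = 3" for z
    proof -
      have "z \<in> {f, f2, e, e2}" using Px that by (auto simp: kset_def)
      moreover have "z \<noteq> f" "z \<noteq> e" using that(3) f(2) e(2) q(2) by auto
      ultimately show ?thesis by blast
    qed
    have tok: "card A = 5 + tok A x" using card_kinds_tok[OF assms(1), of x] assms(5,6) by simp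
    have col: "col A x = 2" using q by (auto simp: col_def)
    have tok2: "2 \<le> tok A x" using q by (auto simp: tok_def)
    \<comment> \<open>The budget is \<open>card A + 2 = 6 + (tok A x + 1)\<close>, one less than the
      tokens need in general, as \<open>col A x = 2\<close>. The saving comes from a misplaced hole,
      or from the token at \<open>e\<close> being final, which removes the colour
      \<open>q'\<close>.\<close>
    have last: False if r: "reach A 6 x x'" "lnk x' j j2" "lnk x' i i2" "g \<in> A" "lkind x' g = 0"
      and c: "g \<noteq> f \<or> (x' e = y e \<and> lkind x' e = q')" for x' g
    proof -
      have c': "conf A x'" "sim A x x'" using reach_conf[OF r(1)] by auto
      have s: "sim A x' y" using sim_trans[OF sim_sym[OF c'(2)] assms(4)] .
      let ?A = "A - {j, j2} - {i, i2}"
      note t = two_supports[OF assms(1) c'(1) assms(3) s i(1) j(1) l(2,1) r(2) l(3) r(3) l(4,5) ji]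
      have cc: "card (kset A x r) = card (kset A x' r)" for r using c'(2) by (simp add: sim_def)
      have tt: "tok ?A x' = tok A x" "col ?A x' = 2" using t(4) col by (simp_all add: tok_def col_def cc)
      have c03: "card (kset ?A x' 3) = 0" "card (kset ?A x' 0) \<noteq> 0"
        using t(4)[of 3] t(4)[of 0] assms(5,6) by (simp_all add: cc)
      have gA: "g \<in> ?A" using r lnk_lkind[OF r(2)] lnk_lkind[OF r(3)] by auto
      have "reach ?A (tok A x + 1) x' y"
      proof (cases "g = f")
        case False
        then have "g \<notin> kset ?A y 0" using f(3) r(4) by (auto simp: kset_iff)
        moreover have "g \<in> kset ?A x' 0" using gA r(5) by (simp add: kset_iff)
        ultimately have "kset ?A x' 0 \<noteq> kset ?A y 0" by blast
        then show ?thesis using tokens_reach[OF _ t(1-3) c03] assms(1) tt by simp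
      next
        case True
        then have e': "x' e = y e" "lkind x' e = q'" using c by auto
        have "q' \<noteq> 3" using q by auto
        then have eA: "e \<in> ?A" using e(1) e'(2) lnk_lkind[OF r(2)] lnk_lkind[OF r(3)] by auto
        have fe': "fst (x' e) = e" using kinds_of_fixed[of x' e] e'(2) q by auto
        note d = del_fixed[OF _ t(1-3) eA e'(1) fe']
        have fin: "finite ?A" using assms(1) by simp
        have cq: "card (kset (?A - {e}) x' q') = 0" "card (kset (?A - {e}) x' q) = card (kset ?A x' q)"
          "card (kset ?A x' q') = 1"
          using d(4)[OF fin, of q'] d(4)[OF fin, of q] e'(2) q(3,5) t(4)[of q'] \<open>q' \<noteq> 3\<close> by (auto simp: cc)
        have "q = 1 \<and> q' = 2 \<or> q = 2 \<and> q' = 1" using q(1-3) by auto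
        then have "tok (?A - {e}) x' = card (kset ?A x' q)" "col (?A - {e}) x' \<le> 1" "tok ?A x' = card (kset ?A x' q) + 1"
          using cq by (elim disjE conjE; simp add: tok_def col_def)+
        then have le: "tok (?A - {e}) x' + col (?A - {e}) x' \<le> tok A x + 1" using tt(1) by linarith
        have r': "reach (?A - {e}) (tok (?A - {e}) x' + col (?A - {e}) x') x' y"
        proof -
          have z: "card (kset (?A - {e}) x' 3) = 0" "card (kset (?A - {e}) x' 0) \<noteq> 0"
            using d(4)[OF fin, of 3] d(4)[OF fin, of 0] c03 e'(2) q by auto
          show ?thesis
            by (rule reach_mono[OF tokens_reach[OF _ d(1-3) z]]) (use fin in auto)
        qed
        have "reach (?A - {e}) (tok A x + 1) x' y" by (rule reach_mono[OF r' le])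
        then show ?thesis using d(5)[OF fin] by blast
      qed
      then have "reach A (tok A x + 1) x' y" by (rule t(5)) (use tok2 in simp)
      then have "reach A (card A + 2) x y" by (rule reach_trans_le[OF r(1)]) (use tok in simp)
      then show False using neg by blast
    qed
    have two_q: "\<exists>k l. k \<in> A \<and> l \<in> A \<and> lkind x k = q \<and> lkind x l = q \<and> k \<noteq> l" using two_kind[OF q(4)] .
    \<comment> \<open>\<open>j2\<close> ends a link in both \<open>x\<close> and \<open>y\<close>,
      hence is \<open>f2\<close> or \<open>e2\<close>. Cases \<open>a\<close> and \<open>c\<close>
      use the same path with the roles of \<open>e\<close> and \<open>f\<close> exchanged.\<close>
    consider (a) "j2 = f2" "lkind x i2 = 3" | (b) "j2 = f2" "lkind x i2 = q" | (c) "j2 = e2"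
      using memx[OF l(1) j2 k3y(2)] rx[OF l(2) ne(2) l(6)] by blast
    then show False
    proof cases
      case a
      then have "i2 = e2" using memx[OF l(2) _ k3y(4)] ne(5) by auto
      then have lx: "lnk x j2 f" "lnk x i2 e" "i2 \<noteq> f" using a m lnk_sym[OF m(3)] lnk_sym[OF m(4)] by auto
      obtain k k' where k: "k \<in> A" "k' \<in> A" "lkind x k = q" "lkind x k' = q" "k \<noteq> k'" using two_q by blast
      obtain z where z: "conf {f} z" "lkind z f = q'" using lkind_dummy[OF q(2)] by blast
      obtain x' where "reach A 6 x x'" "lnk x' j j2" "lnk x' i i2" "lkind x' e = 0"
        using two_links_path_a[OF assms(2,1) j(1) l(1) i(1) l(2) f(1) e(1) k(1,2) lx(1,2) ne(5) lx(3) q(1-3) j(2) i(2) k(3-5) z(1) _ z(2)]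
        by blast
      then show False using last[OF _ _ _ e(1)] fe by blast
    next
      case b
      have lx: "lnk x j2 f" "e \<noteq> j2" "e \<noteq> f" using b m lnk_sym[OF m(3)] fe by auto
      obtain k where k: "k \<in> A" "lkind x k = q" "k \<noteq> i2" using other_kind[OF q(4)] by blast
      obtain x' where "reach A 6 x x'" "lnk x' j j2" "lnk x' i i2" "lkind x' k = 0"
        using two_links_path_b[OF assms(2,1) j(1) l(1) i(1) l(2) f(1) e(1) m(2) k(1) lx(1) m(4) lx(2,3) q(1-3) j(2) i(2) b(2) k(2) k(3)[symmetric]]
        by blast
      moreover have "k \<noteq> f" using k k3x(1) q by auto
      ultimately show False using last[OF _ _ _ k(1)] by blast
    next
      case c
      have "f2 \<in> {j, j2, i, i2}" using Py f2 m(1) by (auto simp: kset_def)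
      moreover have "f2 \<noteq> j" "f2 \<noteq> i" using k3x(2) j(2) i(2) q by auto
      ultimately have "f2 = i2" using c ne(6) by auto
      then have lx: "lnk x j2 e" "lnk x i2 f" "i2 \<noteq> e" using c m lnk_sym[OF m(3)] lnk_sym[OF m(4)] by auto
      obtain k k' where k: "k \<in> A" "k' \<in> A" "lkind x k = q" "lkind x k' = q" "k \<noteq> k'" using two_q by blast
      \<comment> \<open>The hole ends at its final line \<open>f\<close>, so nothing is saved there;
        instead the token at \<open>e\<close> has been set down with its final label.\<close>
      obtain x' where "reach A 6 x x'" "lnk x' j j2" "lnk x' i i2" "lkind x' f = 0" "x' e = y e" "lkind x' e = q'"
        using two_links_path_a[OF assms(2,1) j(1) l(1) i(1) l(2) e(1) f(1) k(1,2) lx(1,2) ne(5) lx(3) q(1-3) j(2) i(2) k(3-5) assms(3) e(1,2)]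
        by blast
      then show False using last[OF _ _ _ f(1)] by blast
    qed
  qed
qed

declare reach.simps [simp del]

section \<open>Removing links when holes and tokens are present\<close>

lemma even_links:
  assumes "finite A" "conf A x"
  shows "even (card (kset A x 3))"
  using assms
proof (induction "card A" arbitrary: A rule: less_induct)
  case less
  show ?case
  proof (cases "card (kset A x 3) = 0")
    case False
    then obtain i j where ij: "i \<in> A" "lnk x i j"
      using kset_ex lkind3_lnk[OF less.prems(2)] by blast
    note d = del_link[OF less.prems(1,2,2) sim_refl ij refl]
    have "even (card (kset (A - {i, j}) x 3))"
      using less.hyps[OF _ _ d(1)] d(6) less.prems(1) by simp
    then show ?thesis using d(4)[of 3] by simp
  qed simp
qed

lemma lonely_bound:
  assumes "finite A"
  shows "card {i\<in>A. lonely A x i} \<le> (if card (kset A x 0) = 1 then 1 else 0)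
    + (if card (kset A x 1) = 1 then 1 else 0) + (if card (kset A x 2) = 1 then 1 else 0)"
proof -
  have "card {q \<in> {0, 1, 2}. P q} = (if P 0 then 1 else 0) + (if P 1 then 1 else 0) + (if P 2 then 1 else 0)"
    for P :: "nat \<Rightarrow> bool"
  proof -
    have "card {q \<in> {0, 1, 2}. P q} = (\<Sum>q\<in>{0, 1, 2}. if P q then 1 else 0)"
      by (simp add: sum.inter_filter[symmetric] del: sum.insert)
    then show ?thesis by simp
  qed
  from this[of "\<lambda>q. card (kset A x q) = 1"] show ?thesis
    using lonely_count[OF assms, of x] by linarith
qed

text \<open>Links of \<open>y\<close> without lonely ends are made and removed. When none is
  guaranteed, the count of lonely lines leaves exactly two links and two kinds that occur
  once.\<close>

lemma holes_reach:
  assumes "finite A" "conf A x" "conf A y" "sim A x y" "2 \<le> card (kset A x 3)" "1 \<le> card (kset A x 0)"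
    and "1 \<le> tok A x" "2 \<le> card (kset A x 0) \<or> 2 \<le> card (kset A x 1) \<or> 2 \<le> card (kset A x 2)"
  shows "reach A (card A + col A x) x y"
  using assms
proof (induction "card A" arbitrary: A x y rule: less_induct)
  case less
  note A = less.prems(1) and x = less.prems(2) and y = less.prems(3) and s = less.prems(4)
  note n = card_kinds_tok[OF A, of x]
  have cy: "card (kset A y q) = card (kset A x q)" for q using s by (simp add: sim_def)
  let ?a = "card (kset A x 1)" and ?b = "card (kset A x 2)" and ?f = "card (kset A x 0)" and ?p = "card (kset A x 3)"
  have t: "tok A x = ?a + ?b" by (simp add: tok_def)
  have "3 \<le> ?f + ?a + ?b" using less.prems(6,7,8) t by linarith
  then have n5: "5 \<le> card A" using n t less.prems(5) by linarith
  obtain m where m: "?p = 2 * m" using even_links[OF A x] by blast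
  have "m = 1 \<or> 2 \<le> m" using m less.prems(5) by auto
  then have "?p = 2 \<and> 2 \<le> ?f \<or> ?p = 2 \<and> ?f = 1 \<or> 4 \<le> ?p" using m less.prems(6) by auto
  then consider "?p = 2" "2 \<le> ?f" | "?p = 2" "?f = 1" | "4 \<le> ?p" by (elim disjE conjE)
  then show ?case
  proof cases
    case 1
    then show ?thesis using one_link_two_holes[OF A x y s 1 n5] less.prems(7) by simp
  next
    case 2
    then have "2 \<le> ?a \<or> 2 \<le> ?b" using less.prems(8) by linarith
    then show ?thesis using one_link_one_hole[OF A x y s 2, of 1] one_link_one_hole[OF A x y s 2, of 2] by blast
  next
    case 3
    show ?thesis
    proof (cases "2 * card {i\<in>A. lonely A x i} < ?p")
      case True
      then obtain i j where ij: "i \<in> A" "j \<in> A" "lnk y i j" "\<not> lonely A x i" "\<not> lonely A x j"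
        using free_link[OF A y] cy by metis
      have ne: "i \<noteq> j" using ij by (simp add: lnk_def)
      let ?B = "A - {i, j}"
      have B: "card ?B + 2 = card A" "finite ?B" using A ij ne n5 by (simp_all add: card_Diff_subset)
      have "reach A (card ?B + col A x + 2) x y"
      proof (rule drop_link[OF A x y s 3 ij])
        fix x' assume x': "conf ?B x'" "conf ?B y" "sim ?B x' y"
          and c: "\<And>q. card (kset ?B x' q) = card (kset A x q) - (if q = 3 then 2 else 0)"
        have "tok ?B x' = tok A x" "col ?B x' = col A x" by (simp_all add: tok_def col_def c)
        moreover have "reach ?B (card ?B + col ?B x') x' y"
        proof (rule less.hyps[OF _ B(2) x'])
          show "card ?B < card A" using B by simp
          show "2 \<le> card (kset ?B x' 3)" using c[of 3] 3 by simp
          show "1 \<le> card (kset ?B x' 0)" using c[of 0] less.prems(6) by simp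
          show "1 \<le> tok ?B x'" using less.prems(7) by (simp add: tok_def c)
          show "2 \<le> card (kset ?B x' 0) \<or> 2 \<le> card (kset ?B x' 1) \<or> 2 \<le> card (kset ?B x' 2)"
            using less.prems(8) by (simp add: c)
        qed
        ultimately show "reach ?B (card ?B + col A x) x' y" by simp
      qed
      then show ?thesis using B(1) by (metis add.assoc add.commute)
    next
      case False
      have "card {i\<in>A. lonely A x i} \<le> (if ?f = 1 then 1 else 0) + (if ?a = 1 then 1 else 0) + (if ?b = 1 then 1 else 0)"
        using lonely_bound[OF A] .
      \<comment> \<open>There are at least four link ends, hence at least two lonely lines. Some
        kind occurs twice, so there are at most two, and both bounds are attained.\<close>
      then have "(?f = 1 \<and> ?a = 1 \<and> ?b \<noteq> 1 \<or> ?f = 1 \<and> ?b = 1 \<and> ?a \<noteq> 1 \<or> ?a = 1 \<and> ?b = 1 \<and> ?f \<noteq> 1) \<and> ?p = 4"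
        using False 3 m less.prems(8) by (auto split: if_splits)
      then consider (a) "?f = 1" "?a = 1" "2 \<le> ?b" "?p = 4" | (b) "?f = 1" "?b = 1" "2 \<le> ?a" "?p = 4"
        | (f) "?a = 1" "?b = 1" "2 \<le> ?f" "?p = 4" using less.prems(8) by linarith
      then show ?thesis
      proof cases
        case a
        have "col A x = 2" using a by (simp add: col_def)
        then show ?thesis using two_links_one_hole[OF A x y s a(4,1), of 2 1] a by simp
      next
        case b
        have "col A x = 2" using b by (simp add: col_def)
        then show ?thesis using two_links_one_hole[OF A x y s b(4,1), of 1 2] b by simp
      next
        case f
        have col: "col A x = 2" using f by (simp add: col_def)
        \<comment> \<open>Both colours are lonely and holes are plentiful: the even token is settled
          in two moves, and its removal lowers the number of lines and \<open>col\<close> by one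
          each.\<close>
        obtain i where i: "i \<in> A" "lkind y i = 1" using kset_ex[of A y 1] cy[of 1] f by auto
        obtain x' where x': "reach A 2 x x'" "x' i = y i"
          using pin_token[OF x y A s i(1) f(3) i(2)] by blast
        have c: "conf A x'" "sim A x x'" using reach_conf[OF x'(1)] by auto
        have s': "sim A x' y" using sim_trans[OF sim_sym[OF c(2)] s] .
        have k: "lkind x' i = 1" using lkind_cong[of x' i y] x'(2) i(2) by simp
        have fi: "fst (x' i) = i" using kinds_of_fixed[of x' i] k by simp
        note d = del_fixed[OF A c(1) y s' i(1) x'(2) fi]
        have cc: "card (kset A x r) = card (kset A x' r)" for r using c(2) by (simp add: sim_def)
        let ?B = "A - {i}"
        have B: "card ?B + 1 = card A" "finite ?B" using A i n5 by (simp_all add: card_Diff_subset)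
        have cB: "card (kset ?B x' 0) = ?f" "card (kset ?B x' 1) = 0" "card (kset ?B x' 2) = 1" "card (kset ?B x' 3) = 4"
          using d(4)[of 0] d(4)[of 1] d(4)[of 2] d(4)[of 3] k f by (simp_all add: cc)
        have "tok ?B x' = 1" "col ?B x' = 1" using cB by (simp_all add: tok_def col_def)
        moreover have "reach ?B (card ?B + col ?B x') x' y"
          by (rule less.hyps[OF _ B(2) d(1-3)]) (use cB f B \<open>tok ?B x' = 1\<close> in simp_all)
        ultimately have "reach A (card ?B + 1) x' y" using d(5) by simp
        then show ?thesis by (rule reach_trans_le[OF x'(1)]) (use B col in simp)
      qed
    qed
  qed
qed

text \<open>All lines are link ends, so none is lonely, and two moves per link suffice without
  surplus.\<close>

lemma links_reach:
  assumes "finite A" "conf A x" "conf A y" "sim A x y" "tok A x = 0" "card (kset A x 0) = 0"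
  shows "reach A (card A) x y"
  using assms
proof (induction "card A" arbitrary: A x y rule: less_induct)
  case less
  note A = less.prems(1) and x = less.prems(2) and y = less.prems(3) and s = less.prems(4)
  note n = card_kinds_tok[OF A, of x]
  have cy: "card (kset A y q) = card (kset A x q)" for q using s by (simp add: sim_def)
  have nA: "card A = card (kset A x 3)" using n less.prems(5,6) by simp
  obtain m where m: "card (kset A x 3) = 2 * m" using even_links[OF A x] by blast
  have "m = 0 \<or> m = 1 \<or> 2 \<le> m" by auto
  then have "card A = 0 \<or> card A = 2 \<or> 4 \<le> card A" using m nA by auto
  then consider "card A = 0" | "card A = 2" | "4 \<le> card A" by (elim disjE)
  then show ?case
  proof cases
    case 1
    then show ?thesis using A x by (simp add: reach.simps)
  next
    case 2
    then obtain i j where ij: "i \<in> A" "lnk x i j" "j \<in> A"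
      using kset_ex[of A x 3] lkind3_lnk[OF x] nA by fastforce
    have "i \<noteq> j" using ij by (simp add: lnk_def)
    then have Aij: "A = {i, j}" using 2 A ij by (intro card_subset_eq[symmetric]) auto
    have "kset A y 3 = A" using cy[of 3] nA A kset_sub by (intro card_subset_eq) auto
    then have "lkind y i = 3" using ij by (auto simp: kset_def)
    then obtain k where k: "lnk y i k" "k \<in> A" using lkind3_lnk[OF y ij(1)] by blast
    then have "k = j" using Aij by (auto simp: lnk_def)
    then show ?thesis using reach_pair[OF x y ij(1,2)] k 2 Aij by simp
  next
    case 3
    have "\<not> lonely A x i" if "i \<in> A" for i
    proof -
      have "kset A x 3 = A" using nA A kset_sub by (intro card_subset_eq) auto
      then show ?thesis using that by (auto simp: lonely_def kset_def)
    qed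
    moreover obtain i j where ij: "i \<in> A" "lnk y i j" "j \<in> A"
      using kset_ex[of A y 3] lkind3_lnk[OF y] nA cy[of 3] 3 by fastforce
    ultimately have ij': "i \<in> A" "j \<in> A" "lnk y i j" "\<not> lonely A x i" "\<not> lonely A x j" by auto
    have ne: "i \<noteq> j" using ij by (simp add: lnk_def)
    let ?B = "A - {i, j}"
    have B: "card ?B + 2 = card A" "finite ?B" using A ij ne 3 by (simp_all add: card_Diff_subset)
    have "reach A (card ?B + 2) x y"
    proof (rule drop_link[OF A x y s _ ij'])
      fix x' assume x': "conf ?B x'" "conf ?B y" "sim ?B x' y"
        and c: "\<And>q. card (kset ?B x' q) = card (kset A x q) - (if q = 3 then 2 else 0)"
      have "tok ?B x' = 0" "card (kset ?B x' 0) = 0" using less.prems(5,6) by (simp_all add: tok_def c)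
      then show "reach ?B (card ?B) x' y" using less.hyps[OF _ B(2) x'] B(1) by simp
    qed (use 3 nA in simp)
    then show ?thesis using B(1) by simp
  qed
qed

text \<open>The link is made with sign 1 and, for reflections, with half the difference of the two
  labels of \<open>y\<close> as offset. It thus conjugates one line of \<open>y\<close> into the
  other, and a single exchange makes both final.\<close>

lemma pin_pair:
  assumes x: "conf A x" "conf A y" "finite A" "sim A x y" "i \<in> A" "j \<in> A" "i \<noteq> j" "4 \<le> card (kset A x 3)"
    and q: "lkind y i = q" "lkind y j = q" "q < 3" "2 \<le> card (kset A x q)"
    and l: "\<not> lonely A x i" "\<not> lonely A x j"
  shows "\<exists>x'. reach A 3 x x' \<and> x' i = y i \<and> x' j = y j"
proof -
  define w where "w = (if q = 0 then 0 else (snd (snd (y j)) - snd (snd (y i))) div 2)"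
  have w: "q \<noteq> 0 \<Longrightarrow> snd (snd (y j)) = snd (snd (y i)) + 2 * w"
    using same_kind_parity[OF x(2,6) q(2) x(2,5) q(1) q(3)] by (simp add: w_def)
  obtain x2 where x2: "reach A 2 x x2" "x2 i = (j, 1, w)"
    using pin_link[OF x(1,3,5-8)] l unfolding lonely_def by (metis not_less)
  have c: "conf A x2" "sim A x x2" using reach_conf[OF x2(1)] by auto
  have lk: "lnk x2 i j" using lnkI[OF c(1) x(5) x2(2) x(7)] .
  have "2 \<le> card (kset A x2 q)" using q(4) c(2) by (simp add: sim_def)
  then obtain k m where km: "k \<in> A" "m \<in> A" "lkind x2 k = q" "lkind x2 m = q" "k \<noteq> m" using two_kind by blast
  obtain x3 where x3: "step A x2 x3" "x3 i = y i" "lkind x3 i = q" "lkind x3 j = q"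
      "snd (snd (x3 j)) = fst (snd (x2 i)) * snd (snd (x3 i)) + (if q = 0 then 0 else 2 * snd (snd (x2 i)))"
    using swap_sgn[OF c(1) x(3,5) lk km(1,2,5,3,4) q(3) _ x(2,5) q(1), of 1] by blast
  have c3: "conf A x3" using step_conf(2)[OF x3(1)] .
  have "x3 j = y j"
  proof (cases "q = 0")
    case True
    then show ?thesis using lkind0D[OF c3 x(6)] lkind0D[OF x(2,6)] x3(4) q(2) by simp
  next
    case False
    then have "q = 1 \<or> q = 2" using q(3) by auto
    then obtain d e where "x3 j = (j, -1, d)" "y j = (j, -1, e)"
      using lkind12D[OF c3 x(6) x3(4)] lkind12D[OF x(2,6) q(2)] by blast
    then show ?thesis using x3(5) False w x2(2) x3(2) by simp
  qed
  then show ?thesis using reach_snoc[OF x2(1) x3(1)] x3(2) by (metis numeral_2_eq_2 numeral_3_eq_3)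
qed

text \<open>For two links whose removal would leave a disconnected class: pairs of lines of one kind
  are removed instead, at three moves per two lines. With at most two pairs the surplus is at most
  2.\<close>

lemma pairs_reach:
  assumes "finite A" "conf A x" "conf A y" "sim A x y" "card (kset A x 3) = 4"
    and "\<And>q. q < 3 \<Longrightarrow> card (kset A x q) = 0 \<or> card (kset A x q) = 2" "card A = 4 + 2 * k"
  shows "reach A (4 + 3 * k) x y"
  using assms
proof (induction k arbitrary: A x)
  case 0
  have "tok A x = 0" "card (kset A x 0) = 0"
    using card_kinds_tok[OF 0(1), of x] 0(5,7) by simp_all
  then have "reach A (card A) x y" using links_reach[OF 0(1-4)] by blast
  then show ?case using 0(7) by simp
next
  case (Suc k)
  note A = Suc.prems(1) and x = Suc.prems(2) and y = Suc.prems(3) and s = Suc.prems(4)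
  have "\<exists>q<3. card (kset A x q) \<noteq> 0"
  proof (rule ccontr)
    assume "\<not> ?thesis"
    then have "card (kset A x 0) = 0" "card (kset A x 1) = 0" "card (kset A x 2) = 0" by auto
    then show False using card_kinds[OF A, of x] Suc.prems(5,7) by simp
  qed
  then obtain q where "q < 3" "card (kset A x q) \<noteq> 0" by blast
  then have q: "q < 3" "card (kset A x q) = 2" using Suc.prems(6)[of q] by auto
  then have "2 \<le> card (kset A y q)" using s by (simp add: sim_def)
  then obtain i j where ij: "i \<in> A" "j \<in> A" "lkind y i = q" "lkind y j = q" "i \<noteq> j" using two_kind by blast
  have nl: "\<not> lonely A x z" if "z \<in> A" for z
  proof (cases "lkind x z = 3")
    case False
    then have "lkind x z < 3" using lkind_le[of x z] by simp
    then have "card (kset A x (lkind x z)) = 2"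
      using Suc.prems(6)[of "lkind x z"] kset_nonempty[OF A that, of x] by simp
    then show ?thesis by (simp add: lonely_def)
  qed (simp add: lonely_def)
  have p4: "4 \<le> card (kset A x 3)" "2 \<le> card (kset A x q)" using Suc.prems(5) q by simp_all
  obtain x' where x': "reach A 3 x x'" "x' i = y i" "x' j = y j"
    using pin_pair[OF x y A s ij(1,2,5) p4(1) ij(3,4) q(1) p4(2) nl nl] ij by blast
  have c: "conf A x'" "sim A x x'" using reach_conf[OF x'(1)] by auto
  have s': "sim A x' y" using sim_trans[OF sim_sym[OF c(2)] s] .
  have k: "lkind x' i = q" "lkind x' j = q" using lkind_cong[of x' i y] lkind_cong[of x' j y] x' ij by auto
  have f: "fst (x' i) = i" "fst (x' j) = j" using kinds_of_fixed[of x'] k q by auto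
  note d = del_fixed[OF A c(1) y s' ij(1) x'(2) f(1)]
  have jB: "j \<in> A - {i}" "finite (A - {i})" using ij A by auto
  note e = del_fixed[OF jB(2) d(1-3) jB(1) x'(3) f(2)]
  let ?B = "A - {i} - {j}"
  have cB: "card (kset A x r) = (if r = q then 2 else 0) + card (kset ?B x' r)" for r
    using c(2) d(4)[of r] e(4)[of r] k by (simp add: sim_def)
  have B: "card ?B + 2 = card A" "finite ?B" using A ij Suc.prems(7) by (simp_all add: card_Diff_subset)
  have "reach ?B (4 + 3 * k) x' y"
  proof (rule Suc.IH[OF B(2) e(1-3)])
    show "card (kset ?B x' 3) = 4" using cB[of 3] Suc.prems(5) q(1) by simp
    show "card (kset ?B x' r) = 0 \<or> card (kset ?B x' r) = 2" if "r < 3" for r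
      using cB[of r] Suc.prems(6)[OF that] by (auto split: if_splits)
    show "card ?B = 4 + 2 * k" using B Suc.prems(7) by simp
  qed
  then have "reach A (4 + 3 * k) x' y" using d(5) e(5) by blast
  then show ?case by (rule reach_trans_le[OF x'(1)]) simp
qed

section \<open>One link, no hole\<close>

text \<open>There are \<open>a\<close> reflections of the colour \<open>q\<close> and \<open>b\<close> of the other colour \<open>o'\<close>.\<close>

definition tc :: "nat set \<Rightarrow> nat \<Rightarrow> nat \<Rightarrow> nat \<Rightarrow> nat \<Rightarrow> lmap \<Rightarrow> lmap \<Rightarrow> bool" where
  "tc A a q b o' x y \<longleftrightarrow> finite A \<and> conf A x \<and> conf A y \<and> sim A x y \<and> (q = 1 \<and> o' = 2 \<or> q = 2 \<and> o' = 1)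
    \<and> card (kset A x 0) = 0 \<and> card (kset A x 3) = 2 \<and> card (kset A x q) = a \<and> card (kset A x o') = b"

lemma tc_conf: "tc A a q b o' x y \<Longrightarrow> finite A" "tc A a q b o' x y \<Longrightarrow> conf A x" "tc A a q b o' x y \<Longrightarrow> conf A y"
  "tc A a q b o' x y \<Longrightarrow> sim A x y"
  by (simp_all add: tc_def)

lemma tc_colours: "tc A a q b o' x y \<Longrightarrow> q = 1 \<or> q = 2" "tc A a q b o' x y \<Longrightarrow> o' = 1 \<or> o' = 2"
  "tc A a q b o' x y \<Longrightarrow> q \<noteq> o'" "tc A a q b o' x y \<Longrightarrow> q < 3" "tc A a q b o' x y \<Longrightarrow> o' < 3"
  by (auto simp: tc_def)

lemma tc_counts: "tc A a q b o' x y \<Longrightarrow> card (kset A x q) = a" "tc A a q b o' x y \<Longrightarrow> card (kset A x o') = b"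
  "tc A a q b o' x y \<Longrightarrow> card (kset A x 3) = 2"
  by (simp_all add: tc_def)

lemma tc_card: "tc A a q b o' x y \<Longrightarrow> card A = a + b + 2"
  using card_kinds[of A x] by (auto simp: tc_def)

lemma tc_swap: "tc A a q b o' x y \<Longrightarrow> tc A b o' a q x y"
  by (auto simp: tc_def)

lemma tc_sym: "tc A a q b o' x y \<Longrightarrow> tc A a q b o' y x"
  by (auto simp: tc_def sim_def)

lemma tc_reach: "tc A a q b o' x y \<Longrightarrow> reach A k x x' \<Longrightarrow> tc A a q b o' x' y"
  using reach_conf[of A k x x'] by (auto simp: tc_def sim_def)

lemma tc_step: "tc A a q b o' x y \<Longrightarrow> step A x x' \<Longrightarrow> tc A a q b o' x' y"
  using tc_reach reach_step by blast

lemma tc_kinds: "tc A a q b o' x y \<Longrightarrow> z \<in> A \<Longrightarrow> lkind x z = q \<or> lkind x z = o' \<or> lkind x z = 3"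
  using lkind_values[of x z] kset_nonempty[of A z x] by (auto simp: tc_def)

lemma tc_links:
  assumes "tc A a q b o' x y" "g \<in> A" "lnk x g h" "z \<in> A"
  shows "lkind x z = 3 \<longleftrightarrow> z = g \<or> z = h"
proof -
  have "g \<noteq> h" "h \<in> A" using assms lnk_mem tc_conf by (auto simp: lnk_def)
  then have "kset A x 3 = {g, h}"
    using assms tc_counts(3)[OF assms(1)] tc_conf(1)[OF assms(1)] lnk_lkind[OF assms(3)]
    by (intro card_subset_eq[symmetric]) (auto simp: kset_iff)
  then show ?thesis using assms(4) kset_iff[of z A x 3] by auto
qed

lemma tc_link_ex: "tc A a q b o' x y \<Longrightarrow> \<exists>g h. g \<in> A \<and> h \<in> A \<and> lnk x g h"
  using kset_ex[of A x 3] lkind3_lnk[of A x] by (fastforce simp: tc_def)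

lemma tc_pin:
  assumes "tc A a q b o' x y" "z \<in> A" "x z = y z" "lkind y z = o'"
  shows "tc (A - {z}) a q (b - 1) o' x y" "reach (A - {z}) n x y \<Longrightarrow> reach A n x y"
proof -
  have k: "lkind x z = o'" using lkind_cong[of x z y] assms(3,4) by simp
  then have f: "fst (x z) = z" using kinds_of_fixed[of x z] tc_colours(5)[OF assms(1)] by simp
  note d = del_fixed[OF tc_conf[OF assms(1)] assms(2,3) f]
  show "reach (A - {z}) n x y \<Longrightarrow> reach A n x y" using d(5) .
  have "card (kset A x r) = (if r = o' then 1 else 0) + card (kset (A - {z}) x r)" for r
    using d(4)[of r] k by auto
  then show "tc (A - {z}) a q (b - 1) o' x y"
    using assms(1) d(1-3) unfolding tc_def by auto
qed

section \<open>Links that fit the labels of the target\<close>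

definition val :: "lmap \<Rightarrow> nat \<Rightarrow> int" where
  "val x i = snd (snd (x i))"

lemma val_parity: "conf A x \<Longrightarrow> i \<in> A \<Longrightarrow> lkind x i = q \<Longrightarrow> q = 1 \<or> q = 2 \<Longrightarrow> even (val x i) \<longleftrightarrow> q = 1"
  using lkind12D[of A x i q] by (auto simp: val_def)

lemma val_eqI:
  assumes "conf A x" "conf B y" "i \<in> A" "i \<in> B" "lkind x i = q" "lkind y i = q" "q = 1 \<or> q = 2" "val x i = val y i"
  shows "x i = y i"
  using lkind12D[OF assms(1,3,5,7)] lkind12D[OF assms(2,4,6,7)] assms(8) by (auto simp: val_def)

text \<open>
  The link \<open>{r, s}\<close> of \<open>x\<close> carries the label of \<open>y\<close> at \<open>r\<close> to its label at \<open>s\<close>, so that one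
  exchange turns both lines into the reflections that they carry in \<open>y\<close>.
\<close>

definition fits :: "lmap \<Rightarrow> nat \<Rightarrow> nat \<Rightarrow> lmap \<Rightarrow> bool" where
  "fits y r s x \<longleftrightarrow> lnk x r s \<and> (\<exists>t w. x r = (s, t, w) \<and> val y s = t * val y r + 2 * w)"

lemma swap_val:
  assumes x: "conf A x" "finite A" "i \<in> A" "lnk x i j"
    and kl: "k \<in> A" "l \<in> A" "k \<noteq> l" "lkind x k = q" "lkind x l = q" "q = 1 \<or> q = 2"
    and c: "even c \<longleftrightarrow> q = 1"
  shows "\<exists>x'. step A x x' \<and> lnk x' k l \<and> val x' i = c \<and> lkind x' i = q \<and> lkind x' j = q \<and> off {i, j, k, l} x x'"
proof -
  define z :: lmap where "z m = (i, -1, c)" for m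
  have z: "conf {i} z" "lkind z i = q" using c kl(6) by (auto simp: z_def conf_def lcomp_def lkind_def)
  have "q < 3" using kl(6) by auto
  from swap_lab[OF x kl(1-5) this z(1) _ z(2)] show ?thesis by (auto simp: val_def z_def)
qed

lemma swap_fit:
  assumes x: "conf A x" "finite A" "i \<in> A" "lnk x i j"
    and kl: "k \<in> A" "l \<in> A" "k \<noteq> l" "lkind x k = q" "lkind x l = q" "q = 1 \<or> q = 2"
    and v: "val x l - val x k = val y l - val y k" "even (val y l - val y k)"
    and z: "conf C z" "i \<in> C" "lkind z i = q"
  shows "\<exists>x'. step A x x' \<and> fits y k l x' \<and> x' i = z i \<and> lkind x' i = q \<and> lkind x' j = q \<and> off {i, j, k, l} x x'
    \<and> (fits z i j x \<and> j \<in> C \<and> lkind z j = q \<longrightarrow> x' j = z j)"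
proof -
  let ?w = "(val y l - val y k) div 2"
  have q3: "q < 3" "q \<noteq> 0" using kl(6) by auto
  have "snd (snd (x l)) = 1 * snd (snd (x k)) + 2 * ?w" using v by (simp add: val_def)
  then obtain x' where x': "step A x x'" "x' k = (l, 1, ?w)" "lnk x' k l" "x' i = z i" "lkind x' i = q" "lkind x' j = q"
      "off {i, j, k, l} x x'"
      "snd (snd (x' j)) = fst (snd (x i)) * snd (snd (x' i)) + (if q = 0 then 0 else 2 * snd (snd (x i)))"
    using swap_to[OF x kl(1-5) q3(1) _ _ z, of 1 ?w] by blast
  moreover have "val y l = 1 * val y k + 2 * ?w" using v(2) by simp
  moreover have "x' j = z j" if f: "fits z i j x" "j \<in> C" "lkind z j = q"
  proof -
    have "val x' j = val z j" using f(1) x'(4,8) q3(2) by (auto simp: fits_def val_def)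
    then show ?thesis
      using val_eqI[OF step_conf(2)[OF x'(1)] z(1) lnk_mem[OF x(1,3,4)] f(2) x'(6) f(3) kl(6)] by blast
  qed
  ultimately show ?thesis unfolding fits_def by blast
qed

text \<open>A flip leaves the offset free, and labels of equal parity make the required offset
  integral for either sign.\<close>

lemma flip_fit:
  assumes x: "conf A x" "finite A" "r \<in> A" "lnk x r s" and e: "even (val y s - val y r)"
  shows "\<exists>x'. step A x x' \<and> fits y r s x' \<and> off {r, s} x x'"
proof -
  obtain t v where xr: "x r = (s, t, v)" "r \<noteq> s" "t = 1 \<or> t = -1" using lnkD[OF x(1,3,4)] by metis
  let ?w = "(val y s + t * val y r) div 2"
  obtain x' where "step A x x'" "x' r = (s, - t, ?w)" "lnk x' r s" "off {r, s} x x'"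
    using flip_to[OF x(1-3) xr(1,2)] by blast
  moreover have "val y s = - t * val y r + 2 * ?w" using e xr(3) by auto
  ultimately show ?thesis unfolding fits_def by blast
qed

text \<open>On leaving, the label at \<open>r\<close> is chosen and the label at \<open>s\<close> is
  forced; a fitting link forces the right one.\<close>

lemma release:
  assumes x: "conf A x" "finite A" "r \<in> A" "fits y r s x"
    and kl: "k \<in> A" "l \<in> A" "k \<noteq> l" "lkind x k = q" "lkind x l = q" "q = 1 \<or> q = 2"
    and y: "conf C y" "r \<in> C" "s \<in> C" "lkind y r = q" "lkind y s = q"
  shows "\<exists>x'. step A x x' \<and> lnk x' k l \<and> x' r = y r \<and> x' s = y s \<and> off {r, s, k, l} x x'"
proof -
  obtain t w where f: "lnk x r s" "x r = (s, t, w)" "val y s = t * val y r + 2 * w"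
    using x(4) by (auto simp: fits_def)
  have q3: "q < 3" "q \<noteq> 0" using kl(6) by auto
  obtain x' where x': "step A x x'" "lnk x' k l" "x' r = y r" "lkind x' r = q" "lkind x' s = q" "off {r, s, k, l} x x'"
      "snd (snd (x' s)) = fst (snd (x r)) * snd (snd (x' r)) + (if q = 0 then 0 else 2 * snd (snd (x r)))"
    using swap_sgn[OF x(1-3) f(1) kl(1-5) q3(1) _ y(1,2,4), of 1] by blast
  have "val x' s = val y s" using x'(3,7) f(2,3) q3(2) by (simp add: val_def)
  then have "x' s = y s" using val_eqI[OF step_conf(2)[OF x'(1)] y(1) lnk_mem[OF x(1,3) f(1)] y(3) x'(5) y(5) kl(6)] by blast
  then show ?thesis using x' by blast
qed

text \<open>The flip makes the old link fit. The exchange makes its two lines final and creates the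
  new link with the sign opposite to that in \<open>y\<close>, so that one more flip completes
  it.\<close>

lemma blocks_other:
  assumes t: "tc A a q b o' x y" and A: "A = {p, p', u, u'}" "distinct [p, p', u, u']"
    and l: "lnk x p p'" "lnk y u u'" and k: "lkind x u = o'" "lkind x u' = o'" "lkind y p = o'" "lkind y p' = o'"
  shows "reach A 3 x y"
proof -
  note c = tc_conf[OF t] and o = tc_colours(2)[OF t]
  have m: "p \<in> A" "p' \<in> A" "u \<in> A" "u' \<in> A" using A by auto
  have "even (val y p' - val y p)" using val_parity[OF c(3) _ _ o] m k by auto
  then obtain x1 where x1: "step A x x1" "fits y p p' x1" "off {p, p'} x x1"
    using flip_fit[OF c(2,1) m(1) l(1)] by blast
  have k1: "lkind x1 u = o'" "lkind x1 u' = o'" using offD(2)[OF x1(3)] A k by auto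
  note c1 = step_conf(2)[OF x1(1)]
  obtain t1 w1 where yu: "y u = (u', t1, w1)" "y u' = (u, t1, - t1 * w1)" "t1 = 1 \<or> t1 = -1" using lnkD[OF c(3) m(3) l(2)] by metis
  obtain t w where f: "lnk x1 p p'" "x1 p = (p', t, w)" "val y p' = t * val y p + 2 * w"
    using x1(2) by (auto simp: fits_def)
  have o3: "o' < 3" "o' \<noteq> 0" using o by auto
  have "- t1 = 1 \<or> - t1 = -1" using yu(3) by auto
  then obtain x2 w2 where x2: "step A x1 x2" "x2 u = (u', - t1, w2)" "x2 p = y p" "lkind x2 p' = o'"
      "off {p, p', u, u'} x1 x2"
      "snd (snd (x2 p')) = fst (snd (x1 p)) * snd (snd (x2 p)) + (if o' = 0 then 0 else 2 * snd (snd (x1 p)))"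
    using swap_sgn[OF c1 c(1) m(1) f(1) m(3,4) _ k1 o3(1) _ c(3) m(1) k(3), of "- t1"] A(2) by auto
  have "val x2 p' = val y p'" using x2(3,6) f(2,3) o3(2) by (simp add: val_def)
  then have p': "x2 p' = y p'" using val_eqI[OF step_conf(2)[OF x2(1)] c(3) m(2,2) x2(4) k(4) o] by blast
  have "u \<noteq> u'" using A by simp
  then obtain x3 where x3: "step A x2 x3" "x3 u = (u', t1, w1)" "off {u, u'} x2 x3"
    using flip_to[OF step_conf(2)[OF x2(1)] c(1) m(3) x2(2), of w1] by auto
  have "x3 p = y p" "x3 p' = y p'" using offD(1)[OF x3(3)] A x2(3) p' by auto
  moreover have "x3 u' = y u'" using conf_link(3)[OF step_conf(2)[OF x3(1)] m(3) x3(2)] yu by simp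
  ultimately have eq: "x3 i = y i" if "i \<in> A" for i using that A x3(2) yu(1) by auto
  show ?thesis using reach_cong_right[OF reach_1_1_1[OF x1(1) x2(1) x3(1)] eq] .
qed

text \<open>Only a visit of the link changes the labels at \<open>u\<close> and \<open>u'\<close>;
  one exchange leads to \<open>blocks_other\<close> with the pairs interchanged.\<close>

lemma blocks_same:
  assumes t: "tc A a q b o' x y" and A: "A = {p, p', u, u'}" "distinct [p, p', u, u']"
    and l: "lnk x p p'" "lnk y p p'" and k: "lkind x u = o'" "lkind x u' = o'" "lkind y u = o'" "lkind y u' = o'"
  shows "reach A 4 x y"
proof -
  note c = tc_conf[OF t]
  have m: "p \<in> A" "p' \<in> A" "u \<in> A" "u' \<in> A" using A by auto
  have "u \<noteq> u'" using A by simp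
  then obtain x1 where x1: "step A x x1" "lnk x1 u u'" "lkind x1 p = o'" "lkind x1 p' = o'"
    using swap_any[OF c(2,1) m(1) l(1) m(3,4) _ k(1,2) tc_colours(5)[OF t]] by blast
  have "A = {u, u', p, p'}" "distinct [u, u', p, p']" using A by auto
  then have "reach A 3 x1 y" by (rule blocks_other[OF tc_step[OF t x1(1)] _ _ x1(2) l(2) x1(3,4) k(3,4)])
  then show ?thesis using reach_Cons[OF x1(1)] by (simp add: eval_nat_numeral)
qed

section \<open>One link and tokens of a single colour\<close>

lemma oc_kind:
  assumes "tc A 0 q b o' x y" "g \<in> A" "lnk x g h" "z \<in> A" "z \<noteq> g" "z \<noteq> h"
  shows "lkind x z = o'"
proof -
  have "lkind x z \<noteq> q"
    using kset_nonempty[OF tc_conf(1)[OF assms(1)] assms(4), of x] tc_counts(1)[OF assms(1)] by auto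
  then show ?thesis using tc_kinds[OF assms(1,4)] tc_links[OF assms(1-4)] assms(5,6) by blast
qed

text \<open>The line \<open>p\<close> receives its final label when the link leaves it: one move,
  one line removed.\<close>

lemma oc_pin_link:
  assumes t: "tc A 0 q b o' x y" and x: "p \<in> A" "lnk x p z" and y: "lkind y p = o'"
    and k: "k \<in> A" "l \<in> A" "k \<noteq> l" "k \<noteq> p" "k \<noteq> z" "l \<noteq> p" "l \<noteq> z"
  shows "\<exists>x'. step A x x' \<and> lnk x' k l \<and> tc (A - {p}) 0 q (b - 1) o' x' y \<and> (\<forall>n. reach (A - {p}) n x' y \<longrightarrow> reach A (Suc n) x y)"
proof -
  note c = tc_conf[OF t]
  obtain x1 where x1: "step A x x1" "lnk x1 k l" "x1 p = y p"
    using swap_lab[OF c(2,1) x k(1-3) _ _ tc_colours(5)[OF t] c(3) x(1) y]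
      oc_kind[OF t x k(1,4,5)] oc_kind[OF t x k(2,6,7)] by blast
  note p = tc_pin[OF tc_step[OF t x1(1)] x(1) x1(3) y]
  show ?thesis using x1 p reach_Cons[OF x1(1)] by blast
qed

text \<open>The invariant is that the two links share exactly one line. The link leaves
  \<open>p\<close> behind as final and goes to \<open>w\<close> and a new line, so that again one
  line is shared. With five lines it goes to two new lines instead, and \<open>blocks_other\<close>
  finishes in three moves.\<close>

lemma oc_share:
  assumes "tc A 0 q b o' x y" "3 \<le> b" "p \<in> A" "z \<in> A" "w \<in> A" "lnk x p z" "lnk y z w" "p \<noteq> w"
  shows "reach A (b + 1) x y"
  using assms
proof (induction b arbitrary: A x p z w)
  case (Suc b)
  note t = Suc.prems(1) and m = Suc.prems(3-5) and l = Suc.prems(6,7)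
  have d: "p \<noteq> z" "z \<noteq> w" "p \<noteq> w" using l Suc.prems(8) by (auto simp: lnk_def)
  have yp: "lkind y p = o'" using oc_kind[OF tc_sym[OF t] m(2) l(2) m(1)] d by blast
  have card: "card A = Suc b + 2" "finite A" using tc_card[OF t] tc_conf[OF t] by auto
  have c3: "card {p, z, w} = 3" using d by auto
  then obtain l1 where l1: "l1 \<in> A" "l1 \<notin> {p, z, w}" using others_of[of "{p, z, w}" A] card Suc.prems(2) by auto
  show ?case
  proof (cases "b = 2")
    case True
    have "card {p, z, w, l1} = 4" using d l1 by auto
    then obtain l2 where l2: "l2 \<in> A" "l2 \<notin> {p, z, w, l1}" using others_of[of "{p, z, w, l1}" A] card True by auto
    obtain x1 where x1: "step A x x1" "lnk x1 l1 l2" "tc (A - {p}) 0 q (Suc b - 1) o' x1 y"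
        "\<And>n. reach (A - {p}) n x1 y \<Longrightarrow> reach A (Suc n) x y"
      using oc_pin_link[OF t m(1) l(1) yp l1(1) l2(1)] l1 l2 by blast
    have "{z, w, l1, l2} \<subseteq> A - {p}" "card {z, w, l1, l2} = 4" using m l1 l2 d by auto
    moreover have "card (A - {p}) = 4" using card True m(1) by simp
    ultimately have A: "A - {p} = {l1, l2, z, w}" using card(2) card_subset_eq[of "A - {p}" "{z, w, l1, l2}"] by auto
    note t1 = x1(3)
    have mm: "l1 \<in> A - {p}" "l2 \<in> A - {p}" "z \<in> A - {p}" "w \<in> A - {p}" using A by auto
    have k: "lkind x1 z = o'" "lkind x1 w = o'" "lkind y l1 = o'" "lkind y l2 = o'"
      using oc_kind[OF t1 mm(1) x1(2) mm(3)] oc_kind[OF t1 mm(1) x1(2) mm(4)]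
        oc_kind[OF tc_sym[OF t1] mm(3) l(2) mm(1)] oc_kind[OF tc_sym[OF t1] mm(3) l(2) mm(2)] l1 l2 by auto
    have "reach (A - {p}) 3 x1 y"
      using blocks_other[OF t1 A _ x1(2) l(2) k] d l1 l2 by auto
    then show ?thesis using x1(4)[of 3] True by simp
  next
    case False
    obtain x1 where x1: "step A x x1" "lnk x1 l1 w" "tc (A - {p}) 0 q (Suc b - 1) o' x1 y"
        "\<And>n. reach (A - {p}) n x1 y \<Longrightarrow> reach A (Suc n) x y"
      using oc_pin_link[OF t m(1) l(1) yp l1(1) m(3)] l1 d by blast
    have t1: "tc (A - {p}) 0 q b o' x1 y" using x1(3) by simp
    have "reach (A - {p}) (b + 1) x1 y"
      using Suc.IH[OF t1 _ _ _ _ x1(2) lnk_sym[OF l(2)]] False Suc.prems(2) m l1 d by auto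
    then show ?thesis using x1(4) by simp
  qed
qed simp

text \<open>One move makes the links share a line. For \<open>b = 3\<close> it would leave two
  tokens, too few for \<open>oc_share\<close>; the link then goes straight to its final pair, and
  \<open>blocks_same\<close> gives \<open>1 + 4\<close> moves.\<close>

lemma oc_disjoint:
  assumes t: "tc A 0 q b o' x y" "3 \<le> b" and m: "p \<in> A" "p' \<in> A" "r \<in> A" "r' \<in> A" and l: "lnk x p p'" "lnk y r r'"
    and d: "p \<notin> {r, r'}" "p' \<notin> {r, r'}"
  shows "reach A (if b = 3 then 5 else b + 1) x y"
proof -
  have d': "p \<noteq> p'" "r \<noteq> r'" using l by (auto simp: lnk_def)
  have yp: "lkind y p = o'" using oc_kind[OF tc_sym[OF t(1)] m(3) l(2) m(1)] d by blast
  have card: "card A = b + 2" "finite A" using tc_card[OF t(1)] tc_conf[OF t(1)] by auto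
  have c4: "card {p, p', r, r'} = 4" using d d' by auto
  then obtain l1 where l1: "l1 \<in> A" "l1 \<notin> {p, p', r, r'}" using others_of[of "{p, p', r, r'}" A] card t(2) by auto
  show ?thesis
  proof (cases "b = 3")
    case True
    obtain x1 where x1: "step A x x1" "lnk x1 r r'" "tc (A - {p}) 0 q (b - 1) o' x1 y"
        "\<And>n. reach (A - {p}) n x1 y \<Longrightarrow> reach A (Suc n) x y"
      using oc_pin_link[OF t(1) m(1) l(1) yp m(3,4) d'(2)] d by blast
    have "{r, r', p', l1} \<subseteq> A - {p}" "card {r, r', p', l1} = 4" using m l1 d d' by auto
    moreover have "card (A - {p}) = 4" using card True m(1) by simp
    ultimately have A: "A - {p} = {r, r', p', l1}" using card(2) card_subset_eq[of "A - {p}" "{r, r', p', l1}"] by auto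
    note t1 = x1(3)
    have mm: "r \<in> A - {p}" "p' \<in> A - {p}" "l1 \<in> A - {p}" using A by auto
    have k: "lkind x1 p' = o'" "lkind x1 l1 = o'" "lkind y p' = o'" "lkind y l1 = o'"
      using oc_kind[OF t1 mm(1) x1(2) mm(2)] oc_kind[OF t1 mm(1) x1(2) mm(3)]
        oc_kind[OF tc_sym[OF t1] mm(1) l(2) mm(2)] oc_kind[OF tc_sym[OF t1] mm(1) l(2) mm(3)] l1 d by auto
    have "reach (A - {p}) 4 x1 y"
      using blocks_same[OF t1 A _ x1(2) l(2) k] d d' l1 by auto
    then show ?thesis using x1(4)[of 4] True by simp
  next
    case False
    obtain x1 where x1: "step A x x1" "lnk x1 l1 r" "tc (A - {p}) 0 q (b - 1) o' x1 y"
        "\<And>n. reach (A - {p}) n x1 y \<Longrightarrow> reach A (Suc n) x y"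
      using oc_pin_link[OF t(1) m(1) l(1) yp l1(1) m(3)] l1 d by blast
    have b3: "3 \<le> b - 1" using False t(2) by arith
    have "reach (A - {p}) (b - 1 + 1) x1 y"
      using oc_share[OF x1(3) b3 _ _ _ x1(2) l(2)] False t(2) m l1 d d' by auto
    then show ?thesis using x1(4) False t(2) by auto
  qed
qed

text \<open>Labels of tokens change only when the link visits them, so it leaves its pair at the
  cost of one move.\<close>

lemma oc_same:
  assumes t: "tc A 0 q b o' x y" "3 \<le> b" and m: "p \<in> A" "p' \<in> A" and l: "lnk x p p'" "lnk y p p'"
  shows "reach A (if b = 3 then 6 else b + 2) x y"
proof -
  have card: "card A = b + 2" "finite A" using tc_card[OF t(1)] tc_conf[OF t(1)] by auto
  have d: "p \<noteq> p'" using l by (simp add: lnk_def)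
  have "2 \<le> card (kset A x o')" using tc_counts(2)[OF t(1)] t(2) by simp
  then obtain k k' where k: "k \<in> A" "k' \<in> A" "lkind x k = o'" "lkind x k' = o'" "k \<noteq> k'" using two_kind by blast
  have ne: "k \<notin> {p, p'}" "k' \<notin> {p, p'}" using k lnk_lkind[OF l(1)] tc_colours(2)[OF t(1)] by auto
  obtain x1 where x1: "step A x x1" "lnk x1 k k'"
    using swap_any[OF tc_conf(2,1)[OF t(1)] m(1) l(1) k(1,2,5,3,4) tc_colours(5)[OF t(1)]] by blast
  have "reach A (if b = 3 then 5 else b + 1) x1 y"
    by (rule oc_disjoint[OF tc_step[OF t(1) x1(1)] t(2) k(1,2) m x1(2) l(2) ne])
  then have "reach A (Suc (if b = 3 then 5 else b + 1)) x y" using reach_Cons[OF x1(1)] by blast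
  then show ?thesis by (auto split: if_splits)
qed

lemma oc_distinct:
  assumes t: "tc A 0 q b o' x y" "3 \<le> b" and m: "p \<in> A" "p' \<in> A" "r \<in> A" "r' \<in> A" and l: "lnk x p p'" "lnk y r r'"
    and d: "{p, p'} \<noteq> {r, r'}"
  shows "reach A (if b = 3 then 5 else b + 1) x y"
proof -
  have le: "b + 1 \<le> (if b = 3 then 5 else b + 1)" by auto
  have d': "p \<noteq> p'" "r \<noteq> r'" using l by (auto simp: lnk_def)
  consider "p \<notin> {r, r'}" "p' \<notin> {r, r'}" | "p = r" "p' \<noteq> r'" | "p = r'" "p' \<noteq> r" | "p' = r" "p \<noteq> r'" | "p' = r'" "p \<noteq> r"
    using d by blast
  then show ?thesis
  proof cases
    case 1 then show ?thesis using oc_disjoint[OF t m l] by blast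
  next
    case 2
    then have "reach A (b + 1) x y" using oc_share[OF t m(2,1,4) lnk_sym[OF l(1)]] l by auto
    then show ?thesis using reach_mono le by blast
  next
    case 3
    then have "reach A (b + 1) x y" using oc_share[OF t m(2,1,3) lnk_sym[OF l(1)]] lnk_sym[OF l(2)] by auto
    then show ?thesis using reach_mono le by blast
  next
    case 4
    then have "reach A (b + 1) x y" using oc_share[OF t m(1,2,4) l(1)] l(2) by auto
    then show ?thesis using reach_mono le by blast
  next
    case 5
    then have "reach A (b + 1) x y" using oc_share[OF t m(1,2,3) l(1)] lnk_sym[OF l(2)] by auto
    then show ?thesis using reach_mono le by blast
  qed
qed

section \<open>Settling two lines of one colour\<close>

lemma three_kind:
  "3 \<le> card (kset A x q) \<Longrightarrow> \<exists>u v w. u \<in> A \<and> v \<in> A \<and> w \<in> A \<and> lkind x u = q \<and> lkind x v = q \<and> lkind x w = q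
    \<and> u \<noteq> v \<and> u \<noteq> w \<and> v \<noteq> w"
proof -
  assume "3 \<le> card (kset A x q)"
  then obtain T where T: "T \<subseteq> kset A x q" "card T = 3" using obtain_subset_with_card_n by blast
  then obtain u v w where "T = {u, v, w}" "u \<noteq> v" "u \<noteq> w" "v \<noteq> w" by (auto simp: card_3_iff)
  then show ?thesis using T(1) by (auto simp: kset_iff)
qed

lemma fits_lnk: "fits y r s x \<Longrightarrow> lnk x r s" by (simp add: fits_def)

lemma even_val_diff:
  "conf A y \<Longrightarrow> r \<in> A \<Longrightarrow> s \<in> A \<Longrightarrow> lkind y r = q \<Longrightarrow> lkind y s = q \<Longrightarrow> q = 1 \<or> q = 2 \<Longrightarrow> even (val y s - val y r)"
  using val_parity[of A y r q] val_parity[of A y s q] by auto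

text \<open>One visit of the link sets both labels: it enters, is flipped so as to fit, and
  returns.\<close>

lemma agree_same:
  assumes t: "tc A a q b o' x y" and x: "p \<in> A" "lnk x p p'"
    and s: "s1 \<in> A" "s2 \<in> A" "s1 \<noteq> s2" "lkind x s1 = q" "lkind x s2 = q" "lkind y s1 = q" "lkind y s2 = q"
  shows "\<exists>x'. reach A 3 x x' \<and> x' s1 = y s1 \<and> x' s2 = y s2 \<and> lnk x' p p'"
proof -
  note c = tc_conf[OF t] and q = tc_colours(1,4)[OF t]
  have p: "p' \<in> A" "p \<noteq> p'" using lnk_mem[OF c(2) x] x(2) by (auto simp: lnk_def)
  have ne: "p \<noteq> s1" "p \<noteq> s2" "p' \<noteq> s1" "p' \<noteq> s2" using lnk_lkind[OF x(2)] s(4,5) q(2) by auto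
  have e: "even (val y s2 - val y s1)" using even_val_diff[OF c(3) s(1,2,6,7) q(1)] .
  obtain x1 where x1: "step A x x1" "lnk x1 s1 s2" "lkind x1 p = q" "lkind x1 p' = q"
    using swap_any[OF c(2,1) x s(1-5) q(2)] by blast
  obtain x2 where x2: "step A x1 x2" "fits y s1 s2 x2" "off {s1, s2} x1 x2"
    using flip_fit[OF step_conf(2)[OF x1(1)] c(1) s(1) x1(2) e] by blast
  have "lkind x2 p = q" "lkind x2 p' = q" using offD(2)[OF x2(3)] x1(3,4) ne by auto
  then obtain x3 where x3: "step A x2 x3" "lnk x3 p p'" "x3 s1 = y s1" "x3 s2 = y s2"
    using release[OF step_conf(2)[OF x2(1)] c(1) s(1) x2(2) x(1) p _ _ q(1) c(3) s(1,2,6,7)] by blast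
  then show ?thesis using reach_1_1_1[OF x1(1) x2(1) x3(1)] by blast
qed

lemma agree_on_link:
  assumes t: "tc A a q b o' x y" and x: "p \<in> A" "p' \<in> A" "lnk x p p'" "lkind y p = q" "lkind y p' = q"
    and e: "e1 \<in> A" "e2 \<in> A" "e1 \<noteq> e2" "lkind x e1 = q" "lkind x e2 = q"
  shows "\<exists>x'. reach A 2 x x' \<and> x' p = y p \<and> x' p' = y p' \<and> lnk x' e1 e2"
proof -
  note c = tc_conf[OF t] and q = tc_colours(1,4)[OF t]
  have ne: "e1 \<noteq> p" "e2 \<noteq> p" "e1 \<noteq> p'" "e2 \<noteq> p'" using lnk_lkind[OF x(3)] e q(2) by auto
  obtain x1 where x1: "step A x x1" "fits y p p' x1" "off {p, p'} x x1"
    using flip_fit[OF c(2,1) x(1,3) even_val_diff[OF c(3) x(1,2,4,5) q(1)]] by blast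
  have "lkind x1 e1 = q" "lkind x1 e2 = q" using offD(2)[OF x1(3)] e ne by auto
  then obtain x2 where x2: "step A x1 x2" "lnk x2 e1 e2" "x2 p = y p" "x2 p' = y p'"
    using release[OF step_conf(2)[OF x1(1)] c(1) x(1) x1(2) e(1-3) _ _ q(1) c(3) x(1,2,4,5)] by blast
  then show ?thesis using reach_1_1[OF x1(1) x2(1)] by blast
qed

text \<open>An exchange gives the vacated lines the kind of the lines entered, so leaving for
  \<open>{e1, e2}\<close> recolours \<open>s1\<close> and \<open>s2\<close>.\<close>

lemma agree_other_colour:
  assumes t: "tc A a q b o' x y" and x: "p \<in> A" "lnk x p p'"
    and s: "s1 \<in> A" "s2 \<in> A" "s1 \<noteq> s2" "lkind x s1 = o'" "lkind x s2 = o'" "lkind y s1 = q" "lkind y s2 = q"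
    and e: "e1 \<in> A" "e2 \<in> A" "e1 \<noteq> e2" "lkind x e1 = q" "lkind x e2 = q"
  shows "\<exists>x'. reach A 3 x x' \<and> x' s1 = y s1 \<and> x' s2 = y s2 \<and> lnk x' e1 e2"
proof -
  note c = tc_conf[OF t] and q = tc_colours(1-5)[OF t]
  have ne: "e1 \<noteq> p" "e2 \<noteq> p" "e1 \<noteq> p'" "e2 \<noteq> p'" "e1 \<noteq> s1" "e1 \<noteq> s2" "e2 \<noteq> s1" "e2 \<noteq> s2"
    using lnk_lkind[OF x(2)] e(4,5) s(4,5) q(3,4) by auto
  have ev: "even (val y s2 - val y s1)" using even_val_diff[OF c(3) s(1,2,6,7) q(1)] .
  obtain x1 where x1: "step A x x1" "lnk x1 s1 s2" "off {p, p', s1, s2} x x1"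
    using swap_any[OF c(2,1) x s(1-5) q(5)] by blast
  obtain x2 where x2: "step A x1 x2" "fits y s1 s2 x2" "off {s1, s2} x1 x2"
    using flip_fit[OF step_conf(2)[OF x1(1)] c(1) s(1) x1(2) ev] by blast
  have "lkind x2 e1 = q" "lkind x2 e2 = q" using offD(2)[OF x2(3)] offD(2)[OF x1(3)] e ne by auto
  then obtain x3 where x3: "step A x2 x3" "lnk x3 e1 e2" "x3 s1 = y s1" "x3 s2 = y s2"
    using release[OF step_conf(2)[OF x2(1)] c(1) s(1) x2(2) e(1-3) _ _ q(1) c(3) s(1,2,6,7)] by blast
  then show ?thesis using reach_1_1_1[OF x1(1) x2(1) x3(1)] by blast
qed

lemma agree_link_and_other:
  assumes t: "tc A a q b o' x y" "3 \<le> b" and x: "p \<in> A" "lnk x p p'"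
    and s: "s \<in> A" "lkind x s = o'" "lkind y p = q" "lkind y s = q"
    and e: "e1 \<in> A" "e2 \<in> A" "e1 \<noteq> e2" "lkind x e1 = q" "lkind x e2 = q"
  shows "\<exists>x'. reach A 3 x x' \<and> x' p = y p \<and> x' s = y s \<and> lnk x' e1 e2"
proof -
  note c = tc_conf[OF t(1)] and q = tc_colours(1-5)[OF t(1)]
  have "card {s} < card (kset A x o')" using tc_counts(2)[OF t(1)] t(2) by simp
  then obtain u where u: "u \<in> A" "lkind x u = o'" "u \<noteq> s" using others_of[of "{s}" "kset A x o'"] by (auto simp: kset_iff)
  have "card {s, u} < card (kset A x o')" using tc_counts(2)[OF t(1)] t(2) card_insert_le_m1[of 2 "{u}" s] by simp
  then obtain v where v: "v \<in> A" "lkind x v = o'" "v \<noteq> s" "v \<noteq> u"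
    using others_of[of "{s, u}" "kset A x o'"] by (auto simp: kset_iff)
  have p: "p' \<in> A" "p \<noteq> p'" using lnk_mem[OF c(2) x] x(2) by (auto simp: lnk_def)
  have ne: "e1 \<noteq> p" "e2 \<noteq> p" "e1 \<noteq> p'" "e2 \<noteq> p'" "e1 \<noteq> s" "e2 \<noteq> s" "e1 \<noteq> u" "e2 \<noteq> u" "e1 \<noteq> v" "e2 \<noteq> v"
    "p \<noteq> s" "p \<noteq> u" "p \<noteq> v" "p' \<noteq> s" "p' \<noteq> u" "p' \<noteq> v"
    using lnk_lkind[OF x(2)] e(4,5) s(2) u(2) v(2) q(3-5) by auto
  have ev: "even (val y s - val y p)" using even_val_diff[OF c(3) x(1) s(1,3,4) q(1)] .
  have xs: "even (val x s) \<longleftrightarrow> o' = 1" using val_parity[OF c(2) s(1,2) q(2)] .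
  \<comment> \<open>With this label at \<open>p\<close>, the reflections at \<open>p\<close> and
    \<open>s\<close> differ as those of \<open>y\<close> do, so the link entering
    \<open>{p, s}\<close> fits without a flip.\<close>
  define m where "m = val x s - (val y s - val y p)"
  have "even m \<longleftrightarrow> o' = 1" using ev xs by (simp add: m_def)
  then obtain x1 where x1: "step A x x1" "lnk x1 u v" "val x1 p = m" "lkind x1 p = o'" "off {p, p', u, v} x x1"
    using swap_val[OF c(2,1) x u(1) v(1) v(4)[symmetric] u(2) v(2) q(2)] by blast
  have 1: "lkind x1 s = o'" "val x1 s = val x s" using offD[OF x1(5), of s] s ne u v by (auto simp: val_def)
  obtain z where z: "conf {u} z" "lkind z u = o'" using lkind_dummy[OF q(2)] by blast
  have "val x1 s - val x1 p = val y s - val y p" using x1(3) 1(2) by (simp add: m_def)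
  then obtain x2 where x2: "step A x1 x2" "fits y p s x2" "off {u, v, p, s} x1 x2"
    using swap_fit[OF step_conf(2)[OF x1(1)] c(1) u(1) x1(2) x(1) s(1) ne(11) x1(4) 1(1) q(2) _ ev z(1) _ z(2)] by blast
  have "lkind x2 e1 = q" "lkind x2 e2 = q" using offD(2)[OF x2(3)] offD(2)[OF x1(5)] e ne by auto
  then obtain x3 where x3: "step A x2 x3" "lnk x3 e1 e2" "x3 p = y p" "x3 s = y s"
    using release[OF step_conf(2)[OF x2(1)] c(1) x(1) x2(2) e(1-3) _ _ q(1) c(3) x(1) s(1,3,4)] by blast
  then show ?thesis using reach_1_1_1[OF x1(1) x2(1) x3(1)] by blast
qed

lemma label_choice:
  "conf A y \<Longrightarrow> u \<in> A \<Longrightarrow> q = 1 \<or> q = 2 \<Longrightarrow> \<exists>z. conf {u} z \<and> lkind z u = q \<and> (lkind y u = q \<longrightarrow> z u = y u)"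
  using lkind_dummy[of q u] conf_fix[of A y u] kinds_of_fixed[of y u] by (cases "lkind y u = q") auto

lemma reach_5:
  "step A a b \<Longrightarrow> step A b c \<Longrightarrow> step A c d \<Longrightarrow> step A d e \<Longrightarrow> step A e f \<Longrightarrow> reach A 5 a f"
  using reach_Cons[OF _ reach_1_1_1_1, of A a b c d e f] by (simp add: eval_nat_numeral)

text \<open>The colours of \<open>s1\<close> and \<open>s2\<close> in \<open>x\<close> differ, so
  \<open>s1\<close> must become an \<open>o'\<close>-token before the link can enter both lines.
  Among the lines visited on the way, \<open>u\<close> takes its final label at no cost and
  \<open>g\<close> for one additional flip.\<close>

lemma agree_mixed:
  assumes t: "tc A a q b o' x y" and x: "p \<in> A" "lnk x p p'"
    and s: "s1 \<in> A" "g \<in> A" "s1 \<noteq> g" "lkind x s1 = q" "lkind x g = q" "s2 \<in> A" "lkind x s2 = o'" "lkind y s1 = q" "lkind y s2 = q"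
    and u: "u \<in> A" "v \<in> A" "u \<noteq> v" "u \<noteq> s2" "v \<noteq> s2" "lkind x u = o'" "lkind x v = o'"
  shows "\<exists>x'. reach A 4 x x' \<and> x' s1 = y s1 \<and> x' s2 = y s2 \<and> lnk x' p p' \<and> (lkind y u = o' \<longrightarrow> x' u = y u)"
    and "lkind y g = o' \<Longrightarrow> \<exists>x'. reach A 5 x x' \<and> x' s1 = y s1 \<and> x' s2 = y s2 \<and> lnk x' p p' \<and> x' g = y g"
proof -
  note c = tc_conf[OF t(1)] and q = tc_colours(1-5)[OF t(1)]
  have p: "p' \<in> A" "p \<noteq> p'" using lnk_mem[OF c(2) x] x(2) by (auto simp: lnk_def)
  have ne1: "p \<noteq> s1" "p \<noteq> s2" "p \<noteq> g" "p \<noteq> u" "p \<noteq> v" "p' \<noteq> s1" "p' \<noteq> s2" "p' \<noteq> g" "p' \<noteq> u" "p' \<noteq> v"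
    "s1 \<noteq> s2" "g \<noteq> s2" "u \<noteq> s1" "u \<noteq> g" "v \<noteq> s1" "v \<noteq> g"
    using lnk_lkind[OF x(2)] s(4,5,7) u(6,7) q(3-5) by auto
  note ne = ne1 ne1[symmetric] u(3-5) u(3-5)[symmetric] s(3) s(3)[symmetric]
  have ev: "even (val y s2 - val y s1)" using even_val_diff[OF c(3) s(1,6,8,9) q(1)] .
  have xs: "even (val x s2) \<longleftrightarrow> o' = 1" using val_parity[OF c(2) s(6,7) q(2)] .
  define m where "m = val x s2 - (val y s2 - val y s1)"
  have m: "even m \<longleftrightarrow> o' = 1" using ev xs by (simp add: m_def)
  obtain x1 where x1: "step A x x1" "lnk x1 s1 g" "lkind x1 p = q" "lkind x1 p' = q" "off {p, p', s1, g} x x1"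
    using swap_any[OF c(2,1) x s(1-5) q(4)] by blast
  have 1: "lkind x1 s2 = o'" "val x1 s2 = val x s2" "lkind x1 u = o'" "lkind x1 v = o'"
    using offD[OF x1(5), of s2] offD[OF x1(5), of u] offD[OF x1(5), of v] s u ne by (auto simp: val_def)
  obtain z where z: "conf {u} z" "lkind z u = o'" "lkind y u = o' \<longrightarrow> z u = y u" using label_choice[OF c(3) u(1) q(2)] by blast
  have tail: "\<exists>x4 x5. step A x3 x4 \<and> step A x4 x5 \<and> x5 s1 = y s1 \<and> x5 s2 = y s2 \<and> lnk x5 p p' \<and> x5 u = z u \<and> x5 g = x3 g"
    if x3: "conf A x3" "lnk x3 u v" "val x3 s1 = m" "lkind x3 s1 = o'" "lkind x3 s2 = o'" "val x3 s2 = val x s2"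
      "lkind x3 p = q" "lkind x3 p' = q" for x3
  proof -
    have "val x3 s2 - val x3 s1 = val y s2 - val y s1" using x3 by (simp add: m_def)
    then obtain x4 where x4: "step A x3 x4" "fits y s1 s2 x4" "x4 u = z u" "off {u, v, s1, s2} x3 x4"
      using swap_fit[OF x3(1) c(1) u(1) x3(2) s(1,6) ne1(11) x3(4,5) q(2) _ ev z(1) _ z(2)] by blast
    have 4: "lkind x4 p = q" "lkind x4 p' = q" "x4 g = x3 g"
      using offD(2)[OF x4(4), of p] offD(2)[OF x4(4), of p'] offD(1)[OF x4(4), of g] x3 ne by auto
    obtain x5 where x5: "step A x4 x5" "lnk x5 p p'" "x5 s1 = y s1" "x5 s2 = y s2" "off {s1, s2, p, p'} x4 x5"
      using release[OF step_conf(2)[OF x4(1)] c(1) s(1) x4(2) x(1) p 4(1,2) q(1) c(3) s(1,6,8,9)] by blast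
    have "x5 u = z u" "x5 g = x3 g" using offD(1)[OF x5(5), of u] offD(1)[OF x5(5), of g] x4(3) 4(3) ne by auto
    then show ?thesis using x4(1) x5 by blast
  qed
  show "\<exists>x'. reach A 4 x x' \<and> x' s1 = y s1 \<and> x' s2 = y s2 \<and> lnk x' p p' \<and> (lkind y u = o' \<longrightarrow> x' u = y u)"
  proof -
    obtain x2 where x2: "step A x1 x2" "lnk x2 u v" "val x2 s1 = m" "lkind x2 s1 = o'" "off {s1, g, u, v} x1 x2"
      using swap_val[OF step_conf(2)[OF x1(1)] c(1) s(1) x1(2) u(1-3) 1(3,4) q(2) m] by blast
    have "lkind x2 s2 = o'" "val x2 s2 = val x s2" "lkind x2 p = q" "lkind x2 p' = q"
      using offD[OF x2(5), of s2] offD(2)[OF x2(5), of p] offD(2)[OF x2(5), of p'] 1 x1 ne by (auto simp: val_def)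
    from tail[OF step_conf(2)[OF x2(1)] x2(2-4) this] obtain x4 x5 where x5: "step A x2 x4" "step A x4 x5"
      "x5 s1 = y s1" "x5 s2 = y s2" "lnk x5 p p'" "x5 u = z u" by blast
    then show ?thesis using reach_1_1_1_1[OF x1(1) x2(1) x5(1,2)] z(3) by metis
  qed
  assume yg: "lkind y g = o'"
  \<comment> \<open>An auxiliary target for the flip: its label at \<open>g\<close> is final, while
    that at \<open>s1\<close> is the intermediate label \<open>m\<close>.\<close>
  define y' where "y' = y(s1 := (s1, -1, m))"
  have y': "conf {s1, g} y'" "lkind y' s1 = o'" "lkind y' g = o'" "y' g = y g" "val y' s1 = m"
  proof -
    obtain d where "y g = (g, -1, d)" using lkind12D[OF c(3) s(2) yg q(2)] by blast
    then show "conf {s1, g} y'" using s(3) by (auto simp: y'_def conf_def lcomp_def)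
    show "lkind y' s1 = o'" using m q(2) by (auto simp: y'_def lkind_def)
    show "y' g = y g" using s(3) by (simp add: y'_def)
    then show "lkind y' g = o'" using lkind_cong[of y' g y] yg by simp
    show "val y' s1 = m" by (simp add: y'_def val_def)
  qed
  have "even (val y' g - val y' s1)" using even_val_diff[OF y'(1) _ _ y'(2,3) q(2)] by simp
  then obtain x2 where x2: "step A x1 x2" "fits y' s1 g x2" "off {s1, g} x1 x2"
    using flip_fit[OF step_conf(2)[OF x1(1)] c(1) s(1) x1(2)] by blast
  have 2: "lkind x2 s2 = o'" "val x2 s2 = val x s2" "lkind x2 p = q" "lkind x2 p' = q" "lkind x2 u = o'" "lkind x2 v = o'"
    using offD[OF x2(3), of s2] offD(2)[OF x2(3), of p] offD(2)[OF x2(3), of p'] offD(2)[OF x2(3), of u] offD(2)[OF x2(3), of v]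
      1 x1 ne by (auto simp: val_def)
  obtain x3 where x3: "step A x2 x3" "lnk x3 u v" "x3 s1 = y' s1" "x3 g = y' g" "off {s1, g, u, v} x2 x3"
    using release[OF step_conf(2)[OF x2(1)] c(1) s(1) x2(2) u(1-3) 2(5,6) q(2) y'(1) _ _ y'(2,3)] by blast
  have "lkind x3 s1 = o'" "val x3 s1 = m" using lkind_cong[of x3 s1 y'] x3(3) y'(2,5) by (auto simp: val_def)
  moreover have "lkind x3 s2 = o'" "val x3 s2 = val x s2" "lkind x3 p = q" "lkind x3 p' = q"
    using offD[OF x3(5), of s2] offD(2)[OF x3(5), of p] offD(2)[OF x3(5), of p'] 2 ne by (auto simp: val_def)
  ultimately obtain x4 x5 where x5: "step A x3 x4" "step A x4 x5"
      "x5 s1 = y s1" "x5 s2 = y s2" "lnk x5 p p'" "x5 g = x3 g"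
    using tail[OF step_conf(2)[OF x3(1)] x3(2)] by blast
  then show "\<exists>x'. reach A 5 x x' \<and> x' s1 = y s1 \<and> x' s2 = y s2 \<and> lnk x' p p' \<and> x' g = y g"
    using reach_5[OF x1(1) x2(1) x3(1) x5(1,2)] x3(4) y'(4) by metis
qed

text \<open>The link end \<open>p\<close> and the \<open>q\<close>-token \<open>e\<close> are both
  turned into \<open>o'\<close>-tokens before the link can enter \<open>{p, e}\<close>. For this the
  link goes to \<open>{u, v}\<close>, then to \<open>{e, g}\<close>, then to a third pair;
  \<open>u\<close> and \<open>v\<close> keep the colour \<open>q\<close> for the final return. The
  third pair settles one more line for free, or two with an additional flip.\<close>

lemma agree_crossed:
  assumes t: "tc A a q b o' x y" and x: "p \<in> A" "lnk x p p'"
    and e: "e \<in> A" "g \<in> A" "e \<noteq> g" "lkind x e = q" "lkind x g = q" "lkind y e = q" "lkind y p = q"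
    and u: "u \<in> A" "v \<in> A" "u \<noteq> v" "lkind x u = o'" "lkind x v = o'"
  shows "\<lbrakk>w \<in> A; w \<noteq> u; w \<noteq> v; lkind x w = o'\<rbrakk> \<Longrightarrow>
      \<exists>x'. reach A 5 x x' \<and> x' p = y p \<and> x' e = y e \<and> lnk x' u v \<and> (lkind y w = o' \<longrightarrow> x' w = y w)"
    and "\<lbrakk>w \<in> A; w \<noteq> u; w \<noteq> v; lkind x w = o'\<rbrakk> \<Longrightarrow>
      \<exists>x'. reach A 5 x x' \<and> x' p = y p \<and> x' e = y e \<and> lnk x' u v \<and> (lkind y p' = o' \<longrightarrow> x' p' = y p')"
    and "\<lbrakk>w \<in> A; w \<noteq> u; w \<noteq> v; w' \<in> A; w' \<noteq> u; w' \<noteq> v; w' \<noteq> w; lkind x w = o'; lkind x w' = o';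
        lkind y w = o'; lkind y w' = o'\<rbrakk> \<Longrightarrow>
      \<exists>x'. reach A 6 x x' \<and> x' p = y p \<and> x' e = y e \<and> lnk x' u v \<and> x' w = y w \<and> x' w' = y w'"
proof -
  note c = tc_conf[OF t(1)] and q = tc_colours(1-5)[OF t(1)]
  have p: "p' \<in> A" "p \<noteq> p'" using lnk_mem[OF c(2) x] x(2) by (auto simp: lnk_def)
  have ne1: "p \<noteq> e" "p \<noteq> g" "p \<noteq> u" "p \<noteq> v" "p' \<noteq> e" "p' \<noteq> g" "p' \<noteq> u" "p' \<noteq> v"
    "u \<noteq> e" "u \<noteq> g" "v \<noteq> e" "v \<noteq> g"
    using lnk_lkind[OF x(2)] e(4,5) u(4,5) q(3-5) by auto
  note ne = ne1 ne1[symmetric] u(3) u(3)[symmetric] e(3) e(3)[symmetric] p(2) p(2)[symmetric]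
  have ev: "even (val y e - val y p)" using even_val_diff[OF c(3) x(1) e(1,7,6) q(1)] .
  obtain x1 where x1: "step A x x1" "lnk x1 u v" "lkind x1 p = o'" "lkind x1 p' = o'" "off {p, p', u, v} x x1"
    using swap_any[OF c(2,1) x u(1-5) q(5)] by blast
  have 1: "lkind x1 e = q" "lkind x1 g = q"
    using offD(2)[OF x1(5), of e] offD(2)[OF x1(5), of g] e(4,5) ne by auto
  obtain x2 where x2: "step A x1 x2" "lnk x2 e g" "lkind x2 u = q" "lkind x2 v = q" "off {u, v, e, g} x1 x2"
    using swap_any[OF step_conf(2)[OF x1(1)] c(1) u(1) x1(2) e(1-3) 1 q(4)] by blast
  have 2: "lkind x2 p = o'" "lkind x2 p' = o'" using offD(2)[OF x2(5), of p] offD(2)[OF x2(5), of p'] x1(3,4) ne by auto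
  have o2: "lkind x2 w = o'" if "w \<in> A" "w \<noteq> u" "w \<noteq> v" "lkind x w = o'" for w
  proof -
    have "w \<noteq> p" "w \<noteq> p'" "w \<noteq> e" "w \<noteq> g" using lnk_lkind[OF x(2)] e(4,5) that(4) q(3-5) by auto
    then show ?thesis using offD(2)[OF x2(5), of w] offD(2)[OF x1(5), of w] that by auto
  qed
  \<comment> \<open>The label for \<open>e\<close> that reproduces the difference of the labels of
    \<open>y\<close>, so that the link fits on entering \<open>{p, e}\<close>.\<close>
  define m where "m = val x2 p + (val y e - val y p)"
  have m: "even m \<longleftrightarrow> o' = 1"
    using ev val_parity[OF step_conf(2)[OF x2(1)] x(1) 2(1) q(2)] by (simp add: m_def)
  have enter: "\<exists>x3. step A x2 x3 \<and> lnk x3 a1 a2 \<and> val x3 e - val x3 p = val y e - val y p \<and> lkind x3 e = o'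
      \<and> lkind x3 u = q \<and> lkind x3 v = q \<and> (p \<notin> {a1, a2} \<longrightarrow> lkind x3 p = o')"
    if a: "a1 \<in> A" "a2 \<in> A" "a1 \<noteq> a2" "lkind x2 a1 = o'" "lkind x2 a2 = o'" "p \<notin> {a1, a2}" for a1 a2
  proof -
    have an: "u \<noteq> a1" "u \<noteq> a2" "v \<noteq> a1" "v \<noteq> a2" using x2(3,4) a(4,5) q(3) by auto
    obtain x3 where x3: "step A x2 x3" "lnk x3 a1 a2" "val x3 e = m" "lkind x3 e = o'" "off {e, g, a1, a2} x2 x3"
      using swap_val[OF step_conf(2)[OF x2(1)] c(1) e(1) x2(2) a(1-5) q(2) m] by blast
    have "x3 p = x2 p" "lkind x3 p = lkind x2 p" "lkind x3 u = q" "lkind x3 v = q"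
      using offD[OF x3(5), of p] offD(2)[OF x3(5), of u] offD(2)[OF x3(5), of v] a(6) an x2(3,4) ne by auto
    then show ?thesis using x3 2(1) by (auto simp: m_def val_def)
  qed
  have leave: "\<exists>x4 x5. step A x3 x4 \<and> step A x4 x5 \<and> x5 p = y p \<and> x5 e = y e \<and> lnk x5 u v \<and> (lkind y a1 = o' \<longrightarrow> x5 a1 = y a1)
      \<and> (fits y a1 a2 x3 \<and> lkind y a1 = o' \<and> lkind y a2 = o' \<longrightarrow> x5 a2 = y a2)"
    if a: "a1 \<in> A" "a2 \<in> A" and x3: "conf A x3" "lnk x3 a1 a2" "val x3 e - val x3 p = val y e - val y p" "lkind x3 e = o'"
      "lkind x3 p = o'" "lkind x3 u = q" "lkind x3 v = q" for x3 a1 a2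
  proof -
    have an: "a1 \<noteq> p" "a1 \<noteq> e" "a1 \<noteq> u" "a1 \<noteq> v" "a2 \<noteq> p" "a2 \<noteq> e" "a2 \<noteq> u" "a2 \<noteq> v"
      using lnk_lkind[OF x3(2)] x3(4-7) q(4,5) by auto
    have fin: "\<exists>x5. step A x4 x5 \<and> x5 p = y p \<and> x5 e = y e \<and> lnk x5 u v \<and> x5 a1 = x4 a1 \<and> x5 a2 = x4 a2"
      if x4: "step A x3 x4" "fits y p e x4" "off {a1, a2, p, e} x3 x4" for x4
    proof -
      have "lkind x4 u = q" "lkind x4 v = q" using offD(2)[OF x4(3), of u] offD(2)[OF x4(3), of v] x3(6,7) an ne by auto
      then obtain x5 where x5: "step A x4 x5" "lnk x5 u v" "x5 p = y p" "x5 e = y e" "off {p, e, u, v} x4 x5"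
        using release[OF step_conf(2)[OF x4(1)] c(1) x(1) x4(2) u(1-3) _ _ q(1) c(3) x(1) e(1,7,6)] by blast
      then show ?thesis using offD(1)[OF x5(5), of a1] offD(1)[OF x5(5), of a2] an by auto
    qed
    show ?thesis
    proof (cases "lkind y a1 = o'")
      case True
      obtain x4 where x4: "step A x3 x4" "fits y p e x4" "x4 a1 = y a1" "off {a1, a2, p, e} x3 x4"
          "fits y a1 a2 x3 \<and> a2 \<in> A \<and> lkind y a2 = o' \<longrightarrow> x4 a2 = y a2"
        using swap_fit[OF x3(1) c(1) a(1) x3(2) x(1) e(1) ne1(1) x3(5,4) q(2) x3(3) ev c(3) a(1) True] by blast
      then show ?thesis using fin[OF x4(1,2,4)] a(2) by metis
    next
      case False
      obtain z where z: "conf {a1} z" "lkind z a1 = o'" using lkind_dummy[OF q(2)] by blast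
      obtain x4 where x4: "step A x3 x4" "fits y p e x4" "off {a1, a2, p, e} x3 x4"
        using swap_fit[OF x3(1) c(1) a(1) x3(2) x(1) e(1) ne1(1) x3(5,4) q(2) x3(3) ev z(1) _ z(2)] by blast
      then show ?thesis using fin[OF x4] False by blast
    qed
  qed
  have two: "\<exists>x'. reach A 5 x x' \<and> x' p = y p \<and> x' e = y e \<and> lnk x' u v \<and> (lkind y a1 = o' \<longrightarrow> x' a1 = y a1)"
    if a: "a1 \<in> A" "a2 \<in> A" "a1 \<noteq> a2" "lkind x2 a1 = o'" "lkind x2 a2 = o'" "p \<notin> {a1, a2}" for a1 a2
  proof -
    obtain x3 where x3: "step A x2 x3" "lnk x3 a1 a2" "val x3 e - val x3 p = val y e - val y p" "lkind x3 e = o'"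
      "lkind x3 p = o'" "lkind x3 u = q" "lkind x3 v = q" using enter[OF a] a(6) by blast
    obtain x4 x5 where "step A x3 x4" "step A x4 x5" "x5 p = y p" "x5 e = y e" "lnk x5 u v" "lkind y a1 = o' \<longrightarrow> x5 a1 = y a1"
      using leave[OF a(1,2) step_conf(2)[OF x3(1)] x3(2-7)] by blast
    then show ?thesis using reach_5[OF x1(1) x2(1) x3(1)] by blast
  qed
  have pw: "p \<notin> {w, p'}" if "lkind x w = o'" for w
    using that lnk_lkind(1)[OF x(2)] p(2) q(5) by auto
  show "\<exists>x'. reach A 5 x x' \<and> x' p = y p \<and> x' e = y e \<and> lnk x' u v \<and> (lkind y w = o' \<longrightarrow> x' w = y w)"
    if w: "w \<in> A" "w \<noteq> u" "w \<noteq> v" "lkind x w = o'"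
    using two[OF w(1) p(1) _ o2[OF w] 2(2) pw[OF w(4)]] lnk_lkind(2)[OF x(2)] w(4) q(5) by fastforce
  show "\<exists>x'. reach A 5 x x' \<and> x' p = y p \<and> x' e = y e \<and> lnk x' u v \<and> (lkind y p' = o' \<longrightarrow> x' p' = y p')"
    if w: "w \<in> A" "w \<noteq> u" "w \<noteq> v" "lkind x w = o'"
  proof -
    have "p' \<noteq> w" "p \<notin> {p', w}" using lnk_lkind(2)[OF x(2)] w(4) q(5) pw[OF w(4)] by auto
    then show ?thesis using two[OF p(1) w(1) _ 2(2) o2[OF w]] by blast
  qed
  assume w: "w \<in> A" "w \<noteq> u" "w \<noteq> v" "w' \<in> A" "w' \<noteq> u" "w' \<noteq> v" "w' \<noteq> w" "lkind x w = o'" "lkind x w' = o'"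
    "lkind y w = o'" "lkind y w' = o'"
  have k: "p \<notin> {w, w'}" "e \<notin> {w, w'}" using lnk_lkind(1)[OF x(2)] w(8,9) e(4) q(3-5) by auto
  have kw: "lkind x2 w = o'" "lkind x2 w' = o'" using o2 w by blast+
  obtain x3 where x3: "step A x2 x3" "lnk x3 w w'" "val x3 e - val x3 p = val y e - val y p" "lkind x3 e = o'"
      "lkind x3 p = o'" "lkind x3 u = q" "lkind x3 v = q"
    using enter[OF w(1,4) w(7)[symmetric] kw k(1)] k(1) by blast
  obtain x4 where x4: "step A x3 x4" "fits y w w' x4" "off {w, w'} x3 x4"
    using flip_fit[OF step_conf(2)[OF x3(1)] c(1) w(1) x3(2) even_val_diff[OF c(3) w(1,4,10,11) q(2)]] by blast
  have 4: "x4 e = x3 e" "x4 p = x3 p" "lkind x4 e = o'" "lkind x4 p = o'" "lkind x4 u = q" "lkind x4 v = q"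
    using offD[OF x4(3), of e] offD[OF x4(3), of p] offD(2)[OF x4(3), of u] offD(2)[OF x4(3), of v] k x3 w by auto
  have "val x4 e - val x4 p = val y e - val y p" using x3(3) 4(1,2) by (simp add: val_def)
  then obtain x5 x6 where x6: "step A x4 x5" "step A x5 x6" "x6 p = y p" "x6 e = y e" "lnk x6 u v" "x6 w = y w" "x6 w' = y w'"
    using leave[OF w(1,4) step_conf(2)[OF x4(1)] fits_lnk[OF x4(2)] _ 4(3-6)] x4(2) w(10,11) by blast
  then show "\<exists>x'. reach A 6 x x' \<and> x' p = y p \<and> x' e = y e \<and> lnk x' u v \<and> x' w = y w \<and> x' w' = y w'"
    using reach_6[OF x1(1) x2(1) x3(1) x4(1) x6(1,2)] by blast
qed

section \<open>Two tokens of one colour and at least three of the other\<close>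

lemma pin_first_colour:
  assumes t: "tc A 2 q b o' x y" and r: "reach A k x x'"
    and s: "s1 \<in> A" "s2 \<in> A" "s1 \<noteq> s2" "x' s1 = y s1" "x' s2 = y s2" "lkind y s1 = q" "lkind y s2 = q"
  shows "tc (A - {s1} - {s2}) 0 q b o' x' y"
    and "reach (A - {s1} - {s2}) m x' y \<Longrightarrow> k + m \<le> n \<Longrightarrow> reach A n x y"
proof -
  have t1: "tc A b o' 2 q x' y" using tc_swap[OF tc_reach[OF t r]] .
  note p1 = tc_pin[OF t1 s(1,4,6)]
  have s2: "s2 \<in> A - {s1}" using s by auto
  note p2 = tc_pin[OF p1(1) s2 s(5,7)]
  show "tc (A - {s1} - {s2}) 0 q b o' x' y" using tc_swap[OF p2(1)] by simp
  show "reach (A - {s1} - {s2}) m x' y \<Longrightarrow> k + m \<le> n \<Longrightarrow> reach A n x y"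
    using p1(2) p2(2) reach_trans_le[OF r] by blast
qed

lemma oc_any:
  assumes t: "tc A 0 q b o' x y" "3 \<le> b"
  shows "reach A (b + 3) x y"
proof -
  obtain p p' where p: "p \<in> A" "p' \<in> A" "lnk x p p'" using tc_link_ex[OF t(1)] by blast
  obtain r r' where r: "r \<in> A" "r' \<in> A" "lnk y r r'" using tc_link_ex[OF tc_sym[OF t(1)]] by blast
  show ?thesis
  proof (cases "{p, p'} = {r, r'}")
    case True
    then have "lnk y p p'" using r(3) lnk_sym[OF r(3)] p(3) by (auto simp: doubleton_eq_iff)
    then have "reach A (if b = 3 then 6 else b + 2) x y" using oc_same[OF t p] by blast
    then show ?thesis by (rule reach_mono) auto
  next
    case False
    have "reach A (if b = 3 then 5 else b + 1) x y" using oc_distinct[OF t p(1,2) r(1,2) p(3) r(3) False] .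
    then show ?thesis by (rule reach_mono) auto
  qed
qed

lemma oc_blocks:
  assumes t: "tc A 0 q 2 o' x y" and l: "g \<in> A" "lnk x g h" "r \<in> A" "lnk y r r'" and d: "{g, h} \<inter> {r, r'} = {}"
  shows "reach A 3 x y"
proof -
  have m: "h \<in> A" "r' \<in> A" using lnk_mem tc_conf[OF t] l by blast+
  have dd: "distinct [g, h, r, r']" using l d by (auto simp: lnk_def)
  then have "card {g, h, r, r'} = 4" by auto
  then have A: "A = {g, h, r, r'}"
    using card_subset_eq[of A "{g, h, r, r'}"] tc_card[OF t] tc_conf(1)[OF t] l m by auto
  have k: "lkind x r = o'" "lkind x r' = o'" "lkind y g = o'" "lkind y h = o'"
    using oc_kind[OF t l(1,2) l(3)] oc_kind[OF t l(1,2) m(2)] oc_kind[OF tc_sym[OF t] l(3,4) l(1)]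
      oc_kind[OF tc_sym[OF t] l(3,4) m(1)] dd by auto
  show ?thesis using blocks_other[OF t A dd l(2,4) k] .
qed

lemma tc_pair:
  assumes "tc A 2 q b o' x y" "s1 \<in> A" "s2 \<in> A" "s1 \<noteq> s2" "lkind x s1 = q" "lkind x s2 = q" "z \<in> A" "lkind x z = q"
  shows "z = s1 \<or> z = s2"
proof -
  have "{s1, s2} = kset A x q"
    using assms tc_counts(1)[OF assms(1)] tc_conf(1)[OF assms(1)] by (intro card_subset_eq) (auto simp: kset_iff)
  then show ?thesis using assms(7,8) kset_iff[of z A x q] by auto
qed

text \<open>Once the two lines of colour \<open>q\<close> are final, one colour remains. The three
  bounds are for an arbitrary position of the link, for a pair different from that of
  \<open>y\<close>, and for a pair sharing one line with it.\<close>

lemma finish_first: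
  assumes t: "tc A 2 q b o' x y" "3 \<le> b" and r: "reach A k x x'"
    and s: "s1 \<in> A" "s2 \<in> A" "s1 \<noteq> s2" "x' s1 = y s1" "x' s2 = y s2" "lkind y s1 = q" "lkind y s2 = q"
  shows "k + (b + 3) \<le> n \<Longrightarrow> reach A n x y"
    and "\<lbrakk>g \<in> A; lnk x' g h; v \<in> A; lnk y v w; {g, h} \<noteq> {v, w}; k + (if b = 3 then 5 else b + 1) \<le> n\<rbrakk> \<Longrightarrow> reach A n x y"
    and "\<lbrakk>g \<in> A; lnk x' g h; h \<in> A; lnk y h w; g \<noteq> w; k + (b + 1) \<le> n\<rbrakk> \<Longrightarrow> reach A n x y"
proof -
  note p = pin_first_colour[OF t(1) r s]
  show "k + (b + 3) \<le> n \<Longrightarrow> reach A n x y" using p(2)[OF oc_any[OF p(1) t(2)]] .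
  have k: "lkind x' s1 = q" "lkind x' s2 = q" using lkind_cong[of x' s1 y] lkind_cong[of x' s2 y] s(4-7) by auto
  have q: "q < 3" using tc_colours[OF t(1)] by blast
  have m: "z \<in> A - {s1} - {s2} \<and> z' \<in> A - {s1} - {s2}"
    if "z \<in> A" "lnk x' z z' \<or> lnk y z z'" for z z'
  proof -
    have "z' \<in> A" using that lnk_mem[of A x' z z'] lnk_mem[of A y z z'] reach_conf[OF r] tc_conf(3)[OF t(1)] by blast
    moreover have "z \<noteq> s1" "z \<noteq> s2" "z' \<noteq> s1" "z' \<noteq> s2"
      using that(2) lnk_lkind[of x' z z'] lnk_lkind[of y z z'] k s(6,7) q by auto
    ultimately show ?thesis using that(1) by blast
  qed
  show "reach A n x y"
    if "g \<in> A" "lnk x' g h" "v \<in> A" "lnk y v w" "{g, h} \<noteq> {v, w}" "k + (if b = 3 then 5 else b + 1) \<le> n"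
    using p(2)[OF oc_distinct[OF p(1) t(2) _ _ _ _ that(2,4,5)] that(6)] m[OF that(1)] m[OF that(3)] that(2,4) by blast
  show "reach A n x y"
    if "g \<in> A" "lnk x' g h" "h \<in> A" "lnk y h w" "g \<noteq> w" "k + (b + 1) \<le> n"
    using p(2)[OF oc_share[OF p(1) t(2) _ _ _ that(2,4,5)] that(6)] m[OF that(1)] m[OF that(3)] that(2,4) by blast
qed

lemma finish_first_pinned:
  assumes t: "tc A 2 q b o' x y" and r: "reach A k x x'"
    and s: "s1 \<in> A" "s2 \<in> A" "s1 \<noteq> s2" "x' s1 = y s1" "x' s2 = y s2" "lkind y s1 = q" "lkind y s2 = q"
    and z: "z \<in> A" "x' z = y z" "lkind y z = o'"
  shows "tc (A - {s1} - {s2} - {z}) 0 q (b - 1) o' x' y"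
    and "reach (A - {s1} - {s2} - {z}) m x' y \<Longrightarrow> k + m \<le> n \<Longrightarrow> reach A n x y"
    and "\<lbrakk>v \<in> A; lnk x' v w \<or> lnk y v w\<rbrakk> \<Longrightarrow> v \<in> A - {s1} - {s2} - {z} \<and> w \<in> A - {s1} - {s2} - {z}"
proof -
  note p = pin_first_colour[OF t(1) r s]
  have zB: "z \<in> A - {s1} - {s2}" using z(1,3) s(6,7) tc_colours(3)[OF t] by auto
  note d = tc_pin[OF p(1) zB z(2,3)]
  show "tc (A - {s1} - {s2} - {z}) 0 q (b - 1) o' x' y" using d(1) .
  show "reach (A - {s1} - {s2} - {z}) m x' y \<Longrightarrow> k + m \<le> n \<Longrightarrow> reach A n x y" using p(2) d(2) by blast
  have k: "lkind x' s1 = q" "lkind x' s2 = q" "lkind x' z = o'"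
    using lkind_cong[of x' s1 y] lkind_cong[of x' s2 y] lkind_cong[of x' z y] s(4-7) z(2,3) by auto
  have q: "q < 3" "o' < 3" using tc_colours[OF t(1)] by blast+
  show "v \<in> A - {s1} - {s2} - {z} \<and> w \<in> A - {s1} - {s2} - {z}" if "v \<in> A" "lnk x' v w \<or> lnk y v w"
  proof -
    have "w \<in> A" using that lnk_mem[of A x' v w] lnk_mem[of A y v w] reach_conf[OF r] tc_conf(3)[OF t(1)] by blast
    moreover have "v \<noteq> s1" "v \<noteq> s2" "w \<noteq> s1" "w \<noteq> s2" "v \<noteq> z" "w \<noteq> z"
      using that(2) lnk_lkind[of x' v w] lnk_lkind[of y v w] k s(6,7) z(3) q by auto
    ultimately show ?thesis using that(1) by blast
  qed
qed

text \<open>Only two moves are spent on the first colour, so the crude bound \<open>b + 3\<close>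
  suffices for the rest.\<close>

lemma case_on_link:
  assumes t: "tc A 2 q b o' x y" "3 \<le> b" and p: "p \<in> A" "lnk x p p'" and k: "lkind y p = q" "lkind y p' = q"
  shows "reach A (b + 5) x y"
proof -
  have p': "p' \<in> A" "p \<noteq> p'" using lnk_mem[OF tc_conf(2)[OF t(1)] p] p(2) by (auto simp: lnk_def)
  have "2 \<le> card (kset A x q)" using tc_counts(1)[OF t(1)] by simp
  then obtain e g where e: "e \<in> A" "g \<in> A" "lkind x e = q" "lkind x g = q" "e \<noteq> g" using two_kind by blast
  obtain x' where x': "reach A 2 x x'" "x' p = y p" "x' p' = y p'"
    using agree_on_link[OF t(1) p(1) p'(1) p(2) k e(1,2,5,3,4)] by blast
  show ?thesis using finish_first(1)[OF t x'(1) p(1) p' x'(2,3) k] by simp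
qed

lemma case_off_link:
  assumes t: "tc A 2 q b o' x y" "3 \<le> b" and p: "p \<in> A" "lnk x p p'" and r: "r \<in> A" "lnk y r r'"
    and s: "s1 \<in> A" "s2 \<in> A" "s1 \<noteq> s2" "lkind y s1 = q" "lkind y s2 = q"
    and k: "lkind x s1 = o' \<or> s1 = p" "lkind x s2 = o'"
  shows "reach A (b + 5) x y"
proof -
  have "2 \<le> card (kset A x q)" using tc_counts(1)[OF t(1)] by simp
  then obtain e g where e: "e \<in> A" "g \<in> A" "lkind x e = q" "lkind x g = q" "e \<noteq> g" using two_kind by blast
  obtain x' where x': "reach A 3 x x'" "x' s1 = y s1" "x' s2 = y s2" "lnk x' e g"
    using k(1)
  proof
    assume "lkind x s1 = o'"
    then show thesis using agree_other_colour[OF t(1) p s(1-3) _ k(2) s(4,5) e(1,2,5,3,4)] that by blast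
  next
    assume "s1 = p"
    then show thesis using agree_link_and_other[OF t p s(2) k(2) _ s(5) e(1,2,5,3,4)] s(4) that by blast
  qed
  show ?thesis
  proof (cases "{e, g} = {r, r'}")
    case True
    \<comment> \<open>The link has landed on the pair of \<open>y\<close>. Then both ends of the
      link of \<open>y\<close> carry \<open>q\<close>-tokens in \<open>x\<close>, and the way back
      is covered by \<open>case_on_link\<close>.\<close>
    then have "lkind x r = q" "lkind x r' = q" using e by (auto simp: doubleton_eq_iff)
    then show ?thesis using reach_sym[OF case_on_link[OF tc_sym[OF t(1)] t(2) r]] by blast
  next
    case False
    show ?thesis
      by (rule finish_first(2)[OF t x'(1) s(1-3) x'(2,3) s(4,5) e(1) x'(4) r False]) (use t(2) in auto)
  qed
qed

lemma case_same_lines: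
  assumes t: "tc A 2 q b o' x y" "3 \<le> b" and p: "p \<in> A" "lnk x p p'" and r: "r \<in> A" "lnk y r r'" "{p, p'} \<noteq> {r, r'}"
    and s: "s1 \<in> A" "s2 \<in> A" "s1 \<noteq> s2" "lkind y s1 = q" "lkind y s2 = q" "lkind x s1 = q" "lkind x s2 = q"
  shows "reach A (b + 5) x y"
proof -
  obtain x' where x': "reach A 3 x x'" "x' s1 = y s1" "x' s2 = y s2" "lnk x' p p'"
    using agree_same[OF t(1) p s(1-3,6,7,4,5)] by blast
  show ?thesis
    by (rule finish_first(2)[OF t x'(1) s(1-3) x'(2,3) s(4,5) p(1) x'(4) r]) (use t(2) in auto)
qed

text \<open>For \<open>b = 3\<close> and disjoint links, the four moves of
  \<open>agree_mixed\<close> and the five of \<open>oc_disjoint\<close> exceed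
  \<open>b + 5 = 8\<close> by one. Therefore one of the seven lines is settled in addition, so that
  only four lines remain and three moves finish.\<close>

lemma case_mixed:
  assumes t: "tc A 2 q b o' x y" "3 \<le> b" and p: "p \<in> A" "lnk x p p'" and r: "r \<in> A" "lnk y r r'" "{p, p'} \<noteq> {r, r'}"
    and s: "s1 \<in> A" "s2 \<in> A" "s1 \<noteq> s2" "lkind y s1 = q" "lkind y s2 = q" "lkind x s1 = q" "lkind x s2 = o'"
  shows "reach A (b + 5) x y"
proof -
  note c = tc_conf[OF t(1)] and q = tc_colours(1-5)[OF t(1)]
  have m: "p' \<in> A" "r' \<in> A" using lnk_mem c p r by blast+
  obtain g where g: "g \<in> A" "lkind x g = q" "s1 \<noteq> g"
    using other_kind[of A x q s1] tc_counts(1)[OF t(1)] by force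
  have "card {s2} < card (kset A x o')" using tc_counts(2)[OF t(1)] t(2) by simp
  then obtain u where u: "u \<in> A" "lkind x u = o'" "u \<noteq> s2" using others_of[of "{s2}" "kset A x o'"] by (auto simp: kset_iff)
  have "card {s2, u} < card (kset A x o')" using tc_counts(2)[OF t(1)] t(2) card_insert_le_m1[of 2 "{u}" s2] by simp
  then obtain v where v: "v \<in> A" "lkind x v = o'" "v \<noteq> s2" "u \<noteq> v"
    using others_of[of "{s2, u}" "kset A x o'"] by (auto simp: kset_iff)
  note mix = agree_mixed[OF t(1) p s(1) g(1,3) s(6) g(2) s(2,7,4,5)]
  show ?thesis
  proof (cases "b = 3")
    case False
    obtain x' where x': "reach A 4 x x'" "x' s1 = y s1" "x' s2 = y s2" "lnk x' p p'"
      using mix(1)[OF u(1) v(1,4) u(3) v(3) u(2) v(2)] by blast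
    show ?thesis
      by (rule finish_first(2)[OF t x'(1) s(1-3) x'(2,3) s(4,5) p(1) x'(4) r]) (use t(2) False in auto)
  next
    case b: True
    show ?thesis
    proof (cases "{p, p'} \<inter> {r, r'} = {}")
      case False
      obtain x' where x': "reach A 4 x x'" "x' s1 = y s1" "x' s2 = y s2" "lnk x' p p'"
        using mix(1)[OF u(1) v(1,4) u(3) v(3) u(2) v(2)] by blast
      have n: "4 + (b + 1) \<le> b + 5" by simp
      note fin = finish_first(3)[OF t x'(1) s(1-3) x'(2,3) s(4,5) _ _ _ _ _ n]
      consider "p = r" "p' \<noteq> r'" | "p = r'" "p' \<noteq> r" | "p' = r" "p \<noteq> r'" | "p' = r'" "p \<noteq> r"
        using False r(3) by blast
      then show ?thesis
      proof cases
        case 1 then show ?thesis using fin[OF m(1) lnk_sym[OF x'(4)] p(1)] r(2) by blast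
      next
        case 2 then show ?thesis using fin[OF m(1) lnk_sym[OF x'(4)] p(1)] lnk_sym[OF r(2)] by blast
      next
        case 3 then show ?thesis using fin[OF p(1) x'(4) m(1)] r(2) by blast
      next
        case 4 then show ?thesis using fin[OF p(1) x'(4) m(1)] lnk_sym[OF r(2)] by blast
      qed
    next
      case disj: True
      have pp: "p \<noteq> p'" "r \<noteq> r'" using p r by (auto simp: lnk_def)
      have nk: "s1 \<notin> {p, p'}" "s2 \<notin> {p, p'}" "g \<notin> {p, p'}" "u \<notin> {p, p'}" "v \<notin> {p, p'}" "s1 \<noteq> s2" "g \<noteq> s2" "u \<noteq> s1" "v \<noteq> s1" "u \<noteq> g" "v \<noteq> g"
        using lnk_lkind[OF p(2)] s(6,7) g(2) u(2) v(2) q(3-5) by auto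
      have nr: "s1 \<notin> {r, r'}" "s2 \<notin> {r, r'}" using lnk_lkind[OF r(2)] s(4,5) q(4) by auto
      have "card {p, p', s1, g, s2, u, v} = 7" using nk pp g(3) u(3) v(3,4) by auto
      then have A: "A = {p, p', s1, g, s2, u, v}"
        using card_subset_eq[of A "{p, p', s1, g, s2, u, v}"] tc_card[OF t(1)] b c(1) p(1) m(1) s(1,2) g(1) u(1) v(1) by auto
      have yk: "lkind y z = o'" if "z \<in> A" "z \<notin> {s1, s2, r, r'}" for z
        using tc_kinds[OF tc_sym[OF t(1)] that(1)] tc_links[OF tc_sym[OF t(1)] r(1,2) that(1)]
          tc_pair[OF tc_sym[OF t(1)] s(1-5) that(1)] that(2) by blast
      have rr: "r \<in> {g, u, v}" "r' \<in> {g, u, v}" using r(1) m(2) A disj nr by auto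
      \<comment> \<open>At most five moves settle three lines, and three moves settle the last four:
        \<open>5 + 3 = b + 5\<close>.\<close>
      have close: "reach A (b + 5) x y"
        if x': "reach A n x x'" "n \<le> 5" "x' s1 = y s1" "x' s2 = y s2" "lnk x' p p'" "x' z = y z"
          and z: "z \<in> A" "z \<notin> {s1, s2, r, r'}" for n x' z
      proof -
        note f = finish_first_pinned[OF t(1) x'(1) s(1-3) x'(3,4) s(4,5) z(1) x'(6) yk[OF z]]
        have "b - 1 = 2" using b by simp
        then have t2: "tc (A - {s1} - {s2} - {z}) 0 q 2 o' x' y" using f(1) by simp
        have "reach (A - {s1} - {s2} - {z}) 3 x' y"
          using oc_blocks[OF t2 _ x'(5) _ r(2) disj] f(3)[OF p(1)] f(3)[OF r(1)] x'(5) r(2) by blast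
        then show ?thesis by (rule f(2)) (use x'(2) b in simp)
      qed
      show ?thesis
      proof (cases "g \<in> {r, r'}")
        case False
        then have z: "g \<notin> {s1, s2, r, r'}" using g(3) nk by auto
        obtain x' where "reach A 5 x x'" "x' s1 = y s1" "x' s2 = y s2" "lnk x' p p'" "x' g = y g"
          using mix(2)[OF u(1) v(1,4) u(3) v(3) u(2) v(2) yk[OF g(1) z]] by blast
        then show ?thesis using close[of 5 x' g] g(1) z by blast
      next
        case True
        \<comment> \<open>If \<open>g\<close> ends the link of \<open>y\<close>, at most one of
          \<open>u\<close>, \<open>v\<close> is its other end; the remaining one is settled at no
          cost.\<close>
        have "u \<notin> {r, r'} \<or> v \<notin> {r, r'}" using True nk v(4) by auto
        then show ?thesis
        proof
          assume "u \<notin> {r, r'}"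
          then have z: "u \<notin> {s1, s2, r, r'}" using u(3) nk by auto
          obtain x' where "reach A 4 x x'" "x' s1 = y s1" "x' s2 = y s2" "lnk x' p p'" "x' u = y u"
            using mix(1)[OF u(1) v(1,4) u(3) v(3) u(2) v(2)] yk[OF u(1) z] by blast
          then show ?thesis using close[of 4 x' u] u(1) z by simp
        next
          assume "v \<notin> {r, r'}"
          then have z: "v \<notin> {s1, s2, r, r'}" using v(3) nk by auto
          obtain x' where "reach A 4 x x'" "x' s1 = y s1" "x' s2 = y s2" "lnk x' p p'" "x' v = y v"
            using mix(1)[OF v(1) u(1) v(4)[symmetric] v(3) u(3) v(2) u(2)] yk[OF v(1) z] by blast
          then show ?thesis using close[of 4 x' v] v(1) z by simp
        qed
      qed
    qed
  qed
qed

text \<open>If the other \<open>q\<close>-token \<open>g\<close> of \<open>x\<close> is an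
  \<open>o'\<close>-token of \<open>y\<close>, the way back is \<open>case_mixed\<close>. Otherwise
  \<open>g\<close> ends the link of \<open>y\<close>, and \<open>agree_crossed\<close> must settle
  \<open>p\<close>, \<open>e\<close> and a further line, chosen so that the link stops in a
  favourable position.\<close>

lemma case_crossed:
  assumes t: "tc A 2 q b o' x y" "3 \<le> b" and p: "p \<in> A" "lnk x p p'" and r: "r \<in> A" "lnk y r r'" "{p, p'} \<noteq> {r, r'}"
    and e: "e \<in> A" "lkind y e = q" "lkind y p = q" "lkind x e = q"
  shows "reach A (b + 5) x y"
proof -
  note c = tc_conf[OF t(1)] and q = tc_colours(1-5)[OF t(1)]
  have m: "p' \<in> A" "r' \<in> A" using lnk_mem c p r by blast+
  obtain g where g: "g \<in> A" "lkind x g = q" "g \<noteq> e"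
    using other_kind[of A x q e] tc_counts(1)[OF t(1)] by force
  have pe: "p \<noteq> e" "p \<noteq> g" "p' \<noteq> e" "p' \<noteq> g" "p \<noteq> p'" using lnk_lkind[OF p(2)] e(4) g(2) q(4) p(2) by (auto simp: lnk_def)
  have Ey: "z = p \<or> z = e" if "z \<in> A" "lkind y z = q" for z
    using tc_pair[OF tc_sym[OF t(1)] p(1) e(1) pe(1) e(3,2) that] .
  consider "lkind y g = o'" | "lkind y g = 3"
    using tc_kinds[OF tc_sym[OF t(1)] g(1)] Ey[OF g(1)] g(3) pe(2) by blast
  then show ?thesis
  proof cases
    case 1
    have "reach A (b + 5) y x"
      using case_mixed[OF tc_sym[OF t(1)] t(2) r(1,2) p r(3)[symmetric] e(1) g(1) g(3)[symmetric] e(4) g(2) e(2) 1] .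
    then show ?thesis using reach_sym by blast
  next
    case 2
    obtain z where z: "lnk y g z" "z \<in> A" using lkind3_lnk[OF c(3) g(1) 2] by blast
    have kz: "lkind y z = 3" "g \<noteq> z" using lnk_lkind[OF z(1)] z(1) by (auto simp: lnk_def)
    have zpe: "z \<noteq> p" "z \<noteq> e" using kz e(2,3) q(4) by auto
    have yk: "lkind y v = o'" if "v \<in> A" "v \<notin> {p, e, g, z}" for v
      using tc_kinds[OF tc_sym[OF t(1)] that(1)] tc_links[OF tc_sym[OF t(1)] g(1) z(1) that(1)] Ey[OF that(1)] that(2) by blast
    have ne: "v \<notin> {p, p', e, g}" if "lkind x v = o'" for v
      using that lnk_lkind[OF p(2)] e(4) g(2) q(3-5) by auto
    \<comment> \<open>For \<open>b = 3\<close> four lines remain and cost three moves. For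
      \<open>5 \<le> b\<close> the remaining \<open>b - 1\<close> tokens exceed three and cost
      \<open>b\<close> moves. For \<open>b = 4\<close> exactly three tokens would remain, the
      expensive value of \<open>oc_distinct\<close>.\<close>
    have close: "reach A (b + 5) x y"
      if x': "reach A 5 x x'" "x' p = y p" "x' e = y e" "lnk x' u v" "u \<in> A" "{u, v} \<inter> {g, z} = {}"
        and w: "w \<in> A" "x' w = y w" "lkind y w = o'" and b: "b \<noteq> 4" for x' u v w
    proof -
      note f = finish_first_pinned[OF t(1) x'(1) p(1) e(1) pe(1) x'(2,3) e(3,2) w]
      let ?B = "A - {p} - {e} - {w}"
      have mm: "u \<in> ?B" "v \<in> ?B" "g \<in> ?B" "z \<in> ?B" using f(3)[OF x'(5)] x'(4) f(3)[OF g(1)] z(1) by blast+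
      show ?thesis
      proof (cases "b = 3")
        case True
        then have "b - 1 = 2" by simp
        then have t2: "tc ?B 0 q 2 o' x' y" using f(1) by simp
        show ?thesis using f(2)[OF oc_blocks[OF t2 mm(1) x'(4) mm(3) z(1) x'(6)]] True by simp
      next
        case False
        then have b5: "3 \<le> b - 1" "b - 1 \<noteq> 3" "5 \<le> b" using b t(2) by arith+
        have "{u, v} \<noteq> {g, z}" using x'(6) by auto
        then have "reach ?B (if b - 1 = 3 then 5 else b - 1 + 1) x' y"
          by (rule oc_distinct[OF f(1) b5(1) mm x'(4) z(1)])
        then show ?thesis by (rule f(2)) (use b5 in auto)
      qed
    qed
    have zk: "z = p' \<or> lkind x z = o'"
      using tc_kinds[OF t(1) z(2)] tc_links[OF t(1) p z(2)] tc_pair[OF t(1) e(1) g(1) g(3)[symmetric] e(4) g(2) z(2)] kz(2) zpe by blast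
    have "3 \<le> card (kset A x o')" using tc_counts(2)[OF t(1)] t(2) by simp
    then obtain u v w where u: "u \<in> A" "v \<in> A" "w \<in> A" "lkind x u = o'" "lkind x v = o'" "lkind x w = o'"
      "u \<noteq> v" "u \<noteq> w" "v \<noteq> w" using three_kind by blast
    note cross = agree_crossed[OF t(1) p e(1) g(1) g(3)[symmetric] e(4) g(2) e(2,3)]
    from zk show ?thesis
    proof
      assume zp: "z = p'"
      have yo: "lkind y v = o'" if "v \<in> A" "lkind x v = o'" for v using yk[OF that(1)] ne[OF that(2)] zp by blast
      have dz: "{u, v} \<inter> {g, z} = {}" using ne[OF u(4)] ne[OF u(5)] zp by auto
      show ?thesis
      proof (cases "b = 4")
        case False
        obtain x' where "reach A 5 x x'" "x' p = y p" "x' e = y e" "lnk x' u v" "x' w = y w"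
          using cross(1)[OF u(1,2,7,4,5,3) u(8,9)[symmetric] u(6)] yo[OF u(3,6)] by blast
        then show ?thesis using close[OF _ _ _ _ u(1) dz u(3) _ yo[OF u(3,6)] False] by blast
      next
        case True
        \<comment> \<open>For \<open>b = 4\<close> a sixth move settles a second line, and four
          lines remain: \<open>6 + 3 = b + 5\<close>.\<close>
        have "card {u, v, w} < card (kset A x o')" using tc_counts(2)[OF t(1)] True u(7-9) by simp
        then obtain w' where w': "w' \<in> A" "lkind x w' = o'" "w' \<noteq> u" "w' \<noteq> v" "w' \<noteq> w"
          using others_of[of "{u, v, w}" "kset A x o'"] by (auto simp: kset_iff)
        obtain x' where x': "reach A 6 x x'" "x' p = y p" "x' e = y e" "lnk x' u v" "x' w = y w" "x' w' = y w'"
          using cross(3)[OF u(1,2,7,4,5,3) u(8,9)[symmetric] w'(1,3,4,5) u(6) w'(2) yo[OF u(3,6)] yo[OF w'(1,2)]] by blast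
        note f = finish_first_pinned[OF t(1) x'(1) p(1) e(1) pe(1) x'(2,3) e(3,2) u(3) x'(5) yo[OF u(3,6)]]
        let ?B = "A - {p} - {e} - {w}"
        have mm: "u \<in> ?B" "v \<in> ?B" "g \<in> ?B" "z \<in> ?B" using f(3)[OF u(1)] x'(4) f(3)[OF g(1)] z(1) by blast+
        have w'B: "w' \<in> ?B" using w' ne[OF w'(2)] by auto
        note d = tc_pin[OF f(1) w'B x'(6) yo[OF w'(1,2)]]
        have "b - 1 - 1 = 2" using True by simp
        then have t2: "tc (?B - {w'}) 0 q 2 o' x' y" using d(1) by simp
        have "u \<in> ?B - {w'}" "g \<in> ?B - {w'}" using mm w' ne[OF w'(2)] by auto
        then have "reach (?B - {w'}) 3 x' y" using oc_blocks[OF t2 _ x'(4) _ z(1) dz] by blast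
        then have "reach ?B 3 x' y" by (rule d(2))
        then show ?thesis by (rule f(2)) (use True in simp)
      qed
    next
      assume zo: "lkind x z = o'"
      have zp: "z \<notin> {p, p', e, g}" using ne[OF zo] .
      have p'o: "lkind y p' = o'" using yk[OF m(1)] pe zp by auto
      have "card {z} < card (kset A x o')" using tc_counts(2)[OF t(1)] t(2) by simp
      then obtain v1 where v1: "v1 \<in> A" "lkind x v1 = o'" "v1 \<noteq> z"
        using others_of[of "{z}" "kset A x o'"] by (auto simp: kset_iff)
      have "card {z, v1} < card (kset A x o')" using tc_counts(2)[OF t(1)] t(2) v1(3) by simp
      then obtain v2 where v2: "v2 \<in> A" "lkind x v2 = o'" "v2 \<noteq> z" "v2 \<noteq> v1"
        using others_of[of "{z, v1}" "kset A x o'"] by (auto simp: kset_iff)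
      show ?thesis
      proof (cases "b = 3")
        case True
        have d: "{v1, v2} \<inter> {g, z} = {}" using ne[OF v1(2)] ne[OF v2(2)] v1(3) v2(3) by auto
        \<comment> \<open>For \<open>b = 3\<close> there is no fourth \<open>o'\<close>-token to
          settle; the old link end \<open>p'\<close> takes its place.\<close>
        obtain x' where "reach A 5 x x'" "x' p = y p" "x' e = y e" "lnk x' v1 v2" "x' p' = y p'"
          using cross(2)[OF v1(1) v2(1) v2(4)[symmetric] v1(2) v2(2) z(2) v1(3)[symmetric] v2(3)[symmetric] zo] p'o by blast
        then show ?thesis using close[OF _ _ _ _ v1(1) d m(1) _ p'o] True by simp
      next
        case False
        have yo: "lkind y v2 = o'" using yk[OF v2(1)] ne[OF v2(2)] v2(3) by auto
        \<comment> \<open>The link stops at \<open>{z, v1}\<close> and shares only \<open>z\<close>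
          with the link of \<open>y\<close>, which is the cheap position.\<close>
        obtain x' where x': "reach A 5 x x'" "x' p = y p" "x' e = y e" "lnk x' z v1" "x' v2 = y v2"
          using cross(1)[OF z(2) v1(1) v1(3)[symmetric] zo v1(2) v2(1,3,4,2)] yo by blast
        note f = finish_first_pinned[OF t(1) x'(1) p(1) e(1) pe(1) x'(2,3) e(3,2) v2(1) x'(5) yo]
        let ?B = "A - {p} - {e} - {v2}"
        have mm: "z \<in> ?B" "v1 \<in> ?B" "g \<in> ?B" using f(3)[OF z(2)] x'(4) f(3)[OF g(1)] z(1) by blast+
        have b4: "3 \<le> b - 1" using False t(2) by arith
        have "v1 \<noteq> g" using ne[OF v1(2)] by auto
        then have "reach ?B (b - 1 + 1) x' y"
          by (rule oc_share[OF f(1) b4 mm(2,1,3) lnk_sym[OF x'(4)] lnk_sym[OF z(1)]])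
        then show ?thesis by (rule f(2)) (use t(2) in simp)
      qed
    qed
  qed
qed

text \<open>The kinds in \<open>x\<close> of the two lines that carry the colour \<open>q\<close> in
  \<open>y\<close> decide between the preceding cases, up to exchanging these lines and the ends of
  the link.\<close>

lemma two_and_many:
  assumes t: "tc A 2 q b o' x y" "3 \<le> b" and p: "p \<in> A" "lnk x p p'" and r: "r \<in> A" "lnk y r r'" "{p, p'} \<noteq> {r, r'}"
  shows "reach A (b + 5) x y"
proof -
  have p': "p' \<in> A" "p \<noteq> p'" using lnk_mem[OF tc_conf(2)[OF t(1)] p] p(2) by (auto simp: lnk_def)
  have "2 \<le> card (kset A y q)" using tc_counts(1)[OF tc_sym[OF t(1)]] by simp
  then obtain s1 s2 where s: "s1 \<in> A" "s2 \<in> A" "lkind y s1 = q" "lkind y s2 = q" "s1 \<noteq> s2" using two_kind by blast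
  have go: "reach A (b + 5) x y"
    if s: "s1 \<in> A" "s2 \<in> A" "s1 \<noteq> s2" "lkind y s1 = q" "lkind y s2 = q"
      and k: "lkind x s1 = q \<or> lkind x s1 = 3 \<and> lkind x s2 \<noteq> q \<or> lkind x s1 = o' \<and> lkind x s2 = o'" for s1 s2
  proof -
    have link: "s = p \<or> s = p'" if "s \<in> A" "lkind x s = 3" for s using tc_links[OF t(1) p that(1)] that(2) by blast
    have p'l: "lnk x p' p" "{p', p} \<noteq> {r, r'}" using lnk_sym[OF p(2)] r(3) by auto
    consider (a) "lkind x s1 = q" "lkind x s2 = q" | (f) "lkind x s1 = q" "lkind x s2 = o'" | (g) "lkind x s1 = q" "lkind x s2 = 3"
      | (c) "lkind x s1 = 3" "lkind x s2 = 3" | (e) "lkind x s1 = 3" "lkind x s2 = o'" | (d) "lkind x s1 = o'" "lkind x s2 = o'"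
      using k tc_kinds[OF t(1) s(2)] by blast
    then show ?thesis
    proof cases
      case a then show ?thesis using case_same_lines[OF t p r s] by blast
    next
      case f then show ?thesis using case_mixed[OF t p r s] by blast
    next
      case g
      from link[OF s(2) g(2)] show ?thesis
      proof
        assume "s2 = p" then show ?thesis using case_crossed[OF t p r s(1,4) _ g(1)] s(5) by blast
      next
        assume "s2 = p'" then show ?thesis using case_crossed[OF t p'(1) p'l(1) r(1,2) p'l(2) s(1,4) _ g(1)] s(5) by blast
      qed
    next
      case c
      from link[OF s(1) c(1)] link[OF s(2) c(2)] s(3) have "lkind y p = q \<and> lkind y p' = q" using s(4,5) by blast
      then show ?thesis using case_on_link[OF t p] by blast
    next
      case e
      from link[OF s(1) e(1)] show ?thesis
      proof
        assume "s1 = p" then show ?thesis using case_off_link[OF t p r(1,2) s _ e(2)] by blast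
      next
        assume "s1 = p'" then show ?thesis using case_off_link[OF t p'(1) p'l(1) r(1,2) s _ e(2)] by blast
      qed
    next
      case d then show ?thesis using case_off_link[OF t p r(1,2) s] by blast
    qed
  qed
  \<comment> \<open>For each combination of kinds one of the two orders of \<open>s1\<close>,
    \<open>s2\<close> satisfies the condition of \<open>go\<close>.\<close>
  show ?thesis
    using go[OF s(1,2,5,3,4)] go[OF s(2,1) s(5)[symmetric] s(4,3)] tc_kinds[OF t(1) s(1)] tc_kinds[OF t(1) s(2)] by blast
qed

section \<open>Both colours at least twice\<close>

lemma pin_one_colour:
  assumes t: "tc A a q b o' x y" "3 \<le> b" and p: "p \<in> A" "lnk x p p'" and yp: "lkind y p = o'"
    and r: "r \<in> A" "lnk y r r'"
  shows "\<exists>x1 u k. lnk x1 u k \<and> {u, k} \<noteq> {r, r'} \<and> u \<in> A - {p} \<and> r \<in> A - {p} \<and> tc (A - {p}) a q (b - 1) o' x1 y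
    \<and> (\<forall>n. reach (A - {p}) n x1 y \<longrightarrow> reach A (Suc n) x y)"
proof -
  note c = tc_conf[OF t(1)] and q = tc_colours(1-5)[OF t(1)]
  have "3 \<le> card (kset A x o')" using tc_counts(2)[OF t(1)] t(2) by simp
  then obtain u v w where u: "u \<in> A" "v \<in> A" "w \<in> A" "lkind x u = o'" "lkind x v = o'" "lkind x w = o'"
    "u \<noteq> v" "u \<noteq> w" "v \<noteq> w" using three_kind by blast
  have "{u, v} \<noteq> {r, r'} \<or> {u, w} \<noteq> {r, r'}" using u(7-9) by (auto simp: doubleton_eq_iff)
  then obtain k where k: "k \<in> A" "lkind x k = o'" "u \<noteq> k" "{u, k} \<noteq> {r, r'}" using u by blast
  obtain x1 where x1: "step A x x1" "lnk x1 u k" "x1 p = y p"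
    using swap_lab[OF c(2,1) p u(1) k(1,3) u(4) k(2) q(5) c(3) p(1) yp(1)] by blast
  note d = tc_pin[OF tc_step[OF t(1) x1(1)] p(1) x1(3) yp(1)]
  have "u \<noteq> p" using lnk_lkind[OF p(2)] u(4) q(5) by auto
  moreover have "r \<noteq> p" using lnk_lkind[OF r(2)] yp(1) q(5) by auto
  ultimately have m: "u \<in> A - {p}" "r \<in> A - {p}" using u(1) r(1) by auto
  have "reach A (Suc n) x y" if "reach (A - {p}) n x1 y" for n
    using reach_Cons[OF x1(1) d(2)[OF that]] .
  then show ?thesis using x1(2) k(4) m d(1) by blast
qed

text \<open>Some end of the link of \<open>x\<close> is off the link of \<open>y\<close> and has a
  colour there. While both colours occur three times, it is left with its final label, one move for
  one line; \<open>pin_one_colour\<close> keeps the two links on different pairs.\<close>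

lemma two_colours_distinct:
  assumes "tc A a q b o' x y" "2 \<le> a" "2 \<le> b" "3 \<le> a \<or> 3 \<le> b"
    and "p \<in> A" "lnk x p p'" "r \<in> A" "lnk y r r'" "{p, p'} \<noteq> {r, r'}"
  shows "reach A (a + b + 3) x y"
  using assms
proof (induction "a + b" arbitrary: A a q b o' x p p' rule: less_induct)
  case less
  note t = less.prems(1) and p = less.prems(5,6) and r = less.prems(7,8,9)
  consider (a) "a = 2" "3 \<le> b" | (b) "b = 2" "3 \<le> a" | (c) "3 \<le> a" "3 \<le> b" using less.prems(2,3,4) by linarith
  then show ?case
  proof cases
    case a
    then have "tc A 2 q b o' x y" using t by simp
    from two_and_many[OF this a(2) p r] have "reach A (b + 5) x y" .
    moreover have "a + b + 3 = b + 5" using a by simp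
    ultimately show ?thesis by metis
  next
    case b
    then have "tc A 2 o' a q x y" using tc_swap[OF t] by simp
    from two_and_many[OF this b(2) p r] have "reach A (a + 5) x y" .
    moreover have "a + b + 3 = a + 5" using b by simp
    ultimately show ?thesis by metis
  next
    case c
    have mm: "p' \<in> A" using lnk_mem[OF tc_conf(2)[OF t] p] .
    have one: "reach A (a + b + 3) x y" if z: "z \<in> A" "lnk x z z'" "z \<notin> {r, r'}" for z z'
    proof -
      have "lkind y z = q \<or> lkind y z = o'"
        using tc_kinds[OF tc_sym[OF t] z(1)] tc_links[OF tc_sym[OF t] r(1,2) z(1)] z(3) by blast
      then show ?thesis
      proof
        assume k: "lkind y z = o'"
        obtain x1 u k where 1: "lnk x1 u k" "{u, k} \<noteq> {r, r'}" "u \<in> A - {z}" "r \<in> A - {z}"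
          "tc (A - {z}) a q (b - 1) o' x1 y" "\<And>n. reach (A - {z}) n x1 y \<Longrightarrow> reach A (Suc n) x y"
          using pin_one_colour[OF t c(2) z(1,2) k r(1,2)] by blast
        have "reach (A - {z}) (a + (b - 1) + 3) x1 y"
          by (rule less.hyps[OF _ 1(5) _ _ _ 1(3,1,4) r(2) 1(2)]) (use c in auto)
        then have "reach A (Suc (a + (b - 1) + 3)) x y" by (rule 1(6))
        moreover have "Suc (a + (b - 1) + 3) = a + b + 3" using c by simp
        ultimately show ?thesis by metis
      next
        assume k: "lkind y z = q"
        obtain x1 u k where 1: "lnk x1 u k" "{u, k} \<noteq> {r, r'}" "u \<in> A - {z}" "r \<in> A - {z}"
          "tc (A - {z}) b o' (a - 1) q x1 y" "\<And>n. reach (A - {z}) n x1 y \<Longrightarrow> reach A (Suc n) x y"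
          using pin_one_colour[OF tc_swap[OF t] c(1) z(1,2) k r(1,2)] by blast
        have "reach (A - {z}) (a - 1 + b + 3) x1 y"
          by (rule less.hyps[OF _ tc_swap[OF 1(5)] _ _ _ 1(3,1,4) r(2) 1(2)]) (use c in auto)
        then have "reach A (Suc (a - 1 + b + 3)) x y" by (rule 1(6))
        moreover have "Suc (a - 1 + b + 3) = a + b + 3" using c by simp
        ultimately show ?thesis by metis
      qed
    qed
    have "p \<notin> {r, r'} \<or> p' \<notin> {r, r'}" using r(3) p(2) by (auto simp: lnk_def)
    then show ?thesis using one[OF p] one[OF mm lnk_sym[OF p(2)]] by blast
  qed
qed

text \<open>Here \<open>card A = a + b + 2\<close>. The extra move that separates links on the same
  pair uses up the surplus of 2.\<close>

lemma two_colours: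
  assumes t: "tc A a q b o' x y" "2 \<le> a" "2 \<le> b" "3 \<le> a \<or> 3 \<le> b"
  shows "reach A (a + b + 4) x y"
proof -
  obtain p p' where p: "p \<in> A" "p' \<in> A" "lnk x p p'" using tc_link_ex[OF t(1)] by blast
  obtain r r' where r: "r \<in> A" "r' \<in> A" "lnk y r r'" using tc_link_ex[OF tc_sym[OF t(1)]] by blast
  show ?thesis
  proof (cases "{p, p'} = {r, r'}")
    case False
    have "reach A (a + b + 3) x y" using two_colours_distinct[OF t p(1,3) r(1,3) False] .
    then show ?thesis by (rule reach_mono) simp
  next
    case True
    have "2 \<le> card (kset A x q)" using tc_counts(1)[OF t(1)] t(2) by simp
    then obtain k l where k: "k \<in> A" "l \<in> A" "lkind x k = q" "lkind x l = q" "k \<noteq> l" using two_kind by blast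
    obtain x1 where x1: "step A x x1" "lnk x1 k l"
      using swap_any[OF tc_conf(2,1)[OF t(1)] p(1,3) k(1,2,5,3,4) tc_colours(4)[OF t(1)]] by blast
    have "k \<notin> {p, p'}" using lnk_lkind[OF p(3)] k(3) tc_colours(4)[OF t(1)] by auto
    then have "{k, l} \<noteq> {r, r'}" using True by auto
    then have "reach A (a + b + 3) x1 y" using two_colours_distinct[OF tc_step[OF t(1) x1(1)] t(2-4) k(1) x1(2) r(1,3)] by blast
    then have "reach A (Suc (a + b + 3)) x y" using reach_Cons[OF x1(1)] by blast
    moreover have "Suc (a + b + 3) = a + b + 4" by simp
    ultimately show ?thesis by metis
  qed
qed

section \<open>The connected classes\<close>

text \<open>
  The arguments are the numbers of lines on links (twice the number of links), of even and of odd
  reflections, and of holes.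
\<close>

definition good :: "nat \<Rightarrow> nat \<Rightarrow> nat \<Rightarrow> nat \<Rightarrow> bool" where
  "good p a b f \<longleftrightarrow> p = 0 \<and> 1 \<le> f
    \<or> 2 \<le> p \<and> f = 0 \<and> a \<noteq> 1 \<and> b \<noteq> 1 \<and> (p = 2 \<longrightarrow> (a, b) \<notin> {(2, 0), (0, 2), (2, 2)})
    \<or> 2 \<le> p \<and> 1 \<le> f \<and> (2 \<le> a \<or> 2 \<le> b \<or> 2 \<le> f) \<and> \<not> (p = 2 \<and> a + b + f = 2)"

lemma drop_link_IH:
  assumes "finite A" "conf A x" "conf A y" "sim A x y" "4 \<le> card (kset A x 3)"
    and nl: "\<And>i. i \<in> A \<Longrightarrow> \<not> lonely A x i"
    and IH: "\<And>B x'. \<lbrakk>finite B; card B + 2 = card A; conf B x'; conf B y; sim B x' y;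
        \<And>q. card (kset B x' q) = card (kset A x q) - (if q = 3 then 2 else 0)\<rbrakk>
        \<Longrightarrow> reach B (card B + 2) x' y"
  shows "reach A (card A + 2) x y"
proof -
  have "card (kset A y 3) \<noteq> 0" using assms(4,5) by (simp add: sim_def)
  then obtain i j where ij: "i \<in> A" "j \<in> A" "lnk y i j" using kset_ex lkind3_lnk[OF assms(3)] by blast
  have ne: "i \<noteq> j" using ij by (simp add: lnk_def)
  have "{i, j} \<subseteq> A" "card {i, j} = 2" using ij ne by auto
  then have B: "card (A - {i, j}) + 2 = card A" "finite (A - {i, j})"
    using assms(1) card_mono[OF assms(1), of "{i, j}"] by (auto simp: card_Diff_subset)
  have "reach A (card (A - {i, j}) + 2 + 2) x y"
    by (rule drop_link[OF assms(1-5) ij nl[OF ij(1)] nl[OF ij(2)] IH[OF B(2,1)]])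
  then show ?thesis using B(1) by (metis)
qed

lemma not_lonely:
  assumes "finite A" "i \<in> A" "card (kset A x 0) \<noteq> 1" "card (kset A x 1) \<noteq> 1" "card (kset A x 2) \<noteq> 1"
  shows "\<not> lonely A x i"
proof -
  have "lkind x i \<in> {0, 1, 2, 3}" using lkind_values[of x i] by auto
  then show ?thesis using kset_nonempty[OF assms(1,2), of x] assms(3-5) by (auto simp: lonely_def)
qed

lemma colour_cases:
  fixes a b :: nat
  assumes "a \<noteq> 1" "b \<noteq> 1" "\<not> (a = 2 \<and> b = 0)" "\<not> (a = 0 \<and> b = 2)" "\<not> (a = 2 \<and> b = 2)"
  shows "a = 0 \<and> b = 0 \<or> a = 0 \<and> 3 \<le> b \<or> 3 \<le> a \<and> b = 0 \<or> 2 \<le> a \<and> 2 \<le> b \<and> (3 \<le> a \<or> 3 \<le> b)"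
  using assms by presburger

text \<open>Links are removed while the remaining class stays connected. From two links with only
  one or two pairs of tokens this would fail, and \<open>pairs_reach\<close> takes over.\<close>

lemma no_holes_reach:
  assumes "finite A" "conf A x" "conf A y" "sim A x y" "card (kset A x 0) = 0" "2 \<le> card (kset A x 3)"
    and "card (kset A x 1) \<noteq> 1" "card (kset A x 2) \<noteq> 1"
    and "card (kset A x 3) = 2 \<longrightarrow> (card (kset A x 1), card (kset A x 2)) \<notin> {(2, 0), (0, 2), (2, 2)}"
  shows "reach A (card A + 2) x y"
  using assms
proof (induction "card A" arbitrary: A x rule: less_induct)
  case less
  note A = less.prems(1-4)
  let ?a = "card (kset A x 1)" and ?b = "card (kset A x 2)" and ?p = "card (kset A x 3)"
  have n: "card A = ?a + ?b + ?p" using card_kinds[OF A(1), of x] less.prems(5) by simp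
  obtain m where m: "?p = 2 * m" using even_links[OF A(1,2)] by blast
  have "?p = 2 \<or> 4 \<le> ?p" using m less.prems(6) by (cases "m = 1") auto
  then show ?case
  proof
    assume p: "?p = 2"
    have bad: "\<not> (?a = 2 \<and> ?b = 0)" "\<not> (?a = 0 \<and> ?b = 2)" "\<not> (?a = 2 \<and> ?b = 2)"
      using less.prems(9) p by auto
    then consider "?a = 0" "?b = 0" | "?a = 0" "3 \<le> ?b" | "3 \<le> ?a" "?b = 0" | "2 \<le> ?a" "2 \<le> ?b" "3 \<le> ?a \<or> 3 \<le> ?b"
      using colour_cases[OF less.prems(7,8) bad] by metis
    then show ?thesis
    proof cases
      case 1
      then have "reach A (card A) x y" using links_reach[OF A] less.prems(5) by (simp add: tok_def)
      then show ?thesis by (rule reach_mono) simp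
    next
      case 2
      have "tc A 0 1 ?b 2 x y" using A less.prems(5) p 2 by (simp add: tc_def)
      from oc_any[OF this 2(2)] show ?thesis by (rule reach_mono) (use n p in simp)
    next
      case 3
      have "tc A 0 2 ?a 1 x y" using A less.prems(5) p 3 by (simp add: tc_def)
      from oc_any[OF this 3(1)] show ?thesis by (rule reach_mono) (use n p in simp)
    next
      case 4
      have "tc A ?a 1 ?b 2 x y" using A less.prems(5) p by (simp add: tc_def)
      from two_colours[OF this 4] show ?thesis by (rule reach_mono) (use n p in simp)
    qed
  next
    assume p: "4 \<le> ?p"
    show ?thesis
    proof (cases "?p = 4 \<and> (?a, ?b) \<in> {(2, 0), (0, 2), (2, 2)}")
      case True
      define k where "k = (?a + ?b) div 2"
      have k: "card A = 4 + 2 * k" "k \<le> 2" using True n by (auto simp: k_def)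
      have c: "card (kset A x q) = 0 \<or> card (kset A x q) = 2" if "q < 3" for q
      proof -
        have "q = 0 \<or> q = 1 \<or> q = 2" using that by auto
        then show ?thesis using True less.prems(5) by auto
      qed
      have "reach A (4 + 3 * k) x y"
        using pairs_reach[OF A _ c k(1)] True by blast
      then show ?thesis by (rule reach_mono) (use k in simp)
    next
      case False
      have f1: "card (kset A x 0) \<noteq> 1" using less.prems(5) by simp
      show ?thesis
      proof (rule drop_link_IH[OF A p not_lonely[OF A(1) _ f1 less.prems(7,8)]])
        fix B x' assume B: "finite B" "card B + 2 = card A" "conf B x'" "conf B y" "sim B x' y"
          and c: "\<And>q. card (kset B x' q) = card (kset A x q) - (if q = 3 then 2 else 0)"
        have c': "card (kset B x' 0) = 0" "card (kset B x' 1) = ?a" "card (kset B x' 2) = ?b" "card (kset B x' 3) = ?p - 2"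
          using c[of 0] c[of 1] c[of 2] c[of 3] less.prems(5) by simp_all
        have "card B < card A" using B(2) by simp
        then show "reach B (card B + 2) x' y"
          by (rule less.hyps[OF _ B(1,3-5)]) (use c' p False less.prems(7,8) in auto)
      qed
    qed
  qed
qed

text \<open>The exception is two links with two holes: removing a link would leave four lines with
  one link, a disconnected class.\<close>

lemma holes_only_reach:
  assumes "finite A" "conf A x" "conf A y" "sim A x y" "tok A x = 0" "2 \<le> card (kset A x 3)" "2 \<le> card (kset A x 0)"
    and "\<not> (card (kset A x 3) = 2 \<and> card (kset A x 0) = 2)"
  shows "reach A (card A + 2) x y"
  using assms
proof (induction "card A" arbitrary: A x rule: less_induct)
  case less
  note A = less.prems(1-4)
  let ?f = "card (kset A x 0)" and ?p = "card (kset A x 3)"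
  have n: "card A = ?f + ?p" using card_kinds_tok[OF A(1), of x] less.prems(5) by simp
  have ab: "card (kset A x 1) = 0" "card (kset A x 2) = 0" using less.prems(5) by (simp_all add: tok_def)
  obtain m where m: "?p = 2 * m" using even_links[OF A(1,2)] by blast
  have "?p = 2 \<or> 4 \<le> ?p" using m less.prems(6) by (cases "m = 1") auto
  then show ?case
  proof
    assume p: "?p = 2"
    then have "5 \<le> card A" using n less.prems(7,8) by linarith
    then show ?thesis using one_link_two_holes[OF A p less.prems(7)] less.prems(5) by simp
  next
    assume p: "4 \<le> ?p"
    show ?thesis
    proof (cases "?p = 4 \<and> ?f = 2")
      case True
      have c: "card (kset A x q) = 0 \<or> card (kset A x q) = 2" if "q < 3" for q
      proof -
        have "q = 0 \<or> q = 1 \<or> q = 2" using that by auto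
        then show ?thesis using True ab by auto
      qed
      have "reach A (4 + 3 * 1) x y"
        by (rule pairs_reach[OF A _ c]) (use True n in simp_all)
      then show ?thesis by (rule reach_mono) (use True n in simp)
    next
      case False
      have nl: "?f \<noteq> 1" "card (kset A x 1) \<noteq> 1" "card (kset A x 2) \<noteq> 1" using less.prems(7) ab by simp_all
      show ?thesis
      proof (rule drop_link_IH[OF A p not_lonely[OF A(1) _ nl]])
        fix B x' assume B: "finite B" "card B + 2 = card A" "conf B x'" "conf B y" "sim B x' y"
          and c: "\<And>q. card (kset B x' q) = card (kset A x q) - (if q = 3 then 2 else 0)"
        have c': "card (kset B x' 0) = ?f" "card (kset B x' 1) = 0" "card (kset B x' 2) = 0" "card (kset B x' 3) = ?p - 2"
          using c[of 0] c[of 1] c[of 2] c[of 3] ab by simp_all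
        have "card B < card A" using B(2) by simp
        then show "reach B (card B + 2) x' y"
          by (rule less.hyps[OF _ B(1,3-5)]) (use c' p False less.prems(7) in \<open>auto simp: tok_def\<close>)
      qed
    qed
  qed
qed

theorem good_reach:
  assumes "finite A" "conf A x" "conf A y" "sim A x y"
    and "good (card (kset A x 3)) (card (kset A x 1)) (card (kset A x 2)) (card (kset A x 0))"
  shows "reach A (card A + 2) x y"
proof -
  let ?f = "card (kset A x 0)" and ?p = "card (kset A x 3)"
  have n: "card A = ?f + tok A x + ?p" using card_kinds_tok[OF assms(1)] .
  consider (t) "?p = 0" "1 \<le> ?f"
    | (l) "2 \<le> ?p" "?f = 0" "card (kset A x 1) \<noteq> 1" "card (kset A x 2) \<noteq> 1"
      "?p = 2 \<longrightarrow> (card (kset A x 1), card (kset A x 2)) \<notin> {(2, 0), (0, 2), (2, 2)}"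
    | (h) "2 \<le> ?p" "1 \<le> ?f" "2 \<le> card (kset A x 1) \<or> 2 \<le> card (kset A x 2) \<or> 2 \<le> ?f"
      "\<not> (?p = 2 \<and> card (kset A x 1) + card (kset A x 2) + ?f = 2)"
    using assms(5) unfolding good_def by metis
  then show ?thesis
  proof cases
    case t
    then have "?f \<noteq> 0" by simp
    from tokens_reach[OF assms(1-4) t(1) this] show ?thesis
      by (rule reach_mono) (use n t col_bounds(1)[of A x] in auto)
  next
    case l
    then show ?thesis using no_holes_reach[OF assms(1-4) l(2,1,3,4,5)] by blast
  next
    case h
    show ?thesis
    proof (cases "tok A x = 0")
      case True
      then show ?thesis using holes_only_reach[OF assms(1-4) True h(1)] h by (simp add: tok_def)
    next
      case False
      then have "1 \<le> tok A x" by simp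
      from holes_reach[OF assms(1-4) h(1,2) this] h(3) have "reach A (card A + col A x) x y" by blast
      then show ?thesis by (rule reach_mono) (use col_bounds(1)[of A x] in simp)
    qed
  qed
qed

section \<open>The disconnected classes\<close>

text \<open>Paths end at \<open>y\<close> only up to values off \<open>A\<close>, hence the witness
  \<open>w\<close> instead of \<open>y\<close> itself.\<close>

lemma reach_invariant:
  assumes "reach A k x y" "I x" "\<And>u v. step A u v \<Longrightarrow> sim A x u \<Longrightarrow> I u \<Longrightarrow> I v"
  shows "\<exists>w. I w \<and> (\<forall>i\<in>A. w i = y i)"
proof -
  have "\<exists>w. I w \<and> (\<forall>i\<in>A. w i = y i)" if "reach A k u y" "I u" "sim A x u" for u
    using that
  proof (induction k arbitrary: u)
    case 0
    then show ?case by (auto simp: reach.simps)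
  next
    case (Suc k)
    then obtain v where v: "step A u v" "reach A k v y" by (auto simp: reach.simps)
    then have "I v" "sim A x v"
      using assms(3)[OF v(1) Suc.prems(3,2)] sim_trans[OF Suc.prems(3) step_conf(3)[OF v(1)]] by auto
    then show ?case using Suc.IH v(2) by blast
  qed
  then show ?thesis using assms(1,2) by auto
qed

text \<open>Conjugation by the transposition of two lines: it stays in the class, but moves a link
  end to where the invariants forbid it.\<close>

definition relabel :: "nat \<Rightarrow> nat \<Rightarrow> lmap \<Rightarrow> lmap" where
  "relabel i j x z = (transpose i j (fst (x (transpose i j z))), snd (x (transpose i j z)))"

lemma transpose_mem: "i \<in> A \<Longrightarrow> j \<in> A \<Longrightarrow> transpose i j z \<in> A \<longleftrightarrow> z \<in> A"
  by (auto simp: transpose_def)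

lemma lkind_relabel: "lkind (relabel i j x) z = lkind x (transpose i j z)"
proof -
  have "transpose i j (fst (x (transpose i j z))) = z \<longleftrightarrow> fst (x (transpose i j z)) = transpose i j z"
    by (metis transpose_involutory)
  then show ?thesis by (simp add: lkind_def relabel_def split: prod.split)
qed

lemma kset_relabel:
  assumes "i \<in> A" "j \<in> A"
  shows "kset A (relabel i j x) q = transpose i j ` kset A x q"
proof -
  have "z \<in> kset A (relabel i j x) q \<longleftrightarrow> transpose i j z \<in> kset A x q" for z
    using transpose_mem[OF assms] by (simp add: kset_iff lkind_relabel)
  then show ?thesis by (simp add: set_eq_iff in_transpose_image_iff)
qed

lemma sim_relabel: "i \<in> A \<Longrightarrow> j \<in> A \<Longrightarrow> sim A x (relabel i j x)"
  by (simp add: sim_def kset_relabel card_image)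

lemma conf_relabel:
  assumes "conf A x" "i \<in> A" "j \<in> A"
  shows "conf A (relabel i j x)"
  unfolding conf_def
proof (intro ballI)
  fix z assume z: "z \<in> A"
  let ?t = "transpose i j"
  obtain k s v where x: "x (?t z) = (k, s, v)" by (metis prod.exhaust)
  have tz: "?t z \<in> A" using z transpose_mem[OF assms(2,3)] by simp
  note l = conf_link[OF assms(1) tz x]
  have "relabel i j x z = (?t k, s, v)" by (simp add: relabel_def x)
  moreover have "relabel i j x (?t k) = (z, s, - s * v)" by (simp add: relabel_def l)
  moreover have "?t k \<in> A" using l transpose_mem[OF assms(2,3)] by simp
  ultimately show "fst (relabel i j x z) \<in> A \<and> (fst (snd (relabel i j x z)) = 1 \<or> fst (snd (relabel i j x z)) = - 1) \<and>
      lcomp (relabel i j x) (relabel i j x) z = (z, 1, 0)"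
    using l(2) by (auto simp: lcomp_def)
qed

text \<open>The new label arises by conjugation with a unit translation, so the class does not
  change.\<close>

lemma shift_label:
  assumes "conf A x" "i \<in> A" "x i = (i, -1, c)"
  shows "conf A (x(i := (i, -1, c + 2)))" "sim A x (x(i := (i, -1, c + 2)))"
proof -
  let ?y = "x(i := (i, -1, c + 2))"
  have "lkind ?y z = lkind x z" for z using assms(3) by (cases "z = i") (auto simp: lkind_def)
  then show "sim A x ?y" by (simp add: sim_def kset_def)
  have ne: "fst (x z) \<noteq> i" if "z \<in> A" "z \<noteq> i" for z
  proof
    assume "fst (x z) = i"
    moreover obtain s v where "x z = (fst (x z), s, v)" by (metis prod.collapse)
    ultimately have "x i = (z, s, - s * v)" using conf_link(3)[OF assms(1) that(1)] by metis
    then show False using assms(3) that(2) by simp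
  qed
  have "lcomp ?y ?y z = lcomp x x z" if "z \<in> A" "z \<noteq> i" for z
    using that ne[OF that] by (intro lcomp_cong) simp_all
  then show "conf A ?y" using assms by (auto simp: conf_def lcomp_def)
qed

lemma step_comm: "step A u v \<Longrightarrow> i \<in> A \<Longrightarrow> lcomp u v i = lcomp v u i"
  by (simp add: step_def)

text \<open>The products of two reflections of a line in the two orders are opposite translations,
  so commuting reflections are equal.\<close>

lemma step_reflections:
  assumes "step A u v" "i \<in> A" "lkind u i = 1 \<or> lkind u i = 2" "lkind v i = 1 \<or> lkind v i = 2"
  shows "v i = u i"
proof -
  obtain c where c: "u i = (i, -1, c)" using lkind12D[OF step_conf(1)[OF assms(1)] assms(2) refl assms(3)] by blast
  obtain d where d: "v i = (i, -1, d)" using lkind12D[OF step_conf(2)[OF assms(1)] assms(2) refl assms(4)] by blast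
  show ?thesis using step_comm[OF assms(1,2)] by (simp add: lcomp_def c d)
qed

text \<open>The link of \<open>v\<close> conjugates the action of the commuting \<open>u\<close> on
  one end into its action on the other end.\<close>

lemma step_transport:
  assumes "step A u v" "i \<in> A" "lnk v i j" "lkind u i \<noteq> 3"
  shows "lkind u j = lkind u i"
proof -
  note c = step_conf[OF assms(1)]
  obtain s w where v: "v i = (j, s, w)" "s = 1 \<or> s = -1" using lnkD[OF c(2) assms(2,3)] by metis
  obtain k t d where u: "u j = (k, t, d)" by (metis prod.exhaust)
  show ?thesis
  proof (cases rule: lkind_cases[OF c(1) assms(2)])
    case 1
    then have "k = j" "t = 1" "t * w + d = w"
      using step_comm[OF assms(1,2)] v by (auto simp: lcomp_def u)
    then show ?thesis using 1 u by (simp add: lkind_def)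
  next
    case (2 e)
    then have "k = j" "t = -1" "s * e + w = t * w + d"
      using step_comm[OF assms(1,2)] v by (auto simp: lcomp_def u)
    moreover have "even d \<longleftrightarrow> even e"
    proof -
      have "d = s * e + 2 * w" using calculation by simp
      then show ?thesis using v(2) by auto
    qed
    ultimately show ?thesis using 2 u by (simp add: lkind_def)
  next
    case 3
    then show ?thesis using assms(4) by simp
  qed
qed

text \<open>If \<open>j\<close> differed from \<open>k\<close>, then \<open>u\<close> would fix the
  line \<open>j\<close> and move \<open>i\<close> to \<open>k\<close>; commutation would make
  \<open>v\<close> link \<open>j\<close> to both \<open>i\<close> and \<open>k\<close>.\<close>

lemma step_link:
  assumes "step A u v" "i \<in> A" "lnk u i k" "lnk v i j" "kset A u 3 = {i, k}"
  shows "j = k"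
proof (rule ccontr)
  assume jk: "j \<noteq> k"
  note c = step_conf[OF assms(1)]
  have j: "j \<in> A" using lnk_mem[OF c(2) assms(2,4)] .
  have "j \<noteq> i" using assms(4) by (simp add: lnk_def)
  then have "lkind u j \<noteq> 3" using jk j assms(5) kset_iff[of j A u 3] by auto
  then have "fst (u j) = j" by (simp add: lkind3)
  moreover have "fst (lcomp u v i) = fst (v k)" "fst (lcomp v u i) = fst (u j)"
    using assms(3,4) by (auto simp: lcomp_def lnk_def split: prod.split)
  ultimately have vk: "fst (v k) = j" using step_comm[OF assms(1,2)] by simp
  have "k \<in> A" using lnk_mem[OF c(1) assms(2,3)] .
  moreover obtain s w where "v k = (j, s, w)" using vk by (metis prod.collapse)
  ultimately have "fst (v j) = k" using conf_link(3)[OF c(2)] by fastforce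
  then show False using assms(3,4) by (auto simp: lnk_def)
qed

lemma links_eqI:
  assumes "finite A" "step A u v" "kset A v 3 \<subseteq> kset A u 3"
  shows "kset A v 3 = kset A u 3"
  using assms card_subset_eq[of "kset A u 3" "kset A v 3"] step_conf(3)[OF assms(2)] by (simp add: sim_def)

section \<open>Invariants of the disconnected classes\<close>

definition separated :: "nat set \<Rightarrow> lmap \<Rightarrow> bool" where
  "separated A x \<longleftrightarrow> (\<exists>y. conf A y \<and> sim A x y \<and> (\<forall>k. \<not> reach A k x y))"

lemma separatedI:
  assumes "conf A y" "sim A x y" "I x" and I: "\<And>u v. step A u v \<Longrightarrow> sim A x u \<Longrightarrow> I u \<Longrightarrow> I v"
    and no: "\<And>w. I w \<Longrightarrow> (\<forall>z\<in>A. w z = y z) \<Longrightarrow> False"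
  shows "separated A x"
proof -
  have "\<not> reach A k x y" for k
  proof
    assume r: "reach A k x y"
    have "\<exists>w. I w \<and> (\<forall>z\<in>A. w z = y z)"
      by (rule reach_invariant[of A k x y I, OF r assms(3)]) (rule I)
    then obtain w where w: "I w" "\<forall>z\<in>A. w z = y z" by (elim exE conjE)
    show False using no[OF w] .
  qed
  with assms(1,2) show ?thesis unfolding separated_def by (intro exI[of _ y]) simp
qed

lemma separated_relabel:
  assumes "conf A x" "i \<in> A" "j \<in> A" "I x" "\<And>u v. step A u v \<Longrightarrow> sim A x u \<Longrightarrow> I u \<Longrightarrow> I v"
    and "\<And>w. I w \<Longrightarrow> (\<forall>z\<in>A. w z = relabel i j x z) \<Longrightarrow> False"
  shows "separated A x"
  by (rule separatedI[where I = I, OF conf_relabel[OF assms(1-3)] sim_relabel[OF assms(2,3)] assms(4-6)])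

text \<open>With no hole and no link in the class, no label can ever change; a shifted label gives
  an unreachable vertex.\<close>

lemma separated_all_reflections:
  assumes A: "finite A" "conf A x" "A \<noteq> {}" and k: "card (kset A x 3) = 0" "card (kset A x 0) = 0"
  shows "separated A x"
proof -
  have k12: "lkind u i = 1 \<or> lkind u i = 2" if "sim A x u" "i \<in> A" for u i
  proof -
    have "card (kset A u 0) = 0" "card (kset A u 3) = 0" using that(1) k by (simp_all add: sim_def)
    then show ?thesis using kset_nonempty[OF A(1) that(2), of u] lkind_values[of u i] by auto
  qed
  obtain i where i: "i \<in> A" using A(3) by auto
  obtain c where c: "x i = (i, -1, c)" using lkind12D[OF A(2) i refl k12[OF sim_refl i]] by blast
  show ?thesis
  proof (rule separatedI[where I = "\<lambda>u. u i = x i", OF shift_label[OF A(2) i c] refl])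
    fix u v assume *: "step A u v" "sim A x u" "u i = x i"
    have "sim A x v" using sim_trans[OF *(2) step_conf(3)[OF *(1)]] .
    then show "v i = x i" using step_reflections[OF *(1) i k12[OF *(2) i] k12[OF _ i]] *(3) by simp
  next
    fix w assume "w i = x i" "\<forall>z\<in>A. w z = (x(i := (i, -1, c + 2))) z"
    then show False using i c by auto
  qed
qed

text \<open>The only token of its colour has no hole to hop to and no second line of its kind for an
  exchange, so its label is invariant.\<close>

lemma separated_single_colour:
  assumes A: "finite A" "conf A x" and k: "card (kset A x 0) = 0" and q: "q = 1 \<or> q = 2" "card (kset A x q) = 1"
  shows "separated A x"
proof -
  obtain i where i: "kset A x q = {i}" using q(2) by (auto simp: card_1_singleton_iff)
  then have iA: "i \<in> A" "lkind x i = q" using kset_iff[of i A x q] by auto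
  obtain c where c: "x i = (i, -1, c)" using lkind12D[OF A(2) iA q(1)] by blast
  show ?thesis
  proof (rule separatedI[where I = "\<lambda>u. u i = x i", OF shift_label[OF A(2) iA(1) c] refl])
    fix u v assume *: "step A u v" "sim A x u" "u i = x i"
    have ku: "lkind u i = q" using lkind_cong[of u i x] *(3) iA by simp
    have "card (kset A u q) = 1" using *(2) q(2) by (simp add: sim_def)
    then have u1: "z = i" if "z \<in> A" "lkind u z = q" for z
      using that iA(1) ku kset_iff[of z A u q] kset_iff[of i A u q] by (auto simp: card_1_singleton_iff)
    have "sim A x v" using sim_trans[OF *(2) step_conf(3)[OF *(1)]] .
    then have "card (kset A v 0) = 0" using k by (simp add: sim_def)
    then have v0: "lkind v i \<noteq> 0" using kset_nonempty[OF A(1) iA(1), of v] by metis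
    have "lkind v i \<noteq> 3"
    proof
      assume "lkind v i = 3"
      then obtain j where j: "lnk v i j" "j \<in> A" using lkind3_lnk[OF step_conf(2)[OF *(1)] iA(1)] by blast
      then have "lkind u j = q" using step_transport[OF *(1) iA(1)] ku q(1) by auto
      then show False using u1[OF j(2)] j(1) by (auto simp: lnk_def)
    qed
    then have "lkind v i = 1 \<or> lkind v i = 2" using lkind_values[of v i] v0 by blast
    then show "v i = x i" using step_reflections[OF *(1) iA(1)] ku q(1) *(3) by simp
  next
    fix w assume "w i = x i" "\<forall>z\<in>A. w z = (x(i := (i, -1, c + 2))) z"
    then show False using iA(1) c by auto
  qed
qed

text \<open>By \<open>step_transport\<close> a new link joins two lines of one kind, but no kind
  occurs twice off the links. Hence the set of link ends is invariant.\<close>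

lemma separated_fixed_set:
  assumes A: "finite A" "conf A x" and k: "2 \<le> card (kset A x 3)" "card (kset A x 3) < card A"
    and le: "card (kset A x 0) \<le> 1" "card (kset A x 1) \<le> 1" "card (kset A x 2) \<le> 1"
  shows "separated A x"
proof -
  obtain i where i: "i \<in> A" "lkind x i = 3" using kset_ex[of A x 3] k(1) by auto
  obtain j where j: "j \<in> A" "lkind x j \<noteq> 3"
    using k(2) kset_sub[of A x 3] by (metis kset_iff order_less_irrefl subset_antisym subsetI)
  show ?thesis
  proof (rule separated_relabel[where I = "\<lambda>u. kset A u 3 = kset A x 3", OF A(2) i(1) j(1) refl])
    fix u v assume *: "step A u v" "sim A x u" "kset A u 3 = kset A x 3"
    have "z \<in> kset A u 3" if "z \<in> kset A v 3" for z
    proof (rule ccontr)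
      assume n: "z \<notin> kset A u 3"
      have z: "z \<in> A" "lkind v z = 3" "lkind u z \<noteq> 3" using that n by (auto simp: kset_iff)
      obtain w where w: "lnk v z w" "w \<in> A" using lkind3_lnk[OF step_conf(2)[OF *(1)] z(1,2)] by blast
      have s: "lkind u w = lkind u z" using step_transport[OF *(1) z(1) w(1) z(3)] .
      have "card (kset A u (lkind u z)) \<le> 1"
        using le z(3) lkind_values[of u z] *(2) by (auto simp: sim_def)
      moreover have "{z, w} \<subseteq> kset A u (lkind u z)" "z \<noteq> w" using z w s by (auto simp: kset_iff lnk_def)
      ultimately show False using card_mono[of "kset A u (lkind u z)" "{z, w}"] A(1) by simp
    qed
    then show "kset A v 3 = kset A x 3" using links_eqI[OF A(1) *(1)] *(3) by blast
  next
    fix w assume w: "kset A w 3 = kset A x 3" "\<forall>z\<in>A. w z = relabel i j x z"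
    have "lkind w j = lkind x i" using w(2) j(1) lkind_cong[of w j "relabel i j x"] lkind_relabel[of i j x j] by simp
    then show False using w(1) i j by (auto simp: kset_def)
  qed
qed

text \<open>A next link that avoids the old ends occupies both other lines, and one that meets them
  has the same pair by \<open>step_link\<close>. Hence the partition of the four lines into two
  pairs is invariant.\<close>

lemma separated_four:
  assumes A: "finite A" "conf A x" and k: "card (kset A x 3) = 2" "card A = 4"
  shows "separated A x"
proof -
  obtain i i' where i: "i \<in> A" "lnk x i i'" "i' \<in> A"
    using kset_ex[of A x 3] lkind3_lnk[OF A(2)] k(1) by fastforce
  have ii: "i \<noteq> i'" "lkind x i = 3" "lkind x i' = 3" using i lnk_lkind by (auto simp: lnk_def)
  have "card (kset A x 3) < card A" using k by simp
  then obtain j where j: "j \<in> A" "lkind x j \<noteq> 3"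
    using kset_sub[of A x 3] by (metis kset_iff order_less_irrefl subset_antisym subsetI)
  let ?P = "kset A x 3"
  show ?thesis
  proof (rule separated_relabel[where I = "\<lambda>u. kset A u 3 = ?P \<or> kset A u 3 = A - ?P", OF A(2) i(1) j(1)])
    fix u v assume *: "step A u v" "sim A x u" "kset A u 3 = ?P \<or> kset A u 3 = A - ?P"
    have cu: "card (kset A u 3) = 2" "card (kset A v 3) = 2"
      using *(2) step_conf(3)[OF *(1)] k(1) by (simp_all add: sim_def)
    have "kset A v 3 = kset A u 3 \<or> kset A v 3 = A - kset A u 3"
    proof (cases "kset A v 3 \<inter> kset A u 3 = {}")
      case True
      then have "kset A v 3 \<subseteq> A - kset A u 3" using kset_sub by blast
      moreover have "card (A - kset A u 3) = 2" using A(1) k(2) cu(1) by (simp add: card_Diff_subset kset_sub)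
      ultimately show ?thesis using card_subset_eq[of "A - kset A u 3" "kset A v 3"] A(1) cu(2) by auto
    next
      case False
      then obtain z where z: "z \<in> A" "lkind u z = 3" "lkind v z = 3" by (auto simp: kset_iff)
      obtain a where a: "lnk u z a" "a \<in> A" using lkind3_lnk[OF step_conf(1)[OF *(1)] z(1,2)] by blast
      obtain b where b: "lnk v z b" "b \<in> A" using lkind3_lnk[OF step_conf(2)[OF *(1)] z(1,3)] by blast
      have za: "kset A u 3 = {z, a}"
        using a z cu A(1) lnk_lkind(2)[OF a(1)] by (intro card_subset_eq[symmetric]) (auto simp: kset_iff lnk_def)
      have zb: "kset A v 3 = {z, b}"
        using b z cu A(1) lnk_lkind(2)[OF b(1)] by (intro card_subset_eq[symmetric]) (auto simp: kset_iff lnk_def)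
      show ?thesis using step_link[OF *(1) z(1) a(1) b(1) za] za zb by simp
    qed
    then show "kset A v 3 = ?P \<or> kset A v 3 = A - ?P" using *(3) kset_sub[of A x 3] by blast
  next
    fix w assume w: "kset A w 3 = ?P \<or> kset A w 3 = A - ?P" "\<forall>z\<in>A. w z = relabel i j x z"
    have "lkind w j = 3" "lkind w i' = 3"
      using w(2) j i(3) ii lkind_cong[of w j "relabel i j x"] lkind_cong[of w i' "relabel i j x"]
        lkind_relabel[of i j x j] lkind_relabel[of i j x i'] by (auto simp: transpose_def)
    then have "j \<in> kset A w 3" "i' \<in> kset A w 3" using j(1) i(3) by (auto simp: kset_iff)
    then show False using w(1) j(2) ii(3) by (auto simp: kset_iff)
  qed simp
qed

text \<open>The link ends, the even and the odd tokens form three pairs. A move may only permute the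
  roles of these pairs.\<close>

lemma separated_six:
  assumes A: "finite A" "conf A x" and k: "card (kset A x 3) = 2" "card (kset A x 1) = 2" "card (kset A x 2) = 2" "card (kset A x 0) = 0"
  shows "separated A x"
proof -
  \<comment> \<open>A set of sets on purpose: it forgets which pair is of which kind, since this
    does change.\<close>
  define bl where "bl u = {kset A u 3, kset A u 1, kset A u 2}" for u
  obtain i i' where i: "i \<in> A" "lnk x i i'" "i' \<in> A"
    using kset_ex[of A x 3] lkind3_lnk[OF A(2)] k(1) by fastforce
  have ii: "i \<noteq> i'" "lkind x i = 3" "lkind x i' = 3" using i lnk_lkind by (auto simp: lnk_def)
  obtain j where j: "j \<in> A" "lkind x j = 1" using kset_ex[of A x 1] k(2) by auto
  show ?thesis
  proof (rule separated_relabel[where I = "\<lambda>u. bl u = bl x", OF A(2) i(1) j(1) refl])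
    fix u v assume *: "step A u v" "sim A x u" "bl u = bl x"
    have cu: "card (kset A u 3) = 2" "card (kset A u 1) = 2" "card (kset A u 2) = 2" "card (kset A u 0) = 0"
      "card (kset A v 3) = 2" "card (kset A v 1) = 2" "card (kset A v 2) = 2" "card (kset A v 0) = 0"
      using *(2) step_conf(3)[OF *(1)] k by (simp_all add: sim_def)
    have n0: "lkind u z \<noteq> 0" "lkind v z \<noteq> 0" if "z \<in> A" for z
      using kset_nonempty[OF A(1) that, of u] kset_nonempty[OF A(1) that, of v] cu(4,8) by metis+
    have same: "v z = u z" if "z \<in> A" "lkind u z \<noteq> 3" "lkind v z \<noteq> 3" for z
      using step_reflections[OF *(1) that(1)] n0[OF that(1)] that(2,3) lkind_values[of u z] lkind_values[of v z] by metis
    have keep: "kset A v q = kset A u q" if "q = 1 \<or> q = 2" "kset A u q \<inter> kset A v 3 = {}" for q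
    proof -
      have "kset A u q \<subseteq> kset A v q"
      proof
        fix z assume "z \<in> kset A u q"
        then have z: "z \<in> A" "lkind u z = q" by (auto simp: kset_iff)
        have "lkind u z \<noteq> 3" "lkind v z \<noteq> 3" using that z by (auto simp: kset_def)
        then have "v z = u z" using same[OF z(1)] by blast
        then show "z \<in> kset A v q" using z lkind_cong[of v z u] by (simp add: kset_iff)
      qed
      then show ?thesis using card_subset_eq[of "kset A v q" "kset A u q"] A(1) cu that(1) by auto
    qed
    obtain z where z: "z \<in> A" "lkind v z = 3" using kset_ex[of A v 3] cu by auto
    obtain b where b: "lnk v z b" "b \<in> A" using lkind3_lnk[OF step_conf(2)[OF *(1)] z(1,2)] by blast
    have zb: "kset A v 3 = {z, b}"
      using b z cu A(1) lnk_lkind(2)[OF b(1)] by (intro card_subset_eq[symmetric]) (auto simp: kset_iff lnk_def)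
    have zne: "z \<noteq> b" using b(1) by (simp add: lnk_def)
    show "bl v = bl x"
    proof (cases "lkind u z = 3")
      case True
      obtain a where a: "lnk u z a" "a \<in> A" using lkind3_lnk[OF step_conf(1)[OF *(1)] z(1) True] by blast
      have za: "kset A u 3 = {z, a}"
        using a z True cu A(1) lnk_lkind(2)[OF a(1)] by (intro card_subset_eq[symmetric]) (auto simp: kset_iff lnk_def)
      have e: "kset A v 3 = kset A u 3" using step_link[OF *(1) z(1) a(1) b(1) za] za zb by simp
      have "kset A u q \<inter> kset A v 3 = {}" if "q \<noteq> 3" for q using e that by (auto simp: kset_def)
      then show ?thesis using keep[of 1] keep[of 2] e *(3) by (simp add: bl_def)
    next
      case False
      have kb: "lkind u b = lkind u z" using step_transport[OF *(1) z(1) b(1) False] .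
      have q: "lkind u z = 1 \<or> lkind u z = 2" using lkind_values[of u z] False n0[OF z(1)] by metis
      then have "card (kset A u (lkind u z)) = 2" using cu by auto
      then have uq: "kset A u (lkind u z) = {z, b}"
        using z b kb zne A(1) by (intro card_subset_eq[symmetric]) (auto simp: kset_iff)
      \<comment> \<open>The other colour, as the colours are 1 and 2.\<close>
      define r where "r = 3 - lkind u z"
      have r: "r = 1 \<or> r = 2" "r \<noteq> lkind u z" using q by (auto simp: r_def)
      have "kset A u r \<inter> kset A u (lkind u z) = {}" using r(2) unfolding kset_def by blast
      then have kr: "kset A v r = kset A u r" using keep[OF r(1)] zb uq by simp
      have "kset A v (lkind u z) \<subseteq> kset A u 3"
      proof
        fix y assume "y \<in> kset A v (lkind u z)"
        then have y: "y \<in> A" "lkind v y = lkind u z" by (auto simp: kset_iff)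
        have "y \<notin> kset A v 3" "y \<notin> kset A v r" using y(2) False r(2) by (simp_all add: kset_iff)
        then have "y \<notin> kset A u (lkind u z)" "y \<notin> kset A u r" unfolding zb uq kr by simp_all
        then have "lkind u y \<noteq> lkind u z" "lkind u y \<noteq> r" using y(1) by (simp_all add: kset_iff)
        then have "lkind u y = 3" using lkind_values[of u y] n0[OF y(1)] q r by metis
        then show "y \<in> kset A u 3" using y(1) by (simp add: kset_iff)
      qed
      then have k3: "kset A v (lkind u z) = kset A u 3"
        using card_subset_eq[of "kset A u 3" "kset A v (lkind u z)"] A(1) cu q by (elim disjE) simp_all
      have "bl w = {kset A w 3, kset A w (lkind u z), kset A w r}" for w
        using q unfolding bl_def r_def by (elim disjE) (simp_all add: insert_commute)
      then have "bl v = bl u" unfolding zb uq k3 kr by (simp add: uq zb k3 kr insert_commute)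
      then show ?thesis using *(3) by simp
    qed
  next
    fix w assume w: "bl w = bl x" "\<forall>z\<in>A. w z = relabel i j x z"
    have ij: "i \<noteq> j" "i' \<noteq> j" using ii j by auto
    have "lkind w j = 3" "lkind w i' = 3"
      using w(2) j i(3) ii ij lkind_cong[of w j "relabel i j x"] lkind_cong[of w i' "relabel i j x"]
        lkind_relabel[of i j x j] lkind_relabel[of i j x i'] by (auto simp: transpose_def)
    then have "j \<in> kset A w 3" "i' \<in> kset A w 3" using j(1) i(3) by (auto simp: kset_iff)
    moreover have "kset A w 3 \<in> bl x" using w(1) by (auto simp: bl_def)
    moreover have "lkind x j = lkind x i'" if "j \<in> kset A x q" "i' \<in> kset A x q" for q
      using that by (simp add: kset_iff)
    ultimately have "lkind x j = lkind x i'" unfolding bl_def by blast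
    then show False using j(2) ii(3) by simp
  qed
qed

lemma not_good_cases:
  assumes that: "\<not> good p a b f" "even p" 
  shows  "p = 0 \<and> f = 0 \<or> 2 \<le> p \<and> f = 0 \<and> (a = 1 \<or> b = 1) \<or> p = 2 \<and> a + b + f = 2 \<or> p = 2 \<and> a = 2 \<and> b = 2 \<and> f = 0
      \<or> 2 \<le> p \<and> 1 \<le> f \<and> f \<le> 1 \<and> a \<le> 1 \<and> b \<le> 1"
proof -
  from that(2) have "p = 0 \<or> 2 \<le> p" by presburger
  then consider "p = 0" | "2 \<le> p" "f = 0" | "2 \<le> p" "1 \<le> f" by linarith
  then show ?thesis
  proof cases
    case 1 then show ?thesis using that(1) by (simp add: good_def)
  next
    case 2
    then have "a = 1 \<or> b = 1 \<or> p = 2 \<and> (a = 2 \<and> b = 0 \<or> a = 0 \<and> b = 2 \<or> a = 2 \<and> b = 2)"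
      using that(1) by (simp add: good_def)
    with 2 show ?thesis by (elim disjE conjE) simp_all
  next
    case 3
    then have "p = 2 \<and> a + b + f = 2 \<or> f \<le> 1 \<and> a \<le> 1 \<and> b \<le> 1"
      using that(1) by (simp add: good_def not_le less_Suc_eq_le) linarith
    with 3 show ?thesis by (elim disjE conjE) simp_all
  qed
qed

lemma not_good_separated:
  assumes A: "finite A" "conf A x" "A \<noteq> {}"
    and g: "\<not> good (card (kset A x 3)) (card (kset A x 1)) (card (kset A x 2)) (card (kset A x 0))"
  shows "separated A x"
proof -
  let ?f = "card (kset A x 0)" and ?a = "card (kset A x 1)" and ?b = "card (kset A x 2)" and ?p = "card (kset A x 3)"
  have n: "card A = ?f + ?a + ?b + ?p" using card_kinds[OF A(1)] .
  obtain m where m: "?p = 2 * m" using even_links[OF A(1,2)] by blast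
  have "even ?p" using m by simp
  from not_good_cases[OF g this] show ?thesis
  proof (elim disjE conjE)
    assume "?p = 0" "?f = 0"
    then show ?thesis using separated_all_reflections[OF A] by blast
  next
    assume "?f = 0" "?a = 1"
    then show ?thesis using separated_single_colour[OF A(1,2), of 1] by simp
  next
    assume "?f = 0" "?b = 1"
    then show ?thesis using separated_single_colour[OF A(1,2), of 2] by simp
  next
    assume "?p = 2" "?a + ?b + ?f = 2"
    then show ?thesis using separated_four[OF A(1,2)] n by simp
  next
    assume "?p = 2" "?a = 2" "?b = 2" "?f = 0"
    then show ?thesis using separated_six[OF A(1,2)] by blast
  next
    assume "2 \<le> ?p" "1 \<le> ?f" "?f \<le> 1" "?a \<le> 1" "?b \<le> 1"
    then show ?thesis using separated_fixed_set[OF A(1,2)] n by linarith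
  qed
qed

section \<open>Conjugacy\<close>

text \<open>\<open>g\<close> maps the lines in \<open>B\<close> to those in \<open>A\<close> and conjugates \<open>z\<close> to \<open>x\<close>.\<close>

definition twine :: "nat set \<Rightarrow> nat set \<Rightarrow> lmap \<Rightarrow> lmap \<Rightarrow> lmap \<Rightarrow> bool" where
  "twine B A g z x \<longleftrightarrow> bij_betw (\<lambda>i. fst (g i)) B A
     \<and> (\<forall>i\<in>B. (fst (snd (g i)) = 1 \<or> fst (snd (g i)) = -1) \<and> lcomp g x i = lcomp z g i)"

lemma twine_Un:
  assumes g: "twine B A g z x" "conf B z" and h: "twine B' A' h z x" "conf B' z"
    and d: "B \<inter> B' = {}" "A \<inter> A' = {}"
  shows "\<exists>k. twine (B \<union> B') (A \<union> A') k z x"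
proof -
  define k where "k i = (if i \<in> B then g i else h i)" for i
  have kB: "k i = g i" if "i \<in> B" for i using that by (simp add: k_def)
  have kB': "k i = h i" if "i \<in> B'" for i using that d(1) by (auto simp: k_def)
  have "bij_betw (\<lambda>i. fst (k i)) B A"
    using g(1) bij_betw_cong[of B "\<lambda>i. fst (k i)" "\<lambda>i. fst (g i)" A] by (simp add: kB twine_def)
  moreover have "bij_betw (\<lambda>i. fst (k i)) B' A'"
    using h(1) bij_betw_cong[of B' "\<lambda>i. fst (k i)" "\<lambda>i. fst (h i)" A'] by (simp add: kB' twine_def)
  ultimately have b: "bij_betw (\<lambda>i. fst (k i)) (B \<union> B') (A \<union> A')"
    using d(2) by (rule bij_betw_combine)
  have "(fst (snd (k i)) = 1 \<or> fst (snd (k i)) = -1) \<and> lcomp k x i = lcomp z k i" if "i \<in> B" for i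
  proof -
    have "fst (z i) \<in> B" using g(2) that by (simp add: conf_def)
    then have "lcomp k x i = lcomp g x i" "lcomp z k i = lcomp z g i"
      using that by (intro lcomp_cong; simp add: kB)+
    then show ?thesis using g(1) that by (simp add: twine_def kB)
  qed
  moreover have "(fst (snd (k i)) = 1 \<or> fst (snd (k i)) = -1) \<and> lcomp k x i = lcomp z k i" if "i \<in> B'" for i
  proof -
    have "fst (z i) \<in> B'" using h(2) that by (simp add: conf_def)
    then have "lcomp k x i = lcomp h x i" "lcomp z k i = lcomp z h i"
      using that by (intro lcomp_cong; simp add: kB')+
    then show ?thesis using h(1) that by (simp add: twine_def kB')
  qed
  ultimately have "twine (B \<union> B') (A \<union> A') k z x" using b unfolding twine_def by (metis UnE)
  then show ?thesis by (rule exI[of _ k])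
qed

text \<open>A line or a link is conjugated to any line or link of its kind, together with its whole
  block. Labels of equal parity are matched by a translation by half their difference.\<close>

lemma twine_block:
  assumes "conf B z" "conf A x" "i \<in> B" "j \<in> A" "lkind x j = lkind z i"
  shows "\<exists>C D g. i \<in> C \<and> finite C \<and> C \<subseteq> B \<and> D \<subseteq> A \<and> conf C z \<and> conf D x \<and> twine C D g z x
    \<and> (\<forall>q. card (kset C z q) = card (kset D x q))"
proof (cases rule: lkind_cases[OF assms(1,3)])
  case 1
  have x: "x j = (j, 1, 0)" using lkind0D[OF assms(2,4)] assms(5) 1(1) by simp
  have "twine {i} {j} (\<lambda>_. (j, 1, 0)) z x"
    by (simp add: twine_def bij_betw_def lcomp_def x 1)
  moreover have "\<forall>q. card (kset {i} z q) = card (kset {j} x q)"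
    using card_kset_insert[of "{}" i z] card_kset_insert[of "{}" j x] assms(5) by simp
  moreover have "conf {i} z" "conf {j} x" using conf_fix[OF assms(1,3)] conf_fix[OF assms(2,4)] 1 x by simp_all
  ultimately show ?thesis using assms(3,4) by (intro exI[of _ "{i}"] exI[of _ "{j}"]) auto
next
  case (2 c)
  have k: "lkind z i = 1 \<or> lkind z i = 2" using 2(1) by simp
  obtain d where d: "x j = (j, -1, d)" "even d \<longleftrightarrow> lkind z i = 1"
    using lkind12D[OF assms(2,4,5)] k by metis
  have "even (d - c)" using d(2) 2(1) by (auto split: if_splits)
  then have "c + 2 * ((d - c) div 2) = d" by simp
  then have "twine {i} {j} (\<lambda>_. (j, 1, (d - c) div 2)) z x"
    by (simp add: twine_def bij_betw_def lcomp_def d 2)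
  moreover have "\<forall>q. card (kset {i} z q) = card (kset {j} x q)"
    using card_kset_insert[of "{}" i z] card_kset_insert[of "{}" j x] assms(5) by simp
  moreover have "conf {i} z" "conf {j} x" using conf_fix[OF assms(1,3)] conf_fix[OF assms(2,4)] 2 d by simp_all
  ultimately show ?thesis using assms(3,4) by (intro exI[of _ "{i}"] exI[of _ "{j}"]) auto
next
  case (3 i' s v)
  then obtain j' t w where x: "x j = (j', t, w)" "j' \<in> A" "j' \<noteq> j" "t = 1 \<or> t = -1" "x j' = (j, t, - t * w)" "lkind x j' = 3"
    using lkind3D[OF assms(2,4)] assms(5) by auto
  \<comment> \<open>The value at \<open>i\<close> is a free choice; the one at \<open>i'\<close> is
    then forced by the two links.\<close>
  let ?g = "\<lambda>k. if k = i then (j, 1, 0) else (j', s * t, w - s * t * v)"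
  have "bij_betw (\<lambda>k. fst (?g k)) {i, i'} {j, j'}" using 3(4) x(3) by (auto simp: bij_betw_def)
  moreover have "lcomp ?g x i = lcomp z ?g i" using 3(2,4,5) x(1,4) by (auto simp: lcomp_def)
  moreover have "lcomp ?g x i' = lcomp z ?g i'" using 3(2,4-6) x(4,5) by (auto simp: lcomp_def algebra_simps)
  ultimately have "twine {i, i'} {j, j'} ?g z x" using 3(5) x(4) by (auto simp: twine_def)
  moreover have "\<forall>q. card (kset {i, i'} z q) = card (kset {j, j'} x q)"
    using card_kset_insert[of "{i'}" i z] card_kset_insert[of "{j'}" j x]
      card_kset_insert[of "{}" i' z] card_kset_insert[of "{}" j' x] assms(5) 3(1,4,7) x(3,6) by simp
  moreover have "conf {i, i'} z" "conf {j, j'} x" using conf_pair[OF assms(1,3) 3(2)] conf_pair[OF assms(2,4) x(1)] .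
  ultimately show ?thesis using assms(3,4) 3(3) x(2) by (intro exI[of _ "{i, i'}"] exI[of _ "{j, j'}"]) auto
qed

lemma sim_twine:
  assumes "finite A" "finite B" "conf A x" "conf B z" "\<And>q. card (kset A x q) = card (kset B z q)"
  shows "\<exists>g. twine B A g z x"
  using assms
proof (induction "card B" arbitrary: A B rule: less_induct)
  case less
  show ?case
  proof (cases "B = {}")
    case True
    have "A = {}"
    proof (rule ccontr)
      assume "A \<noteq> {}"
      then obtain j where "j \<in> A" by blast
      then show False using kset_nonempty[OF less.prems(1), of j x] less.prems(5) True by simp
    qed
    then show ?thesis using True by (simp add: twine_def bij_betw_def)
  next
    case False
    then obtain i where i: "i \<in> B" by blast
    have "card (kset A x (lkind z i)) \<noteq> 0"
      using kset_nonempty[OF less.prems(2) i, of z] less.prems(5) by simp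
    then obtain j where j: "j \<in> A" "lkind x j = lkind z i" using kset_ex by blast
    obtain C D g where C: "i \<in> C" "finite C" "C \<subseteq> B" "D \<subseteq> A" "conf C z" "conf D x" "twine C D g z x"
      and k: "\<forall>q. card (kset C z q) = card (kset D x q)"
      using twine_block[OF less.prems(4,3) i j] by (elim exE conjE) simp
    have "card (B - C) < card B" using C(1,3) i less.prems(2) by (intro psubset_card_mono) auto
    moreover have "card (kset (A - D) x q) = card (kset (B - C) z q)" for q
      using card_kset_Diff[OF less.prems(1) C(4), of x q] card_kset_Diff[OF less.prems(2) C(3), of z q]
        less.prems(5)[of q] k[rule_format, of q] by simp
    ultimately obtain h where h: "twine (B - C) (A - D) h z x"
      using less.hyps[of "B - C" "A - D"] less.prems(1,2) conf_Diff[OF less.prems(3) C(6)] conf_Diff[OF less.prems(4) C(5)]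
      by auto
    have "\<exists>k. twine (C \<union> (B - C)) (D \<union> (A - D)) k z x"
      by (rule twine_Un[OF C(7,5) h conf_Diff[OF less.prems(4) C(5)]]) auto
    moreover have "C \<union> (B - C) = B" "D \<union> (A - D) = A" using C(3,4) by auto
    ultimately show ?thesis by simp
  qed
qed

text \<open>Conjugation changes the label of a reflection by a sign and by twice an offset, so
  parity, and with it the kind, is preserved.\<close>

lemma twine_sim:
  assumes "twine A A g y x" "conf A x" "conf A y"
  shows "sim A x y"
proof -
  let ?f = "\<lambda>i. fst (g i)"
  have b: "bij_betw ?f A A" using assms(1) by (simp add: twine_def)
  have k: "lkind x (?f i) = lkind y i" if i: "i \<in> A" for i
  proof -
    obtain j t w where g: "g i = (j, t, w)" by (metis prod.exhaust)
    obtain l r u where y: "y i = (l, r, u)" by (metis prod.exhaust)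
    obtain k s v where x: "x j = (k, s, v)" by (metis prod.exhaust)
    obtain m p q where gl: "g l = (m, p, q)" by (metis prod.exhaust)
    have j: "j \<in> A" using bij_betwE[OF b] i g by force
    have t: "t = 1 \<or> t = -1" using assms(1) i by (auto simp: twine_def g)
    have e: "k = m" "t * s = r * p" "s * w + v = p * u + q"
      using assms(1) i by (auto simp: twine_def lcomp_def g y x gl)
    have l: "l \<in> A" "r = 1 \<or> r = -1" using conf_link[OF assms(3) i y] by blast+
    show ?thesis
    proof (cases "l = i")
      case True
      then have m: "m = j" "p = t" "q = w" using g gl by auto
      then have s: "s = r" using e(2) t by auto
      have "even v \<longleftrightarrow> even u" if "s = -1"
      proof -
        have "v = t * u + 2 * w" using e(3) that m by simp
        then show ?thesis using t by auto
      qed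
      then show ?thesis using True e(1) m(1) s l(2) by (auto simp: lkind_def g x y)
    next
      case False
      have "m \<noteq> j" using inj_onD[OF bij_betw_imp_inj_on[OF b], of l i] False l(1) i g gl by auto
      then show ?thesis using False e(1) by (simp add: lkind_def g x y)
    qed
  qed
  have "kset A x q = ?f ` kset A y q" for q
  proof -
    have "kset A x q = {j \<in> ?f ` A. lkind x j = q}" using b by (auto simp: bij_betw_def kset_def)
    also have "\<dots> = ?f ` {i \<in> A. lkind x (?f i) = q}" by blast
    also have "\<dots> = ?f ` kset A y q" using k by (auto simp: kset_def)
    finally show ?thesis .
  qed
  moreover have "inj_on ?f (kset A y q)" for q
    using b kset_sub[of A y q] by (auto simp: bij_betw_def intro: inj_on_subset)
  ultimately show ?thesis by (simp add: sim_def card_image)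
qed

section \<open>The affine Weyl group\<close>

text \<open>The positive indices determine a signed permutation. The vector is read at the image
  line because the translation is applied after the signed permutation.\<close>

definition line_map :: "(int \<Rightarrow> int) \<times> (nat \<Rightarrow> int) \<Rightarrow> lmap" where
  "line_map x i = (nat \<bar>fst x (int i)\<bar>, sgn (fst x (int i)), snd x (nat \<bar>fst x (int i)\<bar>))"

text \<open>The inverse of \<open>line_map\<close>. The offset of \<open>g i\<close> is the
  coordinate at the image line, hence the \<open>inv_into\<close> in the vector.\<close>

definition of_lines :: "nat \<Rightarrow> lmap \<Rightarrow> (int \<Rightarrow> int) \<times> (nat \<Rightarrow> int)" where
  "of_lines n g =
     (\<lambda>z. if z \<in> signed_indices n then sgn z * (fst (snd (g (nat \<bar>z\<bar>))) * int (fst (g (nat \<bar>z\<bar>)))) else z,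
      \<lambda>k. if k \<in> {1..n} then snd (snd (g (inv_into {1..n} (\<lambda>i. fst (g i)) k))) else 0)"

lemma carrier_affine_C:
  "(\<sigma>, v) \<in> carrier (affine_C n) \<longleftrightarrow>
     \<sigma> permutes signed_indices n \<and> (\<forall>i. \<sigma> (- i) = - \<sigma> i) \<and> (\<forall>i. i \<notin> {1..n} \<longrightarrow> v i = 0)"
  by (simp add: affine_C_def signed_perm_group_def int_vectors_def)

lemma signed_perm_abs_eq:
  assumes "\<sigma> permutes signed_indices n" "\<forall>i. \<sigma> (- i) = - \<sigma> i" "\<bar>\<sigma> (int i)\<bar> = \<bar>\<sigma> (int k)\<bar>"
  shows "i = k"
proof -
  have "\<sigma> (int i) = \<sigma> (int k) \<or> \<sigma> (int i) = \<sigma> (- int k)" using assms(2,3) by (auto simp: abs_eq_iff)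
  then have "int i = int k \<or> int i = - int k" by (simp only: inj_eq[OF permutes_inj[OF assms(1)]])
  then show ?thesis by linarith
qed

lemma signed_perm_mem:
  assumes "\<sigma> permutes signed_indices n" "i \<in> {1..n}"
  shows "nat \<bar>\<sigma> (int i)\<bar> \<in> {1..n}" "sgn (\<sigma> (int i)) = 1 \<or> sgn (\<sigma> (int i)) = -1"
proof -
  have "int i \<in> signed_indices n" using assms(2) by (auto simp: signed_indices_def)
  then have "\<sigma> (int i) \<in> signed_indices n" using permutes_in_image[OF assms(1)] by blast
  then show "nat \<bar>\<sigma> (int i)\<bar> \<in> {1..n}" "sgn (\<sigma> (int i)) = 1 \<or> sgn (\<sigma> (int i)) = -1"
    by (auto simp: signed_indices_def sgn_if)
qed

lemma signed_perm_act_line: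
  assumes "\<sigma> permutes signed_indices n" "\<forall>i. \<sigma> (- i) = - \<sigma> i" "i \<in> {1..n}"
  shows "signed_perm_act n v \<sigma> (nat \<bar>\<sigma> (int i)\<bar>) = v i * sgn (\<sigma> (int i))"
proof -
  have "signed_perm_act n v \<sigma> (nat \<bar>\<sigma> (int i)\<bar>)
      = (\<Sum>k = 1..n. if k = i then v i * sgn (\<sigma> (int i)) else 0)"
    unfolding signed_perm_act_def
    by (intro sum.cong refl) (use signed_perm_abs_eq[OF assms(1,2)] in \<open>auto simp: signed_basis_def\<close>)
  then show ?thesis using assms(3) by simp
qed

lemma line_map_mem:
  assumes "x \<in> carrier (affine_C n)" "i \<in> {1..n}"
  shows "fst (line_map x i) \<in> {1..n}" "fst (snd (line_map x i)) = 1 \<or> fst (snd (line_map x i)) = -1"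
  using assms signed_perm_mem[of "fst x" n i] by (cases x; simp add: carrier_affine_C line_map_def)+

lemma line_map_bij:
  assumes "x \<in> carrier (affine_C n)"
  shows "bij_betw (\<lambda>i. fst (line_map x i)) {1..n} {1..n}"
proof -
  obtain \<sigma> v where x: "x = (\<sigma>, v)" by (cases x)
  have "inj_on (\<lambda>i. fst (line_map x i)) {1..n}"
  proof (rule inj_onI)
    fix i k assume "fst (line_map x i) = fst (line_map x k)"
    then have "\<bar>\<sigma> (int i)\<bar> = \<bar>\<sigma> (int k)\<bar>" by (simp add: line_map_def x)
    then show "i = k" using signed_perm_abs_eq[of \<sigma> n] assms by (simp add: x carrier_affine_C)
  qed
  moreover have "(\<lambda>i. fst (line_map x i)) ` {1..n} \<subseteq> {1..n}" using line_map_mem(1)[OF assms] by blast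
  ultimately show ?thesis by (simp add: bij_betw_def endo_inj_surj)
qed

lemma line_map_mult:
  assumes "x \<in> carrier (affine_C n)" "y \<in> carrier (affine_C n)" "i \<in> {1..n}"
  shows "line_map (x \<otimes>\<^bsub>affine_C n\<^esub> y) i = lcomp (line_map x) (line_map y) i"
proof -
  obtain \<alpha> v \<tau> u where xy: "x = (\<alpha>, v)" "y = (\<tau>, u)" by (cases x, cases y)
  have a: "\<alpha> permutes signed_indices n"
    and t: "\<tau> permutes signed_indices n" "\<forall>i. \<tau> (- i) = - \<tau> i"
    using assms(1,2) by (simp_all add: xy carrier_affine_C)
  define j where "j = nat \<bar>\<alpha> (int i)\<bar>"
  define s where "s = sgn (\<alpha> (int i))"
  have j: "j \<in> {1..n}" and s: "s = 1 \<or> s = -1" using signed_perm_mem[OF a assms(3)] by (simp_all add: j_def s_def)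
  have "\<alpha> (int i) = s * int j" by (simp add: s_def j_def sgn_mult_abs)
  then have "\<tau> (\<alpha> (int i)) = s * \<tau> (int j)" using s t(2) by auto
  then have e: "nat \<bar>\<tau> (\<alpha> (int i))\<bar> = nat \<bar>\<tau> (int j)\<bar>" "sgn (\<tau> (\<alpha> (int i))) = s * sgn (\<tau> (int j))"
    using s by (auto simp: sgn_minus)
  have "x \<otimes>\<^bsub>affine_C n\<^esub> y = (\<tau> \<circ> \<alpha>, \<lambda>k. signed_perm_act n v \<tau> k + u k)"
    by (simp add: affine_C_def signed_perm_group_def xy)
  then have 1: "line_map (x \<otimes>\<^bsub>affine_C n\<^esub> y) i
      = (nat \<bar>\<tau> (int j)\<bar>, s * sgn (\<tau> (int j)), v j * sgn (\<tau> (int j)) + u (nat \<bar>\<tau> (int j)\<bar>))"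
    by (simp add: line_map_def e signed_perm_act_line[OF t j])
  have "lcomp (line_map x) (line_map y) i
      = (nat \<bar>\<tau> (int j)\<bar>, s * sgn (\<tau> (int j)), v j * sgn (\<tau> (int j)) + u (nat \<bar>\<tau> (int j)\<bar>))"
    by (simp add: lcomp_def line_map_def xy mult.commute flip: j_def s_def)
  with 1 show ?thesis by simp
qed

lemma line_map_one: "i \<in> {1..n} \<Longrightarrow> line_map \<one>\<^bsub>affine_C n\<^esub> i = (i, 1, 0)"
  by (simp add: affine_C_def signed_perm_group_def line_map_def)

lemma line_map_inj:
  assumes "x \<in> carrier (affine_C n)" "y \<in> carrier (affine_C n)" "\<And>i. i \<in> {1..n} \<Longrightarrow> line_map x i = line_map y i"
  shows "x = y"
proof -
  obtain \<alpha> v \<tau> u where xy: "x = (\<alpha>, v)" "y = (\<tau>, u)" by (cases x, cases y)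
  have a: "\<alpha> permutes signed_indices n" "\<forall>i. \<alpha> (- i) = - \<alpha> i"
    and t: "\<tau> permutes signed_indices n" "\<forall>i. \<tau> (- i) = - \<tau> i"
    and vu: "\<forall>i. i \<notin> {1..n} \<longrightarrow> v i = 0" "\<forall>i. i \<notin> {1..n} \<longrightarrow> u i = 0"
    using assms(1,2) by (simp_all add: xy carrier_affine_C)
  have pos: "\<alpha> (int i) = \<tau> (int i)" if "i \<in> {1..n}" for i
  proof -
    have "nat \<bar>\<alpha> (int i)\<bar> = nat \<bar>\<tau> (int i)\<bar>" "sgn (\<alpha> (int i)) = sgn (\<tau> (int i))"
      using assms(3)[OF that] by (simp_all add: line_map_def xy)
    moreover from this(1) have "\<bar>\<alpha> (int i)\<bar> = \<bar>\<tau> (int i)\<bar>" by linarith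
    ultimately show ?thesis by (metis sgn_mult_abs)
  qed
  have "\<alpha> z = \<tau> z" for z
  proof (cases "z \<in> signed_indices n")
    case True
    then have m: "nat \<bar>z\<bar> \<in> {1..n}" by (auto simp: signed_indices_def)
    have "z = int (nat \<bar>z\<bar>) \<or> z = - int (nat \<bar>z\<bar>)" by auto
    then show ?thesis using pos[OF m] a(2) t(2) by metis
  next
    case False
    then show ?thesis using permutes_not_in[OF a(1)] permutes_not_in[OF t(1)] by simp
  qed
  moreover have "v k = u k" for k
  proof (cases "k \<in> {1..n}")
    case True
    then obtain i where "i \<in> {1..n}" "fst (line_map x i) = k"
      using line_map_bij[OF assms(1)] by (metis bij_betw_def imageE)
    then show ?thesis using assms(3)[of i] by (auto simp: line_map_def xy)
  next
    case False
    then show ?thesis using vu by simp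
  qed
  ultimately show ?thesis by (auto simp: xy)
qed

lemma of_lines:
  assumes b: "bij_betw (\<lambda>i. fst (g i)) {1..n} {1..n}"
    and s: "\<And>i. i \<in> {1..n} \<Longrightarrow> fst (snd (g i)) = 1 \<or> fst (snd (g i)) = -1"
  shows "of_lines n g \<in> carrier (affine_C n)" and "i \<in> {1..n} \<Longrightarrow> line_map (of_lines n g) i = g i"
proof -
  define \<sigma> where "\<sigma> = fst (of_lines n g)"
  have mem: "z \<in> signed_indices n \<longleftrightarrow> nat \<bar>z\<bar> \<in> {1..n}" for z by (auto simp: signed_indices_def)
  have sg: "\<sigma> z = sgn z * (fst (snd (g (nat \<bar>z\<bar>))) * int (fst (g (nat \<bar>z\<bar>))))" if "z \<in> signed_indices n" for z
    using that by (simp add: \<sigma>_def of_lines_def)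
  have im: "fst (g i) \<in> {1..n}" if "i \<in> {1..n}" for i using b that by (rule bij_betwE[rule_format])
  have ab: "nat \<bar>\<sigma> z\<bar> = fst (g (nat \<bar>z\<bar>))" if "z \<in> signed_indices n" for z
  proof -
    have "z \<noteq> 0" using that by (simp add: signed_indices_def)
    then show ?thesis using s[of "nat \<bar>z\<bar>"] that mem[of z] by (auto simp: sg abs_mult)
  qed
  have sn: "sgn (\<sigma> z) = sgn z * fst (snd (g (nat \<bar>z\<bar>)))" if "z \<in> signed_indices n" for z
    using s[of "nat \<bar>z\<bar>"] im[of "nat \<bar>z\<bar>"] that mem[of z] by (auto simp: sg sgn_mult sgn_minus)
  have inj: "inj_on \<sigma> (signed_indices n)"
  proof (rule inj_onI)
    fix z w assume zw: "z \<in> signed_indices n" "w \<in> signed_indices n" "\<sigma> z = \<sigma> w"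
    have "fst (g (nat \<bar>z\<bar>)) = fst (g (nat \<bar>w\<bar>))" using ab[OF zw(1)] ab[OF zw(2)] zw(3) by simp
    then have e: "nat \<bar>z\<bar> = nat \<bar>w\<bar>"
      using inj_onD[OF bij_betw_imp_inj_on[OF b]] zw(1,2) mem by blast
    have "sgn z = sgn w" using sn[OF zw(1)] sn[OF zw(2)] zw(3) e s[of "nat \<bar>w\<bar>"] zw(2) mem[of w] by auto
    moreover have "\<bar>z\<bar> = \<bar>w\<bar>" using e by linarith
    ultimately show "z = w" by (metis sgn_mult_abs)
  qed
  have "\<sigma> z \<in> signed_indices n" if "z \<in> signed_indices n" for z
  proof -
    have "nat \<bar>z\<bar> \<in> {1..n}" using that mem[of z] by (rule iffD1[rotated])
    then show ?thesis using im[of "nat \<bar>z\<bar>"] unfolding mem[of "\<sigma> z"] ab[OF that] by blast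
  qed
  then have "\<sigma> ` signed_indices n \<subseteq> signed_indices n" by (rule image_subsetI)
  moreover have "finite (signed_indices n)"
    by (rule finite_subset[of _ "{- int n..int n}"]) (auto simp: signed_indices_def)
  ultimately have "bij_betw \<sigma> (signed_indices n) (signed_indices n)"
    using inj by (simp add: bij_betw_def endo_inj_surj)
  then have "\<sigma> permutes signed_indices n"
    by (rule bij_imp_permutes) (simp add: \<sigma>_def of_lines_def)
  moreover have "\<sigma> (- z) = - \<sigma> z" for z
    using mem[of z] mem[of "- z"] by (simp add: \<sigma>_def of_lines_def sgn_minus)
  ultimately show "of_lines n g \<in> carrier (affine_C n)"
    by (simp add: of_lines_def carrier_affine_C \<sigma>_def)
  show "line_map (of_lines n g) i = g i" if i: "i \<in> {1..n}"
  proof -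
    have m: "int i \<in> signed_indices n" using i by (auto simp: signed_indices_def)
    have "inv_into {1..n} (\<lambda>i. fst (g i)) (fst (g i)) = i"
      using inv_into_f_f[OF bij_betw_imp_inj_on[OF b] i] .
    then have "snd (of_lines n g) (fst (g i)) = snd (snd (g i))" using im[OF i] by (simp add: of_lines_def)
    moreover have "nat \<bar>fst (of_lines n g) (int i)\<bar> = fst (g i)" "sgn (fst (of_lines n g) (int i)) = fst (snd (g i))"
      using ab[OF m] sn[OF m] i by (simp_all add: \<sigma>_def)
    ultimately show ?thesis by (simp add: line_map_def)
  qed
qed

section \<open>Conjugacy classes in an arbitrary group\<close>

lemma conjugacy_class_eq:
  assumes "X \<in> conjugacy_classes G"
  obtains c where "c \<in> carrier G" "X = {h \<otimes>\<^bsub>G\<^esub> c \<otimes>\<^bsub>G\<^esub> inv\<^bsub>G\<^esub> h | h. h \<in> carrier G}"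
  using assms that by (auto simp: conjugacy_classes_def orbits_def Group_Action.orbit_def)

lemma conjugacy_class_sub:
  assumes "group G" "X \<in> conjugacy_classes G"
  shows "X \<subseteq> carrier G"
proof -
  interpret group G by fact
  show ?thesis using assms(2) by (elim conjugacy_class_eq) auto
qed

lemma conjugacy_class_conjugate:
  assumes "group G" "X \<in> conjugacy_classes G" "x \<in> X" "y \<in> X"
  shows "\<exists>g\<in>carrier G. g \<otimes>\<^bsub>G\<^esub> x = y \<otimes>\<^bsub>G\<^esub> g"
proof -
  interpret group G by fact
  obtain c where "c \<in> carrier G" and X: "X = {h \<otimes>\<^bsub>G\<^esub> c \<otimes>\<^bsub>G\<^esub> inv\<^bsub>G\<^esub> h | h. h \<in> carrier G}"
    using assms(2) by (rule conjugacy_class_eq)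
  then obtain a b where c: "c \<in> carrier G" "a \<in> carrier G" "b \<in> carrier G"
    and x: "x = a \<otimes>\<^bsub>G\<^esub> c \<otimes>\<^bsub>G\<^esub> inv\<^bsub>G\<^esub> a" and y: "y = b \<otimes>\<^bsub>G\<^esub> c \<otimes>\<^bsub>G\<^esub> inv\<^bsub>G\<^esub> b"
    using assms(3,4) by blast
  have "inv\<^bsub>G\<^esub> a \<otimes>\<^bsub>G\<^esub> x = c \<otimes>\<^bsub>G\<^esub> inv\<^bsub>G\<^esub> a" using c by (simp add: x m_assoc inv_solve_left')
  moreover have "y \<otimes>\<^bsub>G\<^esub> b = b \<otimes>\<^bsub>G\<^esub> c" using c by (simp add: y m_assoc)
  ultimately have "(b \<otimes>\<^bsub>G\<^esub> inv\<^bsub>G\<^esub> a) \<otimes>\<^bsub>G\<^esub> x = y \<otimes>\<^bsub>G\<^esub> (b \<otimes>\<^bsub>G\<^esub> inv\<^bsub>G\<^esub> a)"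
    using c x y by (metis inv_closed m_assoc m_closed)
  then show ?thesis using c by blast
qed

lemma conjugacy_class_closed:
  assumes "group G" "X \<in> conjugacy_classes G" "x \<in> X" "y \<in> carrier G" "g \<in> carrier G"
    and "g \<otimes>\<^bsub>G\<^esub> x = y \<otimes>\<^bsub>G\<^esub> g"
  shows "y \<in> X"
proof -
  interpret group G by fact
  obtain c where "c \<in> carrier G" and X: "X = {h \<otimes>\<^bsub>G\<^esub> c \<otimes>\<^bsub>G\<^esub> inv\<^bsub>G\<^esub> h | h. h \<in> carrier G}"
    using assms(2) by (rule conjugacy_class_eq)
  then obtain a where c: "c \<in> carrier G" "a \<in> carrier G" and x: "x = a \<otimes>\<^bsub>G\<^esub> c \<otimes>\<^bsub>G\<^esub> inv\<^bsub>G\<^esub> a"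
    using assms(3) by blast
  have "y = g \<otimes>\<^bsub>G\<^esub> x \<otimes>\<^bsub>G\<^esub> inv\<^bsub>G\<^esub> g"
    using assms(4-6) c by (simp add: x m_assoc)
  also have "\<dots> = (g \<otimes>\<^bsub>G\<^esub> a) \<otimes>\<^bsub>G\<^esub> c \<otimes>\<^bsub>G\<^esub> inv\<^bsub>G\<^esub> (g \<otimes>\<^bsub>G\<^esub> a)"
    using assms(5) c by (simp add: x m_assoc inv_mult_group)
  finally show ?thesis using assms(5) c X by blast
qed

section \<open>Passing between the commuting graph and arrangements of lines\<close>

lemma line_map_conf:
  assumes "involution (affine_C n) x"
  shows "conf {1..n} (line_map x)"
proof -
  interpret group "affine_C n" by (rule group_affine_C)
  have x: "x \<in> carrier (affine_C n)" "ord x = 2" using assms by (simp_all add: involution_def)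
  have "x [^]\<^bsub>affine_C n\<^esub> (2::nat) = \<one>\<^bsub>affine_C n\<^esub>" using pow_ord_eq_1[OF x(1)] x(2) by simp
  then have "x \<otimes>\<^bsub>affine_C n\<^esub> x = \<one>\<^bsub>affine_C n\<^esub>" using x(1) by (simp add: numeral_2_eq_2)
  then have "lcomp (line_map x) (line_map x) i = (i, 1, 0)" if "i \<in> {1..n}" for i
    using line_map_mult[OF x(1,1) that] line_map_one[OF that] by simp
  then show ?thesis using line_map_mem[OF x(1)] by (simp add: conf_def)
qed

lemma line_map_commute:
  assumes "x \<in> carrier (affine_C n)" "y \<in> carrier (affine_C n)"
  shows "x \<otimes>\<^bsub>affine_C n\<^esub> y = y \<otimes>\<^bsub>affine_C n\<^esub> x \<longleftrightarrow>
    (\<forall>i\<in>{1..n}. lcomp (line_map x) (line_map y) i = lcomp (line_map y) (line_map x) i)"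
proof -
  interpret group "affine_C n" by (rule group_affine_C)
  show ?thesis
  proof
    assume "x \<otimes>\<^bsub>affine_C n\<^esub> y = y \<otimes>\<^bsub>affine_C n\<^esub> x"
    then show "\<forall>i\<in>{1..n}. lcomp (line_map x) (line_map y) i = lcomp (line_map y) (line_map x) i"
      using line_map_mult[OF assms] line_map_mult[OF assms(2,1)] by simp
  next
    assume *: "\<forall>i\<in>{1..n}. lcomp (line_map x) (line_map y) i = lcomp (line_map y) (line_map x) i"
    show "x \<otimes>\<^bsub>affine_C n\<^esub> y = y \<otimes>\<^bsub>affine_C n\<^esub> x"
      by (rule line_map_inj[of _ n]) (use * assms line_map_mult[OF assms] line_map_mult[OF assms(2,1)] in simp_all)
  qed
qed

lemma class_sim:
  assumes "X \<in> conjugacy_classes (affine_C n)" "\<forall>x\<in>X. involution (affine_C n) x" "x \<in> X" "y \<in> X"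
  shows "sim {1..n} (line_map x) (line_map y)"
proof -
  note G = group_affine_C[of n]
  have c: "x \<in> carrier (affine_C n)" "y \<in> carrier (affine_C n)"
    using conjugacy_class_sub[OF G assms(1)] assms(3,4) by blast+
  obtain g where g: "g \<in> carrier (affine_C n)" "g \<otimes>\<^bsub>affine_C n\<^esub> x = y \<otimes>\<^bsub>affine_C n\<^esub> g"
    using conjugacy_class_conjugate[OF G assms(1,3,4)] by blast
  have "lcomp (line_map g) (line_map x) i = lcomp (line_map y) (line_map g) i" if "i \<in> {1..n}" for i
    using line_map_mult[OF g(1) c(1) that] line_map_mult[OF c(2) g(1) that] g(2) by simp
  then have "twine {1..n} {1..n} (line_map g) (line_map y) (line_map x)"
    using line_map_bij[OF g(1)] line_map_mem(2)[OF g(1)] by (simp add: twine_def)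
  then show ?thesis using twine_sim line_map_conf assms(2-4) by blast
qed

lemma of_lines_conf:
  assumes "conf {1..n} z"
  shows "of_lines n z \<in> carrier (affine_C n)" and "i \<in> {1..n} \<Longrightarrow> line_map (of_lines n z) i = z i"
proof -
  have "fst (z (fst (z i))) = i" if "i \<in> {1..n}" for i
    using conf_link(3)[OF assms that, of "fst (z i)" "fst (snd (z i))" "snd (snd (z i))"] by simp
  then have "bij_betw (\<lambda>i. fst (z i)) {1..n} {1..n}"
    using assms by (intro bij_betw_byWitness[where f' = "\<lambda>i. fst (z i)"]) (simp_all add: conf_def image_subset_iff)
  moreover have "fst (snd (z i)) = 1 \<or> fst (snd (z i)) = -1" if "i \<in> {1..n}" for i
    using assms that by (simp add: conf_def)
  ultimately show "of_lines n z \<in> carrier (affine_C n)" "i \<in> {1..n} \<Longrightarrow> line_map (of_lines n z) i = z i"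
    using of_lines by blast+
qed

text \<open>The conjugating line map from \<open>sim_twine\<close> lifts to the group by
  \<open>of_lines\<close>; thus all intermediate arrangements of a path are vertices of the
  graph.\<close>

lemma class_mem:
  assumes "X \<in> conjugacy_classes (affine_C n)" "\<forall>x\<in>X. involution (affine_C n) x" "x \<in> X"
    and "conf {1..n} z" "sim {1..n} (line_map x) z"
  shows "of_lines n z \<in> X"
proof -
  note G = group_affine_C[of n]
  interpret group "affine_C n" by (rule G)
  have x: "x \<in> carrier (affine_C n)" using conjugacy_class_sub[OF G assms(1)] assms(3) by blast
  note z = of_lines_conf[OF assms(4)]
  have "conf {1..n} (line_map x)" using line_map_conf assms(2,3) by blast
  then obtain g where g: "twine {1..n} {1..n} g z (line_map x)"
    using sim_twine[of "{1..n}" "{1..n}" "line_map x" z] assms(4,5) by (auto simp: sim_def)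
  have b: "bij_betw (\<lambda>i. fst (g i)) {1..n} {1..n}" using g by (simp add: twine_def)
  have s: "fst (snd (g i)) = 1 \<or> fst (snd (g i)) = -1" if "i \<in> {1..n}" for i using g that by (simp add: twine_def)
  let ?g = "of_lines n g" and ?z = "of_lines n z"
  have gc: "?g \<in> carrier (affine_C n)" and gl: "\<And>i. i \<in> {1..n} \<Longrightarrow> line_map ?g i = g i"
    using of_lines[OF b s] by blast+
  have "?g \<otimes>\<^bsub>affine_C n\<^esub> x = ?z \<otimes>\<^bsub>affine_C n\<^esub> ?g"
  proof (rule line_map_inj[of _ n])
    fix i assume i: "i \<in> {1..n}"
    have "fst (z i) \<in> {1..n}" using assms(4) i by (simp add: conf_def)
    then have "lcomp (line_map ?z) (line_map ?g) i = lcomp z g i" using z(2)[OF i] gl by (intro lcomp_cong) simp_all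
    moreover have "lcomp (line_map ?g) (line_map x) i = lcomp g (line_map x) i" using gl[OF i] by (intro lcomp_cong) simp_all
    moreover have "lcomp g (line_map x) i = lcomp z g i" using g i by (simp add: twine_def)
    ultimately show "line_map (?g \<otimes>\<^bsub>affine_C n\<^esub> x) i = line_map (?z \<otimes>\<^bsub>affine_C n\<^esub> ?g) i"
      using line_map_mult[OF gc x i] line_map_mult[OF z(1) gc i] by simp
  qed (use gc x z(1) in simp_all)
  then show ?thesis using conjugacy_class_closed[OF G assms(1,3) z(1) gc] by blast
qed

text \<open>Moves that change nothing yield no arc and are dropped, so the walk may be shorter than
  \<open>k\<close>.\<close>

lemma reach_awalk:
  assumes "X \<in> conjugacy_classes (affine_C n)" "\<forall>x\<in>X. involution (affine_C n) x" "x \<in> X" "y \<in> X"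
    and "reach {1..n} k (line_map x) (line_map y)"
  shows "\<exists>p. pre_digraph.awalk (commuting_graph (affine_C n) X) x p y \<and> length p \<le> k"
proof -
  let ?G = "affine_C n"
  interpret pair_wf_digraph "commuting_graph ?G X" by (rule pair_wf_digraph_commuting_graph)
  note sub = conjugacy_class_sub[OF group_affine_C[of n] assms(1)]
  have verts: "pverts (commuting_graph ?G X) = X"
    and arcs: "(u, v) \<in> parcs (commuting_graph ?G X) \<longleftrightarrow> u \<in> X \<and> v \<in> X \<and> u \<noteq> v \<and> u \<otimes>\<^bsub>?G\<^esub> v = v \<otimes>\<^bsub>?G\<^esub> u" for u v
    by (simp_all add: commuting_graph_def)
  show ?thesis
    using assms(3,5)
  proof (induction k arbitrary: x)
    case 0
    then have "x = y" using line_map_inj[of x n y] sub assms(4) by (auto simp: reach.simps)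
    then have "awalk x [] y" using assms(4) by (simp add: awalk_Nil_iff verts)
    then show ?case by (intro exI[of _ "[]"]) simp
  next
    case (Suc k)
    then obtain z where z: "step {1..n} (line_map x) z" "reach {1..n} k z (line_map y)" by (auto simp: reach.simps)
    note c = step_conf[OF z(1)]
    let ?w = "of_lines n z"
    have w: "?w \<in> X" using class_mem[OF assms(1,2) Suc.prems(1) c(2,3)] .
    note l = of_lines_conf(2)[OF c(2)]
    have "reach {1..n} k (line_map ?w) (line_map y)"
      using reach_cong_left[OF z(2)] l by simp
    then obtain p where p: "awalk ?w p y" "length p \<le> k" using Suc.IH[OF w] by blast
    show ?case
    proof (cases "?w = x")
      case True
      then show ?thesis using p by (intro exI[of _ p]) simp
    next
      case False
      have "lcomp (line_map x) (line_map ?w) i = lcomp (line_map ?w) (line_map x) i" if i: "i \<in> {1..n}" for i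
      proof -
        have "fst (line_map x i) \<in> {1..n}" using c(1) i by (simp add: conf_def)
        then have "lcomp (line_map x) (line_map ?w) i = lcomp (line_map x) z i" using l by (intro lcomp_cong) simp_all
        moreover have "lcomp (line_map ?w) (line_map x) i = lcomp z (line_map x) i" using l[OF i] by (intro lcomp_cong) simp_all
        ultimately show ?thesis using step_comm[OF z(1) i] by simp
      qed
      then have "x \<otimes>\<^bsub>?G\<^esub> ?w = ?w \<otimes>\<^bsub>?G\<^esub> x" using line_map_commute[of x n ?w] sub w Suc.prems(1) by blast
      then have "awalk x ((x, ?w) # p) y"
        using p(1) w Suc.prems(1) False by (simp add: awalk_Cons_iff arcs)
      then show ?thesis using p(2) by (intro exI[of _ "(x, ?w) # p"]) simp
    qed
  qed
qed

lemma reachable_reach: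
  assumes "X \<in> conjugacy_classes (affine_C n)" "\<forall>x\<in>X. involution (affine_C n) x"
    and "x \<rightarrow>\<^sup>*\<^bsub>with_proj (commuting_graph (affine_C n) X)\<^esub> y"
  shows "\<exists>k. reach {1..n} k (line_map x) (line_map y)"
proof -
  interpret pair_wf_digraph "commuting_graph (affine_C n) X" by (rule pair_wf_digraph_commuting_graph)
  note sub = conjugacy_class_sub[OF group_affine_C[of n] assms(1)]
  show ?thesis
    using assms(3)
  proof (induction rule: converse_reachable_induct)
    case base
    then have "y \<in> X" by (simp add: commuting_graph_def)
    then have "reach {1..n} 0 (line_map y) (line_map y)" using line_map_conf assms(2) by (simp add: reach.simps)
    then show ?case ..
  next
    case (step u w)
    then have "u \<in> X" "w \<in> X" "u \<otimes>\<^bsub>affine_C n\<^esub> w = w \<otimes>\<^bsub>affine_C n\<^esub> u"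
      by (simp_all add: commuting_graph_def)
    moreover from this have "sim {1..n} (line_map u) (line_map w)" using class_sim[OF assms(1,2)] by blast
    moreover have "conf {1..n} (line_map u)" "conf {1..n} (line_map w)"
      using line_map_conf assms(2) \<open>u \<in> X\<close> \<open>w \<in> X\<close> by blast+
    ultimately have "step {1..n} (line_map u) (line_map w)"
      using line_map_commute[of u n w] sub unfolding step_def by blast
    then show ?case using step.IH by (metis reach.simps(2))
  qed
qed

theorem theorem1p1:
  fixes n :: nat and X :: "((int \<Rightarrow> int) \<times> (nat \<Rightarrow> int)) set"
  assumes "n \<ge> 2"
    and "X \<in> conjugacy_classes (affine_C n)"
    and "\<forall>x\<in>X. involution (affine_C n) x"
    and "connected (commuting_graph (affine_C n) X)"
  shows "graph_diameter (commuting_graph (affine_C n) X) \<le> ereal (real n + 2)"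
proof -
  let ?D = "commuting_graph (affine_C n) X" and ?A = "{1..n}"
  interpret pair_wf_digraph ?D by (rule pair_wf_digraph_commuting_graph)
  have verts: "verts (with_proj ?D) = X" by (simp add: commuting_graph_def)
  have joined: "\<exists>k. reach ?A k (line_map x) (line_map y)" if "x \<in> X" "y \<in> X" for x y
  proof (rule reachable_reach[OF assms(2,3)])
    \<comment> \<open>Connectedness refers to the symmetric closure, which has the same reachability
      because the graph is symmetric.\<close>
    have "x \<rightarrow>\<^sup>*\<^bsub>mk_symmetric ?D\<^esub> y"
      using assms(4) that by (auto simp: connected_def strongly_connected_def commuting_graph_def)
    then show "x \<rightarrow>\<^sup>*\<^bsub>?D\<^esub> y" by (simp only: reachable_mk_symmetric_eq[OF symmetric_commuting_graph])
  qed
  have "graph_dist ?D x y \<le> ereal (real n + 2)" if xy: "x \<in> X" "y \<in> X" for x y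
  proof -
    have c: "conf ?A (line_map x)" "conf ?A (line_map y)" using line_map_conf assms(3) xy by blast+
    let ?k = "\<lambda>q. card (kset ?A (line_map x) q)"
    \<comment> \<open>This is where connectedness enters: for a class that is not
      \<open>good\<close>, an invariant gives a vertex that cannot be reached from
      \<open>x\<close>.\<close>
    have "good (?k 3) (?k 1) (?k 2) (?k 0)"
    proof (rule ccontr)
      assume "\<not> good (?k 3) (?k 1) (?k 2) (?k 0)"
      then have "separated ?A (line_map x)"
        using not_good_separated[of ?A "line_map x"] c(1) assms(1) by simp
      then obtain z where z: "conf ?A z" "sim ?A (line_map x) z" "\<And>k. \<not> reach ?A k (line_map x) z"
        unfolding separated_def by blast
      obtain k where "reach ?A k (line_map x) (line_map (of_lines n z))"
        using joined[OF xy(1) class_mem[OF assms(2,3) xy(1) z(1,2)]] by blast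
      then have "reach ?A k (line_map x) z"
        using reach_cong_right of_lines_conf(2)[OF z(1)] by metis
      then show False using z(3) by blast
    qed
    then have "reach ?A (card ?A + 2) (line_map x) (line_map y)"
      using good_reach c class_sim[OF assms(2,3) xy] by blast
    then obtain p where p: "awalk x p y" "length p \<le> n + 2"
      using reach_awalk[OF assms(2,3) xy] by auto
    have "awalk_cost (\<lambda>_. 1) p = real (length p)" by (induction p) simp_all
    then have "graph_dist ?D x y \<le> ereal (real (length p))"
      using min_cost_le_walk_cost[OF p(1), of "\<lambda>_. 1"] by (simp add: graph_dist_def)
    also have "\<dots> \<le> ereal (real n + 2)" using p(2) by simp
    finally show ?thesis .
  qed
  then show ?thesis unfolding graph_diameter_def verts by (intro SUP_least)
qed

end
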